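(* Let $\Gamma$ be an amenable discrete group and $\mathsf{A}=C^*(\Gamma)\approx C(\hat\Gamma)$. There is a one-to-one correspondence between idempotent states on $\mathsf{A}$ and subgroups of $\Gamma$. An idempotent state $\phi\in\mathsf{A}^*$ is a Haar idempotent if and only if the corresponding subgroup of $\Gamma$ is normal.
   Context: $C^*(\Gamma)$ is the group $C^*$-algebra of $\Gamma$ (universal and reduced versions coincide by amenability), generated by the canonical unitaries $\lambda_\gamma$, $\gamma\in\Gamma$, with coproduct $\Delta(\lambda_\gamma)=\lambda_\gamma\otimes\lambda_\gamma$; it is regarded as the algebra $C(\hat\Gamma)$ of continuous functions on a compact quantum group denoted $\hat\Gamma$. A compact quantum group $\mathbb{G}$ is given by a unital $C^*$-algebra $C(\mathbb{G})$ with a coassociative unital $*$-homomorphism $\Delta:C(\mathbb{G})\to C(\mathbb{G})\otimes C(\mathbb{G})$ (spatial tensor product) satisfying $\overline{\mathrm{Lin}}((1\otimes C(\mathbb{G}))\Delta(C(\mathbb{G})))=\overline{\mathrm{Lin}}((C(\mathbb{G})\otimes1)\Delta(C(\mathbb{G})))=C(\mathbb{G})\otimes C(\mathbb{G})$. Its Haar state $h_{\mathbb{G}}$ is the unique state with $(h_{\mathbb{G}}\otimes\mathrm{id})\Delta(a)=(\mathrm{id}\otimes h_{\mathbb{G}})\Delta(a)=h_{\mathbb{G}}(a)1$ for all $a\in C(\mathbb{G})$; by standing convention Haar states of the compact quantum groups considered are faithful. A state $\phi$ on $C(\mathbb{G})$ is idempotent if $(\phi\otimes\phi)\circ\Delta=\phi$.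 A quantum subgroup of $\mathbb{G}$ is a pair $(\mathbb{G}',j)$ with $\mathbb{G}'$ a compact quantum group and $j:C(\mathbb{G})\to C(\mathbb{G}')$ a surjective unital $*$-homomorphism satisfying $\Delta_{C(\mathbb{G}')}\circ j=(j\otimes j)\circ\Delta_{C(\mathbb{G})}$. A Haar idempotent on $\mathbb{G}$ is a state of the form $h_{\mathbb{G}'}\circ j$ for a quantum subgroup $(\mathbb{G}',j)$ of $\mathbb{G}$. *)

theory Defs
  imports "HOL-Analysis.Analysis" "HOL-Algebra.Coset" "HOL-Library.Nonpos_Ints"
begin

section \<open>Complex normed spaces and the Hilbert spaces \<open>\<ell>\<^sup>2(X)\<close>\<close>

class complex_normed_vector = real_normed_vector +
  fixes scaleC :: "complex \<Rightarrow> 'a \<Rightarrow> 'a"  (infixr \<open>*\<^sub>C\<close> 75)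
  assumes scaleC_add_right: "c *\<^sub>C (x + y) = c *\<^sub>C x + c *\<^sub>C y"
    and scaleC_add_left: "(c + d) *\<^sub>C x = c *\<^sub>C x + d *\<^sub>C x"
    and scaleC_scaleC: "c *\<^sub>C d *\<^sub>C x = (c * d) *\<^sub>C x"
    and scaleC_of_real: "complex_of_real r *\<^sub>C x = r *\<^sub>R x"
    and norm_scaleC: "norm (c *\<^sub>C x) = cmod c * norm x"

global_interpretation complex_vector: vector_space "scaleC :: complex \<Rightarrow> 'a \<Rightarrow> 'a::complex_normed_vector"
  defines cspan = complex_vector.span
proof
  show "1 *\<^sub>C x = x" for x :: 'a
    using scaleC_of_real[of 1 x] by simp
qed (simp_all add: scaleC_add_right scaleC_add_left scaleC_scaleC)

instantiation complex :: complex_normed_vector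
begin
definition scaleC_complex :: "complex \<Rightarrow> complex \<Rightarrow> complex"
  where "scaleC_complex c z = c * z"
instance
  by standard (simp_all add: scaleC_complex_def algebra_simps norm_mult scaleR_conv_of_real)
end

instantiation blinfun :: (real_normed_vector, complex_normed_vector) complex_normed_vector
begin
lift_definition scaleC_blinfun :: "complex \<Rightarrow> ('a \<Rightarrow>\<^sub>L 'b) \<Rightarrow> ('a \<Rightarrow>\<^sub>L 'b)" is "\<lambda>c T x. c *\<^sub>C T x"
proof -
  fix c and T :: "'a \<Rightarrow> 'b"
  assume "bounded_linear T"
  then interpret bounded_linear T .
  obtain K where "\<And>x. norm (T x) \<le> norm x * K"
    using bounded by blast
  then have "cmod c * norm (T x) \<le> cmod c * (norm x * K)" for x
    by (simp add: mult_left_mono)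
  then have "norm (c *\<^sub>C T x) \<le> norm x * (cmod c * K)" for x
    by (simp add: norm_scaleC mult.left_commute)
  moreover have "c *\<^sub>C T (r *\<^sub>R x) = r *\<^sub>R c *\<^sub>C T x" for r x
    unfolding scaleR by (simp add: scaleC_scaleC mult.commute flip: scaleC_of_real)
  ultimately show "bounded_linear (\<lambda>x. c *\<^sub>C T x)"
    by (intro bounded_linear_intro[where K = "cmod c * K"]) (simp_all add: add scaleC_add_right)
qed
instance
proof
  fix c d :: complex and r :: real and S T :: "'a \<Rightarrow>\<^sub>L 'b"
  show "c *\<^sub>C (S + T) = c *\<^sub>C S + c *\<^sub>C T"
    by transfer (simp add: scaleC_add_right)
  show "(c + d) *\<^sub>C T = c *\<^sub>C T + d *\<^sub>C T"
    by transfer (simp add: scaleC_add_left)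
  show "c *\<^sub>C d *\<^sub>C T = (c * d) *\<^sub>C T"
    by transfer (simp add: scaleC_scaleC)
  show "complex_of_real r *\<^sub>C T = r *\<^sub>R T"
    by transfer (simp add: scaleC_of_real)
  have le: "norm (c *\<^sub>C T) \<le> cmod c * norm T" for c and T :: "'a \<Rightarrow>\<^sub>L 'b"
  proof (rule norm_blinfun_bound)
    show "norm ((c *\<^sub>C T) x) \<le> cmod c * norm T * norm x" for x
      by (simp add: scaleC_blinfun.rep_eq norm_scaleC mult.assoc mult_left_mono norm_blinfun)
  qed simp
  show "norm (c *\<^sub>C T) = cmod c * norm T"
  proof (cases "c = 0")
    case True
    then show ?thesis using le[of 0 T] by simp
  next
    case False
    have "(1 / c) *\<^sub>C c *\<^sub>C T = T"
      using False by transfer (simp add: scaleC_scaleC)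
    then have "norm T \<le> cmod (1 / c) * norm (c *\<^sub>C T)"
      using le[of "1 / c" "c *\<^sub>C T"] by simp
    then have "cmod c * norm T \<le> norm (c *\<^sub>C T)"
      using False by (simp add: norm_divide field_simps)
    then show ?thesis using le[of c T] by simp
  qed
qed
end

typedef 'x ell2 = "{f :: 'x \<Rightarrow> complex. (\<lambda>x. (cmod (f x))\<^sup>2) summable_on UNIV}"
  by (rule exI[of _ "\<lambda>_. 0"]) simp

setup_lifting type_definition_ell2

lemma ell2_summable: "(\<lambda>x. (cmod (Rep_ell2 f x))\<^sup>2) summable_on UNIV"
  using Rep_ell2 by auto

lemma summable_on_le:
  fixes f g :: "'a \<Rightarrow> real"
  assumes "g summable_on A" "\<And>x. x \<in> A \<Longrightarrow> \<bar>f x\<bar> \<le> g x"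
  shows "f summable_on A"
proof -
  have "(\<lambda>x. norm (f x)) summable_on A"
  proof (rule Infinite_Sum.abs_summable_on_comparison_test)
    have "norm (g x) = g x" if "x \<in> A" for x
      using assms(2)[OF that] by simp
    then show "(\<lambda>x. norm (g x)) summable_on A"
      using assms(1) summable_on_cong[of A "\<lambda>x. norm (g x)" g] by blast
    show "norm (f x) \<le> norm (g x)" if "x \<in> A" for x
      using assms(2)[OF that] by simp
  qed
  then show ?thesis by (rule Infinite_Sum.abs_summable_summable)
qed

lemma ell2_inner_summable:
  assumes "(\<lambda>x. (cmod (f x))\<^sup>2) summable_on UNIV" "(\<lambda>x. (cmod (g x))\<^sup>2) summable_on UNIV"
  shows "(\<lambda>x. f x \<bullet> g x) summable_on UNIV"
proof (rule summable_on_le)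
  show "(\<lambda>x. (cmod (f x))\<^sup>2 + (cmod (g x))\<^sup>2) summable_on UNIV"
    using assms by (rule summable_on_add)
  show "\<bar>f x \<bullet> g x\<bar> \<le> (cmod (f x))\<^sup>2 + (cmod (g x))\<^sup>2" for x
  proof -
    have "\<bar>f x \<bullet> g x\<bar> \<le> cmod (f x) * cmod (g x)"
      by (rule Cauchy_Schwarz_ineq2)
    moreover have "2 * (cmod (f x) * cmod (g x)) \<le> (cmod (f x))\<^sup>2 + (cmod (g x))\<^sup>2"
      using sum_squares_bound[of "cmod (f x)" "cmod (g x)"] by (simp add: mult.assoc)
    moreover have "0 \<le> cmod (f x) * cmod (g x)" by simp
    ultimately show ?thesis by linarith
  qed
qed

instantiation ell2 :: (type) real_vector
begin
lift_definition zero_ell2 :: "'a ell2" is "\<lambda>_. 0" by simp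
lift_definition plus_ell2 :: "'a ell2 \<Rightarrow> 'a ell2 \<Rightarrow> 'a ell2" is "\<lambda>f g x. f x + g x"
proof -
  fix f g :: "'a \<Rightarrow> complex"
  assume *: "(\<lambda>x. (cmod (f x))\<^sup>2) summable_on UNIV" "(\<lambda>x. (cmod (g x))\<^sup>2) summable_on UNIV"
  have "(\<lambda>x. (cmod (f x))\<^sup>2 + (cmod (g x))\<^sup>2) summable_on UNIV"
    using * by (rule summable_on_add)
  moreover have "(\<lambda>x. 2 * (f x \<bullet> g x)) summable_on UNIV"
    using ell2_inner_summable[OF *] by (rule summable_on_cmult_right)
  ultimately have "(\<lambda>x. ((cmod (f x))\<^sup>2 + (cmod (g x))\<^sup>2) + 2 * (f x \<bullet> g x)) summable_on UNIV"
    by (rule summable_on_add)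
  moreover have "((cmod (f x))\<^sup>2 + (cmod (g x))\<^sup>2) + 2 * (f x \<bullet> g x) = (cmod (f x + g x))\<^sup>2" for x
    using dot_norm[of "f x" "g x"] by simp
  ultimately show "(\<lambda>x. (cmod (f x + g x))\<^sup>2) summable_on UNIV"
    by simp
qed
lift_definition uminus_ell2 :: "'a ell2 \<Rightarrow> 'a ell2" is "\<lambda>f x. - f x" by simp
definition minus_ell2 :: "'a ell2 \<Rightarrow> 'a ell2 \<Rightarrow> 'a ell2" where "minus_ell2 f g = f + - g"
lift_definition scaleR_ell2 :: "real \<Rightarrow> 'a ell2 \<Rightarrow> 'a ell2" is "\<lambda>r f x. r *\<^sub>R f x"
  by (simp add: power_mult_distrib summable_on_cmult_right del: scaleR_conv_of_real)
instance
  by standard (simp_all add: minus_ell2_def, (transfer, simp add: algebra_simps fun_eq_iff)+)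
end

instantiation ell2 :: (type) real_inner
begin
lift_definition inner_ell2 :: "'a ell2 \<Rightarrow> 'a ell2 \<Rightarrow> real"
  is "\<lambda>f g. \<Sum>\<^sub>\<infinity>x. f x \<bullet> g x" .
definition norm_ell2 :: "'a ell2 \<Rightarrow> real" where "norm_ell2 f = sqrt (f \<bullet> f)"
definition sgn_ell2 :: "'a ell2 \<Rightarrow> 'a ell2" where "sgn_ell2 f = f /\<^sub>R norm f"
definition dist_ell2 :: "'a ell2 \<Rightarrow> 'a ell2 \<Rightarrow> real" where "dist_ell2 f g = norm (f - g)"
definition uniformity_ell2 :: "('a ell2 \<times> 'a ell2) filter"
  where "uniformity_ell2 = (INF e\<in>{0<..}. principal {(x, y). dist x y < e})"
definition open_ell2 :: "'a ell2 set \<Rightarrow> bool"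
  where "open_ell2 U = (\<forall>x\<in>U. \<forall>\<^sub>F (x', y) in uniformity. x' = x \<longrightarrow> y \<in> U)"
instance
proof
  fix f g h :: "'a ell2" and r :: real
  show "f \<bullet> g = g \<bullet> f" by transfer (simp add: inner_commute)
  show "(f + g) \<bullet> h = f \<bullet> h + g \<bullet> h"
    by transfer (simp add: inner_add_left infsum_add ell2_inner_summable)
  show "(r *\<^sub>R f) \<bullet> g = r * (f \<bullet> g)"
    by transfer (simp add: infsum_cmult_right' del: scaleR_conv_of_real)
  show "0 \<le> f \<bullet> f" by transfer (simp add: infsum_nonneg)
  show "f \<bullet> f = 0 \<longleftrightarrow> f = 0"
  proof
    assume "f \<bullet> f = 0"
    then have "(\<Sum>\<^sub>\<infinity>x. (cmod (Rep_ell2 f x))\<^sup>2) \<le> 0"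
      by (simp add: inner_ell2.rep_eq power2_norm_eq_inner)
    then have "(cmod (Rep_ell2 f x))\<^sup>2 = 0" for x
      by (rule nonneg_infsum_le_0D) (simp_all add: ell2_summable)
    then show "f = 0"
      by (simp add: fun_eq_iff zero_ell2.rep_eq flip: Rep_ell2_inject)
  qed (transfer, simp)
qed (simp_all add: norm_ell2_def sgn_ell2_def dist_ell2_def uniformity_ell2_def open_ell2_def)
end

instantiation ell2 :: (type) complex_normed_vector
begin
lift_definition scaleC_ell2 :: "complex \<Rightarrow> 'a ell2 \<Rightarrow> 'a ell2" is "\<lambda>c f x. c * f x"
  by (simp add: norm_mult power_mult_distrib summable_on_cmult_right)
instance
proof
  fix c :: complex and f :: "'a ell2"
  have "(c *\<^sub>C f) \<bullet> (c *\<^sub>C f) = (cmod c)\<^sup>2 * (f \<bullet> f)"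
    by transfer (simp add: norm_mult power_mult_distrib infsum_cmult_right' flip: power2_norm_eq_inner)
  then show "norm (c *\<^sub>C f) = cmod c * norm f"
    by (simp add: norm_ell2_def real_sqrt_mult)
qed (transfer, simp add: algebra_simps scaleR_conv_of_real fun_eq_iff)+
end

lift_definition cinner :: "'x ell2 \<Rightarrow> 'x ell2 \<Rightarrow> complex"
  is "\<lambda>f g. \<Sum>\<^sub>\<infinity>x. cnj (f x) * g x" .

lift_definition tensor_ell2 :: "'x ell2 \<Rightarrow> 'y ell2 \<Rightarrow> ('x \<times> 'y) ell2"  (infixr \<open>\<otimes>\<^sub>v\<close> 70)
  is "\<lambda>f g (x, y). f x * g y"
proof -
  fix f :: "'x \<Rightarrow> complex" and g :: "'y \<Rightarrow> complex"
  assume fg: "(\<lambda>x. (cmod (f x))\<^sup>2) summable_on UNIV" "(\<lambda>x. (cmod (g x))\<^sup>2) summable_on UNIV"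
  then have "(\<lambda>z. norm ((cmod (f (fst z)))\<^sup>2 * (cmod (g (snd z)))\<^sup>2)) summable_on UNIV \<times> UNIV"
    by (subst Infinite_Sum.abs_summable_on_Sigma_iff)
      (simp_all add: summable_on_cmult_right summable_on_cmult_left infsum_cmult_right' abs_mult)
  then show "(\<lambda>z. (cmod (case z of (x, y) \<Rightarrow> f x * g y))\<^sup>2) summable_on UNIV"
    by (simp add: case_prod_unfold norm_mult power_mult_distrib abs_mult)
qed


section \<open>Operators on \<open>\<ell>\<^sup>2(X)\<close>\<close>

text \<open>The bounded operators \<open>'x ell2 \<Rightarrow>\<^sub>L 'x ell2\<close> of the library are only real-linear.\<close>

type_synonym 'x op = "'x ell2 \<Rightarrow>\<^sub>L 'x ell2"

definition complex_ops :: "'x op set"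
  where "complex_ops = {T :: 'x op. \<forall>c f. T (c *\<^sub>C f) = c *\<^sub>C T f}"

definition adj :: "'x op \<Rightarrow> 'x op"
  where "adj T = (THE S :: 'x op. \<forall>f g. cinner (S f) g = cinner f (T g))"

definition tensor_op :: "'x op \<Rightarrow> 'y op \<Rightarrow> ('x \<times> 'y) op"  (infixr \<open>\<otimes>\<^sub>o\<close> 70)
  where "S \<otimes>\<^sub>o T = (THE R :: ('x \<times> 'y) op. \<forall>f g. R (f \<otimes>\<^sub>v g) = S f \<otimes>\<^sub>v T g)"

text \<open>Composition with \<open>p\<close>, extended by zero outside \<open>S\<close>; bounded if \<open>p\<close> is injective on \<open>S\<close>.\<close>

definition pullback :: "'x set \<Rightarrow> ('x \<Rightarrow> 'y) \<Rightarrow> 'y ell2 \<Rightarrow>\<^sub>L 'x ell2"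
  where "pullback S p = Blinfun (\<lambda>f. Abs_ell2 (\<lambda>x. if x \<in> S then Rep_ell2 f (p x) else 0))"

lemma pullback_apply:
  assumes "inj_on p S"
  shows "Rep_ell2 (pullback S p f) x = (if x \<in> S then Rep_ell2 f (p x) else 0)"
proof -
  define P where "P f x = (if x \<in> S then Rep_ell2 f (p x) else 0)" for f :: "'b ell2" and x
  have sub: "(\<lambda>y. (cmod (Rep_ell2 f y))\<^sup>2) summable_on p ` S" for f
    by (rule summable_on_subset_banach[OF ell2_summable]) simp
  then have "(\<lambda>x. (cmod (Rep_ell2 f (p x)))\<^sup>2) summable_on S" for f
    using assms by (simp add: summable_on_reindex o_def)
  then have "(\<lambda>x. (cmod (P f x))\<^sup>2) summable_on UNIV" for f
    unfolding P_def by (subst summable_on_cong_neutral[where T = S and g = "\<lambda>x. (cmod (Rep_ell2 f (p x)))\<^sup>2"]) auto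
  then have rep: "Rep_ell2 (Abs_ell2 (P f)) = P f" for f
    by (simp add: Abs_ell2_inverse)
  have "norm (Abs_ell2 (P f)) \<le> norm f" for f
  proof -
    have "Abs_ell2 (P f) \<bullet> Abs_ell2 (P f) = (\<Sum>\<^sub>\<infinity>x. (cmod (P f x))\<^sup>2)"
      by (simp add: inner_ell2.rep_eq rep flip: power2_norm_eq_inner)
    also have "\<dots> = (\<Sum>\<^sub>\<infinity>x\<in>S. (cmod (Rep_ell2 f (p x)))\<^sup>2)"
      unfolding P_def by (rule infsum_cong_neutral) auto
    also have "\<dots> = (\<Sum>\<^sub>\<infinity>y\<in>p ` S. (cmod (Rep_ell2 f y))\<^sup>2)"
      using assms by (simp add: infsum_reindex o_def)
    also have "\<dots> \<le> (\<Sum>\<^sub>\<infinity>y. (cmod (Rep_ell2 f y))\<^sup>2)"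
      by (rule infsum_mono_neutral) (auto simp: sub ell2_summable)
    also have "\<dots> = f \<bullet> f"
      by (simp add: inner_ell2.rep_eq flip: power2_norm_eq_inner)
    finally show ?thesis by (simp add: norm_ell2_def)
  qed
  moreover have "Abs_ell2 (P (f + g)) = Abs_ell2 (P f) + Abs_ell2 (P g)" for f g
    by (simp add: rep plus_ell2.rep_eq P_def fun_eq_iff flip: Rep_ell2_inject)
  moreover have "Abs_ell2 (P (r *\<^sub>R f)) = r *\<^sub>R Abs_ell2 (P f)" for r f
    by (simp add: rep scaleR_ell2.rep_eq P_def fun_eq_iff flip: Rep_ell2_inject)
  ultimately have "bounded_linear (\<lambda>f. Abs_ell2 (P f))"
    by (intro bounded_linear_intro[where K = 1]) simp_all
  then have "pullback S p f = Abs_ell2 (P f)"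
    unfolding pullback_def P_def[abs_def] by (simp add: bounded_linear_Blinfun_apply)
  then show ?thesis by (simp add: rep P_def)
qed

definition assoc_op :: "(('x \<times> 'y) \<times> 'z) op \<Rightarrow> ('x \<times> ('y \<times> 'z)) op"
  where "assoc_op T = pullback UNIV (\<lambda>(x, (y, z)). ((x, y), z)) o\<^sub>L T
                        o\<^sub>L pullback UNIV (\<lambda>((x, y), z). (x, (y, z)))"


section \<open>\<open>C\<^sup>*\<close>-algebras\<close>

text \<open>
  By the Gelfand--Naimark theorem every \<open>C\<^sup>*\<close>-algebra is isomorphic to a norm closed
  \<open>*\<close>-subalgebra of the bounded operators on some Hilbert space \<open>\<ell>\<^sup>2(X)\<close>. The unit of a unital
  algebra need not be the identity operator of \<open>\<ell>\<^sup>2(X)\<close>.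
\<close>

definition cstar_algebra :: "'x op set \<Rightarrow> bool"
  where "cstar_algebra A \<longleftrightarrow> A \<subseteq> complex_ops \<and> closed A \<and> 0 \<in> A \<and>
    (\<forall>a\<in>A. \<forall>b\<in>A. a + b \<in> A \<and> a o\<^sub>L b \<in> A) \<and>
    (\<forall>a\<in>A. adj a \<in> A \<and> (\<forall>c. c *\<^sub>C a \<in> A))"

definition is_unit :: "'x op set \<Rightarrow> 'x op \<Rightarrow> bool"
  where "is_unit A e \<longleftrightarrow> e \<in> A \<and> (\<forall>a\<in>A. e o\<^sub>L a = a \<and> a o\<^sub>L e = a)"

definition unital_cstar_algebra :: "'x op set \<Rightarrow> bool"
  where "unital_cstar_algebra A \<longleftrightarrow> cstar_algebra A \<and> (\<exists>e. is_unit A e)"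

definition unit_of :: "'x op set \<Rightarrow> 'x op"
  where "unit_of A = (THE e. is_unit A e)"

definition unital_star_hom :: "'x op set \<Rightarrow> 'y op set \<Rightarrow> ('x op \<Rightarrow> 'y op) \<Rightarrow> bool"
  where "unital_star_hom A B j \<longleftrightarrow> j ` A \<subseteq> B \<and> j (unit_of A) = unit_of B \<and>
    (\<forall>a\<in>A. \<forall>b\<in>A. j (a + b) = j a + j b \<and> j (a o\<^sub>L b) = j a o\<^sub>L j b) \<and>
    (\<forall>a\<in>A. j (adj a) = adj (j a) \<and> (\<forall>c. j (c *\<^sub>C a) = c *\<^sub>C j a))"

definition bounded_clinear_on ::
    "'a::complex_normed_vector set \<Rightarrow> ('a \<Rightarrow> 'b::complex_normed_vector) \<Rightarrow> bool"
  where "bounded_clinear_on V L \<longleftrightarrow>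
    (\<forall>x\<in>V. \<forall>y\<in>V. L (x + y) = L x + L y) \<and> (\<forall>c. \<forall>x\<in>V. L (c *\<^sub>C x) = c *\<^sub>C L x) \<and>
    (\<exists>K. \<forall>x\<in>V. norm (L x) \<le> K * norm x)"

text \<open>A state lives on \<open>A\<close> only; \<^const>\<open>extensional\<close> fixes its values elsewhere, so that two
  states are equal iff they agree on \<open>A\<close>.\<close>

definition state :: "'x op set \<Rightarrow> ('x op \<Rightarrow> complex) \<Rightarrow> bool"
  where "state A \<phi> \<longleftrightarrow> \<phi> \<in> extensional A \<and> bounded_clinear_on A \<phi> \<and>
    (\<forall>a\<in>A. \<phi> (adj a o\<^sub>L a) \<in> \<real>\<^sub>\<ge>\<^sub>0) \<and> \<phi> (unit_of A) = 1"

definition faithful :: "'x op set \<Rightarrow> ('x op \<Rightarrow> complex) \<Rightarrow> bool"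
  where "faithful A \<phi> \<longleftrightarrow> (\<forall>a\<in>A. \<phi> (adj a o\<^sub>L a) = 0 \<longrightarrow> a = 0)"

definition spatial_tensor :: "'x op set \<Rightarrow> 'y op set \<Rightarrow> ('x \<times> 'y) op set"  (infixr \<open>\<otimes>\<^sub>A\<close> 70)
  where "A \<otimes>\<^sub>A B = closure (cspan {a \<otimes>\<^sub>o b |a b. a \<in> A \<and> b \<in> B})"

text \<open>The tensor products of \<open>*\<close>-homomorphisms, of functionals, and of a functional with the
  identity exist on the spatial tensor product and are unique there. They are therefore introduced
  by their values on elementary tensors.\<close>

definition tensor_hom :: "'x op set \<Rightarrow> 'y op set \<Rightarrow> 'u op set \<Rightarrow> 'v op set \<Rightarrow>
    ('x op \<Rightarrow> 'u op) \<Rightarrow> ('y op \<Rightarrow> 'v op) \<Rightarrow> (('x \<times> 'y) op \<Rightarrow> ('u \<times> 'v) op) \<Rightarrow> bool"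
  where "tensor_hom A B C D j k J \<longleftrightarrow> unital_star_hom (A \<otimes>\<^sub>A B) (C \<otimes>\<^sub>A D) J \<and>
    (\<forall>a\<in>A. \<forall>b\<in>B. J (a \<otimes>\<^sub>o b) = j a \<otimes>\<^sub>o k b)"

definition tensor_functional :: "'x op set \<Rightarrow> 'y op set \<Rightarrow>
    ('x op \<Rightarrow> complex) \<Rightarrow> ('y op \<Rightarrow> complex) \<Rightarrow> (('x \<times> 'y) op \<Rightarrow> complex) \<Rightarrow> bool"
  where "tensor_functional A B \<phi> \<psi> \<Phi> \<longleftrightarrow> bounded_clinear_on (A \<otimes>\<^sub>A B) \<Phi> \<and>
    (\<forall>a\<in>A. \<forall>b\<in>B. \<Phi> (a \<otimes>\<^sub>o b) = \<phi> a * \<psi> b)"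

definition left_slice :: "'x op set \<Rightarrow> 'y op set \<Rightarrow>
    ('x op \<Rightarrow> complex) \<Rightarrow> (('x \<times> 'y) op \<Rightarrow> 'y op) \<Rightarrow> bool"
  where "left_slice A B \<phi> L \<longleftrightarrow> bounded_clinear_on (A \<otimes>\<^sub>A B) L \<and>
    (\<forall>a\<in>A. \<forall>b\<in>B. L (a \<otimes>\<^sub>o b) = \<phi> a *\<^sub>C b)"

definition right_slice :: "'x op set \<Rightarrow> 'y op set \<Rightarrow>
    ('y op \<Rightarrow> complex) \<Rightarrow> (('x \<times> 'y) op \<Rightarrow> 'x op) \<Rightarrow> bool"
  where "right_slice A B \<psi> R \<longleftrightarrow> bounded_clinear_on (A \<otimes>\<^sub>A B) R \<and>
    (\<forall>a\<in>A. \<forall>b\<in>B. R (a \<otimes>\<^sub>o b) = \<psi> b *\<^sub>C a)"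


section \<open>Compact quantum groups\<close>

definition coassociative :: "'x op set \<Rightarrow> ('x op \<Rightarrow> ('x \<times> 'x) op) \<Rightarrow> bool"
  where "coassociative A \<Delta> \<longleftrightarrow> (\<exists>L R.
    tensor_hom A A (A \<otimes>\<^sub>A A) A \<Delta> id L \<and> tensor_hom A A A (A \<otimes>\<^sub>A A) id \<Delta> R \<and>
    (\<forall>a\<in>A. assoc_op (L (\<Delta> a)) = R (\<Delta> a)))"

definition compact_quantum_group :: "'x op set \<Rightarrow> ('x op \<Rightarrow> ('x \<times> 'x) op) \<Rightarrow> bool"
  where "compact_quantum_group A \<Delta> \<longleftrightarrow>
    unital_cstar_algebra A \<and> unital_star_hom A (A \<otimes>\<^sub>A A) \<Delta> \<and> coassociative A \<Delta> \<and>
    closure (cspan {(unit_of A \<otimes>\<^sub>o a) o\<^sub>L \<Delta> b |a b. a \<in> A \<and> b \<in> A}) = A \<otimes>\<^sub>A A \<and>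
    closure (cspan {(a \<otimes>\<^sub>o unit_of A) o\<^sub>L \<Delta> b |a b. a \<in> A \<and> b \<in> A}) = A \<otimes>\<^sub>A A"

definition haar_state ::
    "'x op set \<Rightarrow> ('x op \<Rightarrow> ('x \<times> 'x) op) \<Rightarrow> ('x op \<Rightarrow> complex) \<Rightarrow> bool"
  where "haar_state A \<Delta> h \<longleftrightarrow> state A h \<and> (\<exists>L R. left_slice A A h L \<and> right_slice A A h R \<and>
    (\<forall>a\<in>A. L (\<Delta> a) = h a *\<^sub>C unit_of A \<and> R (\<Delta> a) = h a *\<^sub>C unit_of A))"

definition idempotent_state ::
    "'x op set \<Rightarrow> ('x op \<Rightarrow> ('x \<times> 'x) op) \<Rightarrow> ('x op \<Rightarrow> complex) \<Rightarrow> bool"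
  where "idempotent_state A \<Delta> \<phi> \<longleftrightarrow> state A \<phi> \<and>
    (\<exists>\<Phi>. tensor_functional A A \<phi> \<phi> \<Phi> \<and> (\<forall>a\<in>A. \<Phi> (\<Delta> a) = \<phi> a))"

definition quantum_subgroup :: "'x op set \<Rightarrow> ('x op \<Rightarrow> ('x \<times> 'x) op) \<Rightarrow>
    'y op set \<Rightarrow> ('y op \<Rightarrow> ('y \<times> 'y) op) \<Rightarrow> ('x op \<Rightarrow> 'y op) \<Rightarrow> bool"
  where "quantum_subgroup A \<Delta> B \<Delta>' j \<longleftrightarrow>
    compact_quantum_group B \<Delta>' \<and> unital_star_hom A B j \<and> j ` A = B \<and>
    (\<exists>J. tensor_hom A A B B j j J \<and> (\<forall>a\<in>A. \<Delta>' (j a) = J (\<Delta> a)))"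

text \<open>Haar states are assumed to be faithful. The quantum subgroup is represented on
  \<open>\<ell>\<^sup>2\<close> of the type argument, which must therefore be large enough. If \<open>A\<close> is the
  \<open>C\<^sup>*\<close>-algebra of a discrete group \<open>G\<close>, then at least as many elements as \<open>G\<close> has are
  enough: the GNS representation of the faithful Haar state is faithful, and the images of the
  generators are total in its Hilbert space.\<close>

definition haar_idempotent :: "'y itself \<Rightarrow>
    'x op set \<Rightarrow> ('x op \<Rightarrow> ('x \<times> 'x) op) \<Rightarrow> ('x op \<Rightarrow> complex) \<Rightarrow> bool"
  where "haar_idempotent (_ :: 'y itself) A \<Delta> \<phi> \<longleftrightarrow>
    (\<exists>(B :: 'y op set) \<Delta>' j h. quantum_subgroup A \<Delta> B \<Delta>' j \<and>
       haar_state B \<Delta>' h \<and> faithful B h \<and> \<phi> = restrict (h \<circ> j) A)"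


section \<open>Amenable groups and their \<open>C\<^sup>*\<close>-algebras\<close>

text \<open>A left invariant mean on the bounded real functions on \<open>G\<close>. By positivity, the mean of
  \<open>f\<close> depends only on the values of \<open>f\<close> on the carrier.\<close>

definition amenable :: "('g, 'b) monoid_scheme \<Rightarrow> bool"
  where "amenable G \<longleftrightarrow> (\<exists>m :: ('g \<Rightarrow> real) \<Rightarrow> real.
    (\<forall>f f'. bounded (f ` carrier G) \<longrightarrow> bounded (f' ` carrier G) \<longrightarrow>
       m (\<lambda>x. f x + f' x) = m f + m f') \<and>
    (\<forall>f r. bounded (f ` carrier G) \<longrightarrow> m (\<lambda>x. r * f x) = r * m f) \<and>
    (\<forall>f. bounded (f ` carrier G) \<longrightarrow> (\<forall>x\<in>carrier G. 0 \<le> f x) \<longrightarrow> 0 \<le> m f) \<and>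
    m (\<lambda>_. 1) = 1 \<and>
    (\<forall>f. bounded (f ` carrier G) \<longrightarrow> (\<forall>g\<in>carrier G. m (\<lambda>x. f (g \<otimes>\<^bsub>G\<^esub> x)) = m f)))"

definition left_translation :: "('g, 'b) monoid_scheme \<Rightarrow> 'g \<Rightarrow> 'g op"
  where "left_translation G g = pullback (carrier G) (\<lambda>x. inv\<^bsub>G\<^esub> g \<otimes>\<^bsub>G\<^esub> x)"

lemma left_translation_apply:
  assumes "group G" "g \<in> carrier G"
  shows "Rep_ell2 (left_translation G g f) x =
    (if x \<in> carrier G then Rep_ell2 f (inv\<^bsub>G\<^esub> g \<otimes>\<^bsub>G\<^esub> x) else 0)"
proof -
  interpret group G by fact
  have "inj_on (\<lambda>x. inv\<^bsub>G\<^esub> g \<otimes>\<^bsub>G\<^esub> x) (carrier G)"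
    using assms(2) by (intro inj_onI) simp
  then show ?thesis
    unfolding left_translation_def by (rule pullback_apply)
qed

text \<open>The reduced group \<open>C\<^sup>*\<close>-algebra, which is the group \<open>C\<^sup>*\<close>-algebra for amenable \<open>G\<close>.
  Its unit is the projection of \<open>'g ell2\<close> onto the functions supported on the carrier.\<close>

definition group_cstar :: "('g, 'b) monoid_scheme \<Rightarrow> 'g op set"
  where "group_cstar G = cstar_algebra hull (left_translation G ` carrier G)"

text \<open>Continuity is automatic for a \<open>*\<close>-homomorphism; with it, the values on the generators
  visibly determine the coproduct on \<open>group_cstar G\<close>.\<close>

definition dual_coproduct :: "('g, 'b) monoid_scheme \<Rightarrow> 'g op \<Rightarrow> ('g \<times> 'g) op"
  where "dual_coproduct G = (SOME \<Delta>.
    unital_star_hom (group_cstar G) (group_cstar G \<otimes>\<^sub>A group_cstar G) \<Delta> \<and>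
    continuous_on (group_cstar G) \<Delta> \<and>
    (\<forall>g\<in>carrier G. \<Delta> (left_translation G g) = left_translation G g \<otimes>\<^sub>o left_translation G g))"

definition state_subgroup :: "('g, 'b) monoid_scheme \<Rightarrow> ('g op \<Rightarrow> complex) \<Rightarrow> 'g set"
  where "state_subgroup G \<phi> = {g \<in> carrier G. \<phi> (left_translation G g) = 1}"

end

theory Submission
  imports Defs "HOL-Analysis.Finite_Function_Topology"
begin

text \<open>
  An idempotent state takes only the values \<open>0\<close> and \<open>1\<close> at the generators \<open>\<lambda>\<^sub>g\<close>, and positivity makes the set
  where it is \<open>1\<close> a subgroup. Conversely, amenability yields almost invariant vectors, by a Hahn--Banach
  argument, so every permutation representation of \<open>G\<close> extends to \<open>C\<^sup>*(G)\<close>, by Fell's absorption principle.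
  The vector state of the representation on \<open>G/H\<close> at the coset \<open>H\<close> is the state of the subgroup \<open>H\<close>; its
  tensor square comes from \<open>H \<times> H\<close> in \<open>G \<times> G\<close>. If \<open>H\<close> is normal, this state factors through the canonical
  trace of \<open>G/H\<close>, along a \<open>*\<close>-homomorphism \<open>C\<^sup>*(G) \<rightarrow> C\<^sup>*(G/H)\<close> that is surjective because it has dense range.
  If the state is a Haar idempotent \<open>h \<circ> j\<close>, then faithfulness of \<open>h\<close> identifies \<open>H\<close> with the kernel of
  \<open>g \<mapsto> j \<lambda>\<^sub>g\<close>.
\<close>

section \<open>Geometry of \<open>\<ell>\<^sup>2(X)\<close>\<close>

text \<open>The obstacle throughout is that adjoints, tensor products of maps and closed ranges have
  to be produced concretely. What makes this feasible is that \<open>group_cstar G\<close> is the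
  closed linear span of the translations: a map out of it is given by its values there and one norm
  inequality for finite sums, and an identity between bounded linear maps is checked on
  translations. Since the spatial tensor square is
  \<open>group_cstar (G \<times>\<times> G)\<close>, coproducts and tensor products of homomorphisms
  and of states become instances of the same extension theorem for other groups. The norm inequality
  is where amenability is spent: on the reduced algebra even the trivial representation is bounded
  only for amenable groups. From the mean only almost invariant vectors are kept for G and for its
  square, because they multiply under tensor products; for a quotient it is the mean that is
  transported. That a dense range is everything is shown by successive approximation with truncated
  Neumann series, in place of functional calculus and quotient algebras.\<close>

lemma scaleC_one [simp]: "1 *\<^sub>C x = (x :: 'a::complex_normed_vector)"
  using scaleC_of_real[of 1 x] by simp

lemma norm_ell2_power2: "(norm f)\<^sup>2 = (\<Sum>\<^sub>\<infinity>x. (cmod (Rep_ell2 f x))\<^sup>2)"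
  by (simp add: power2_norm_eq_inner inner_ell2.rep_eq)

lemma sum_cmod_le_norm_ell2:
  assumes "finite F"
  shows "(\<Sum>x\<in>F. (cmod (Rep_ell2 f x))\<^sup>2) \<le> (norm f)\<^sup>2"
  unfolding norm_ell2_power2 by (rule finite_sum_le_infsum) (auto simp: assms ell2_summable)

lemma cmod_le_norm_ell2: "cmod (Rep_ell2 f x) \<le> norm f"
  using sum_cmod_le_norm_ell2[of "{x}" f] by (simp add: abs_le_square_iff[symmetric])

lemma norm_ell2_le:
  assumes "\<And>F. finite F \<Longrightarrow> (\<Sum>x\<in>F. (cmod (Rep_ell2 f x))\<^sup>2) \<le> B\<^sup>2" "0 \<le> B"
  shows "norm f \<le> B"
proof -
  have "(norm f)\<^sup>2 \<le> B\<^sup>2"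
    unfolding norm_ell2_power2 by (rule infsum_le_finite_sums) (auto simp: assms ell2_summable)
  then show ?thesis
    using assms(2) by (rule power2_le_imp_le)
qed

text \<open>The standard device for building vectors from coordinates: a bound on finite partial
  sums that is uniform in the finite set gives square summability and the norm bound at once.
  Adjoints and amplifications are constructed this way.\<close>

lemma ell2_exI:
  assumes "\<And>F. finite F \<Longrightarrow> (\<Sum>x\<in>F. (cmod (g x))\<^sup>2) \<le> B\<^sup>2" "0 \<le> B"
  shows "Rep_ell2 (Abs_ell2 g) = g" "norm (Abs_ell2 g) \<le> B"
proof -
  have "(\<lambda>x. (cmod (g x))\<^sup>2) summable_on UNIV"
    by (rule nonneg_bounded_partial_sums_imp_summable_on[where C = "B\<^sup>2"])
      (auto intro!: eventually_finite_subsets_at_top_weakI assms)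
  then show *: "Rep_ell2 (Abs_ell2 g) = g"
    by (simp add: Abs_ell2_inverse)
  show "norm (Abs_ell2 g) \<le> B"
    by (rule norm_ell2_le) (simp_all add: * assms)
qed

lemma ell2_eqI: "(\<And>x. Rep_ell2 f x = Rep_ell2 g x) \<Longrightarrow> f = g"
  by (simp add: Rep_ell2_inject[symmetric] fun_eq_iff)

lemma Rep_ell2_minus: "Rep_ell2 (f - g) x = Rep_ell2 f x - Rep_ell2 g x"
  unfolding minus_ell2_def plus_ell2.rep_eq uminus_ell2.rep_eq by simp

lemma Rep_ell2_sum: "Rep_ell2 (\<Sum>i\<in>I. f i) x = (\<Sum>i\<in>I. Rep_ell2 (f i) x)"
  by (induction I rule: infinite_finite_induct) (simp_all add: zero_ell2.rep_eq plus_ell2.rep_eq)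

lemma bounded_linear_Rep_ell2: "bounded_linear (\<lambda>f. Rep_ell2 f x)"
  by (rule bounded_linear_intro[where K = 1])
    (simp_all add: plus_ell2.rep_eq scaleR_ell2.rep_eq cmod_le_norm_ell2 del: scaleR_conv_of_real)

section \<open>Completeness\<close>

instance ell2 :: (type) banach
proof
  fix X :: "nat \<Rightarrow> 'a ell2"
  assume X: "Cauchy X"
  have "Cauchy (\<lambda>n. Rep_ell2 (X n) x)" for x
    by (rule bounded_linear.Cauchy[OF bounded_linear_Rep_ell2 X])
  then have "\<exists>l. (\<lambda>n. Rep_ell2 (X n) x) \<longlonglongrightarrow> l" for x
    by (simp add: Cauchy_convergent_iff convergent_def)
  then obtain l where l: "\<And>x. (\<lambda>n. Rep_ell2 (X n) x) \<longlonglongrightarrow> l x"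
    by metis
  \<comment> \<open>Only finite sums are passed to the limit in m, so no limit is interchanged with
    an infinite sum, and the bound stays uniform in F.\<close>
  have tail: "(\<Sum>x\<in>F. (cmod (Rep_ell2 (X n) x - l x))\<^sup>2) \<le> e\<^sup>2"
    if "finite F" "0 \<le> e" and e: "\<And>m. m \<ge> n \<Longrightarrow> norm (X n - X m) \<le> e" for F n e
  proof (rule tendsto_upperbound)
    show "(\<lambda>m. \<Sum>x\<in>F. (cmod (Rep_ell2 (X n - X m) x))\<^sup>2) \<longlonglongrightarrow> (\<Sum>x\<in>F. (cmod (Rep_ell2 (X n) x - l x))\<^sup>2)"
      unfolding Rep_ell2_minus by (intro tendsto_intros l)
    have "(\<Sum>x\<in>F. (cmod (Rep_ell2 (X n - X m) x))\<^sup>2) \<le> e\<^sup>2" if "m \<ge> n" for m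
      using sum_cmod_le_norm_ell2[OF \<open>finite F\<close>] e[OF that] by (meson order_trans norm_ge_zero power_mono)
    then show "\<forall>\<^sub>F m in sequentially. (\<Sum>x\<in>F. (cmod (Rep_ell2 (X n - X m) x))\<^sup>2) \<le> e\<^sup>2"
      using eventually_sequentially by blast
  qed simp
  obtain N where N: "\<And>m n. m \<ge> N \<Longrightarrow> n \<ge> N \<Longrightarrow> norm (X m - X n) < 1"
    using CauchyD[OF X, of 1] by auto
  \<comment> \<open>The pointwise limit \<open>l\<close> is not yet known to be square summable, but
    \<open>X N - l\<close> is, by \<open>tail\<close> with bound 1; the limit vector is therefore
    written as \<open>X N - d\<close>.\<close>
  define d where "d = Abs_ell2 (\<lambda>x. Rep_ell2 (X N) x - l x)"
  have d: "Rep_ell2 d = (\<lambda>x. Rep_ell2 (X N) x - l x)"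
    unfolding d_def by (rule ell2_exI(1)[where B = 1]) (rule tail, auto intro: less_imp_le N)
  have "X \<longlonglongrightarrow> X N - d"
  proof (rule LIMSEQ_I)
    fix r :: real
    assume "0 < r"
    then obtain M where M: "\<And>m n. m \<ge> M \<Longrightarrow> n \<ge> M \<Longrightarrow> norm (X m - X n) < r / 2"
      using CauchyD[OF X, of "r / 2"] by auto
    have "norm (X n - (X N - d)) \<le> r / 2" if "n \<ge> M" for n
      using \<open>0 < r\<close> that
      by (intro norm_ell2_le) (auto simp: Rep_ell2_minus d intro!: tail less_imp_le[OF M])
    then show "\<exists>no. \<forall>n\<ge>no. norm (X n - (X N - d)) < r"
      using \<open>0 < r\<close> by (intro exI[of _ M]) fastforce
  qed
  then show "convergent X"
    by (auto simp: convergent_def)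
qed

section \<open>The complex inner product\<close>

lemma cinner_summable: "(\<lambda>x. cnj (Rep_ell2 f x) * Rep_ell2 g x) summable_on UNIV"
proof -
  have "(\<lambda>x. cmod (cnj (Rep_ell2 f x) * Rep_ell2 g x)) summable_on UNIV"
  proof (rule summable_on_le)
    show "(\<lambda>x. (cmod (Rep_ell2 f x))\<^sup>2 + (cmod (Rep_ell2 g x))\<^sup>2) summable_on UNIV"
      by (intro summable_on_add ell2_summable)
    show "\<bar>cmod (cnj (Rep_ell2 f x) * Rep_ell2 g x)\<bar> \<le> (cmod (Rep_ell2 f x))\<^sup>2 + (cmod (Rep_ell2 g x))\<^sup>2" for x
    proof -
      have "0 \<le> (cmod (Rep_ell2 f x) - cmod (Rep_ell2 g x))\<^sup>2" "0 \<le> cmod (Rep_ell2 f x) * cmod (Rep_ell2 g x)"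
        by simp_all
      then have "cmod (Rep_ell2 f x) * cmod (Rep_ell2 g x) \<le> (cmod (Rep_ell2 f x))\<^sup>2 + (cmod (Rep_ell2 g x))\<^sup>2"
        unfolding power2_diff by linarith
      then show ?thesis
        by (simp add: norm_mult)
    qed
  qed
  then show ?thesis
    by (rule abs_summable_summable)
qed

text \<open>Since \<open>cinner\<close> is conjugate linear in its first argument, multiplying f by
  \<i> turns the real part into the imaginary part. Additivity and the Cauchy-Schwarz inequality are
  then inherited from the real inner product.\<close>

lemma cinner_eq: "cinner f g = Complex (f \<bullet> g) ((\<i> *\<^sub>C f) \<bullet> g)"
proof -
  note s = cinner_summable[of f g]
  have "Re (cinner f g) = f \<bullet> g"
    unfolding cinner.rep_eq infsum_Re[OF s, symmetric] inner_ell2.rep_eq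
    by (simp add: inner_complex_def)
  moreover have "Im (cinner f g) = (\<i> *\<^sub>C f) \<bullet> g"
    unfolding cinner.rep_eq infsum_Im[OF s, symmetric] inner_ell2.rep_eq
    by (simp add: inner_complex_def scaleC_ell2.rep_eq algebra_simps)
  ultimately show ?thesis
    by (simp add: complex_eq_iff)
qed

lemma cinner_cnj: "cnj (cinner f g) = cinner g f"
  unfolding cinner.rep_eq infsum_cnj[symmetric] by (simp add: mult.commute)

lemma cinner_add_right: "cinner f (g + h) = cinner f g + cinner f h"
  and cinner_diff_right: "cinner f (g - h) = cinner f g - cinner f h"
  and cinner_zero_right [simp]: "cinner f 0 = 0"
  by (simp_all add: cinner_eq inner_add_right inner_diff_right complex_eq_iff)

lemma cinner_scaleC_right: "cinner f (c *\<^sub>C g) = c * cinner f g"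
  unfolding cinner.rep_eq scaleC_ell2.rep_eq
  by (subst infsum_cmult_right'[symmetric]) (simp add: mult.left_commute)

lemma cinner_scaleR_right: "cinner f (r *\<^sub>R g) = of_real r * cinner f g"
  by (simp add: scaleC_of_real[symmetric] cinner_scaleC_right)

lemma cinner_add_left: "cinner (f + g) h = cinner f h + cinner g h"
  using cinner_cnj[of h "f + g"] by (simp add: cinner_add_right cinner_cnj)

lemma cinner_diff_left: "cinner (f - g) h = cinner f h - cinner g h"
  using cinner_cnj[of h "f - g"] by (simp add: cinner_diff_right cinner_cnj)

lemma cinner_zero_left [simp]: "cinner 0 h = 0"
  using cinner_cnj[of h 0] by simp

lemma cinner_scaleC_left: "cinner (c *\<^sub>C f) h = cnj c * cinner f h"
  using cinner_cnj[of h "c *\<^sub>C f"] by (simp add: cinner_scaleC_right cinner_cnj)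

lemma cinner_sum_right: "cinner f (\<Sum>i\<in>I. g i) = (\<Sum>i\<in>I. cinner f (g i))"
  by (induction I rule: infinite_finite_induct) (simp_all add: cinner_add_right)

lemma cinner_sum_left: "cinner (\<Sum>i\<in>I. g i) f = (\<Sum>i\<in>I. cinner (g i) f)"
  by (induction I rule: infinite_finite_induct) (simp_all add: cinner_add_left)

lemma cinner_self: "cinner f f = of_real ((norm f)\<^sup>2)"
proof -
  have "Im (cinner f f) = 0"
    using cinner_cnj[of f f] by (metis complex_cnj_cancel_iff Im_complex_of_real Reals_cnj_iff Reals_cases)
  then show ?thesis
    by (simp add: complex_eq_iff) (simp add: cinner_eq power2_norm_eq_inner)
qed

lemma cmod_cinner_le: "cmod (cinner f g) \<le> norm f * norm g"
proof (cases "cinner f g = 0")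
  case False
  \<comment> \<open>A phase of modulus 1 rotates the complex inner product onto the nonnegative real
    axis, where the real inequality applies.\<close>
  define c where "c = cnj (cinner f g) / of_real (cmod (cinner f g))"
  have "cmod c = 1"
    using False by (simp add: c_def norm_divide)
  have "c * cinner f g = of_real (cmod (cinner f g))"
    using False by (simp add: c_def mult.commute flip: complex_norm_square power2_eq_square)
       (simp add: power2_eq_square)
  then have "cinner f (c *\<^sub>C g) = of_real (cmod (cinner f g))"
    by (simp add: cinner_scaleC_right)
  then have "cmod (cinner f g) = f \<bullet> (c *\<^sub>C g)"
    by (simp add: cinner_eq complex_eq_iff)
  also have "\<dots> \<le> norm f * norm (c *\<^sub>C g)"
    by (rule norm_cauchy_schwarz)
  finally show ?thesis
    using \<open>cmod c = 1\<close> by (simp add: norm_scaleC)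
qed simp

lemma bounded_linear_cinner_right: "bounded_linear (cinner f)"
  by (rule bounded_linear_intro[where K = "norm f"])
    (simp_all add: cinner_add_right cinner_scaleR_right scaleR_conv_of_real cmod_cinner_le mult.commute[of
      "norm _" "norm f"])

lemma norm_le_cinnerI:
  assumes "\<And>g. cmod (cinner g f) \<le> K * norm g"
  shows "norm f \<le> K"
proof (cases "f = 0")
  case True
  show ?thesis
  \<comment> \<open>For f = 0 the claim is that K is nonnegative, which needs a nonzero test vector;
    the indicator of \<open>undefined\<close> is one.\<close>
  proof (cases "\<exists>g::'a ell2. g \<noteq> 0")
    case True
    then obtain g :: "'a ell2" where "g \<noteq> 0"
      by blast
    then show ?thesis
      using assms[of g] \<open>f = 0\<close> by (simp add: zero_le_mult_iff)
  next
    case False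
    have "Rep_ell2 (Abs_ell2 (\<lambda>x. if x = undefined then 1 else 0) :: 'a ell2) undefined = (1::complex)"
      by (subst Abs_ell2_inverse) (auto intro!: finite_nonzero_values_imp_summable_on)
    then show ?thesis
      using False by (metis zero_ell2.rep_eq zero_neq_one)
  qed
next
  case False
  then have "norm f * norm f \<le> K * norm f"
    using assms[of f] by (simp add: cinner_self power2_eq_square norm_mult)
  then show ?thesis
    using False by simp
qed

section \<open>The standard basis\<close>

definition ket :: "'x \<Rightarrow> 'x ell2"
  where "ket x = Abs_ell2 (\<lambda>y. if y = x then 1 else 0)"

lemma Rep_ell2_ket: "Rep_ell2 (ket x) y = (if y = x then 1 else 0)"
  unfolding ket_def by (subst Abs_ell2_inverse) (auto intro!: finite_nonzero_values_imp_summable_on)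

lemma cinner_ket: "cinner (ket x) f = Rep_ell2 f x"
proof -
  have "((\<lambda>y. cnj (Rep_ell2 (ket x) y) * Rep_ell2 f y) has_sum (\<Sum>y\<in>{x}. cnj (Rep_ell2 (ket x) y) *
    Rep_ell2 f y)) UNIV"
    by (rule has_sum_finite_neutralI[where B = "{x}"]) (auto simp: Rep_ell2_ket)
  then show ?thesis
    by (simp add: cinner.rep_eq infsumI Rep_ell2_ket)
qed

lemma norm_ket [simp]: "norm (ket x) = 1"
proof -
  have "complex_of_real ((norm (ket x))\<^sup>2) = 1"
    by (simp add: cinner_self[symmetric] cinner_ket Rep_ell2_ket del: of_real_power)
  then have "(norm (ket x))\<^sup>2 = 1"
    using of_real_eq_1_iff by blast
  then show ?thesis
    by (simp add: power2_eq_1_iff) (smt (verit) norm_ge_zero)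
qed

lemma ell2_finite_approx:
  assumes "0 < e"
  shows "\<exists>F. finite F \<and> norm (f - (\<Sum>x\<in>F. Rep_ell2 f x *\<^sub>C ket x)) < e"
proof -
  have "((\<lambda>x. (cmod (Rep_ell2 f x))\<^sup>2) has_sum (norm f)\<^sup>2) UNIV"
    by (simp add: norm_ell2_power2 ell2_summable)
  then obtain F where F: "finite F" "dist (\<Sum>x\<in>F. (cmod (Rep_ell2 f x))\<^sup>2) ((norm f)\<^sup>2) \<le> e\<^sup>2 / 2"
    using has_sum_finite_approximation[of _ _ _ "e\<^sup>2 / 2"] assms by (metis half_gt_zero zero_less_power)
  define u where "u = (\<Sum>x\<in>F. Rep_ell2 f x *\<^sub>C ket x)"
  have Ru: "Rep_ell2 u x = (if x \<in> F then Rep_ell2 f x else 0)" for x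
  proof -
    have "Rep_ell2 u x = (\<Sum>y\<in>F. if x = y then Rep_ell2 f y else 0)"
      unfolding u_def Rep_ell2_sum by (intro sum.cong) (auto simp: scaleC_ell2.rep_eq Rep_ell2_ket)
    then show ?thesis
      using F(1) by simp
  qed
  have "cinner u h = (\<Sum>x\<in>F. cnj (Rep_ell2 f x) * Rep_ell2 h x)" for h
    unfolding u_def by (simp add: cinner_sum_left cinner_scaleC_left cinner_ket)
  then have u: "cinner u f = (\<Sum>x\<in>F. of_real ((cmod (Rep_ell2 f x))\<^sup>2))" "cinner u u = cinner u f"
    using Ru by (simp_all add: complex_norm_square mult.commute flip: of_real_power)
  then have "cinner f u = cinner u f"
    using cinner_cnj[of u f] by simp
  then have "cinner (f - u) (f - u) = cinner f f - cinner u f"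
    by (simp add: cinner_diff_left cinner_diff_right u(2))
  then have "(norm (f - u))\<^sup>2 = (norm f)\<^sup>2 - (\<Sum>x\<in>F. (cmod (Rep_ell2 f x))\<^sup>2)"
    unfolding cinner_self u(1) of_real_sum[symmetric] of_real_diff[symmetric] of_real_eq_iff .
  then have "(norm (f - u))\<^sup>2 \<le> e\<^sup>2 / 2"
    using F(2) unfolding dist_real_def by linarith
  moreover have "0 < e\<^sup>2"
    using assms by simp
  ultimately have "(norm (f - u))\<^sup>2 < e\<^sup>2"
    by linarith
  then show ?thesis
    using F(1) assms unfolding u_def by (meson less_imp_le power2_less_imp_less)
qed

lemma closure_span_ket: "f \<in> closure (span {c *\<^sub>C ket x |c x. True})"
  unfolding closure_approachable
proof safe
  fix e :: real
  assume "0 < e"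
  then obtain F where "finite F" "norm (f - (\<Sum>x\<in>F. Rep_ell2 f x *\<^sub>C ket x)) < e"
    using ell2_finite_approx by blast
  then show "\<exists>y\<in>span {c *\<^sub>C ket x |c x. True}. dist y f < e"
    by (intro bexI[of _ "\<Sum>x\<in>F. Rep_ell2 f x *\<^sub>C ket x"] span_sum)
      (auto simp: dist_norm norm_minus_commute intro: span_base)
qed

text \<open>The maps are only real-linear, so agreement is demanded on all complex multiples of
  basis vectors: it is the real span of these that is dense.\<close>

lemma bounded_linear_eq_on_kets:
  fixes S T :: "'x ell2 \<Rightarrow> 'b::real_normed_vector"
  assumes "bounded_linear S" "bounded_linear T" "\<And>c x. S (c *\<^sub>C ket x) = T (c *\<^sub>C ket x)"
  shows "S f = T f"
proof -
  interpret S: bounded_linear S by fact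
  interpret T: bounded_linear T by fact
  have "S u = T u" if "u \<in> span {c *\<^sub>C ket x |c x. True}" for u
    using that
  proof (induction rule: span_induct_alt)
    case (step r x y)
    then show ?case
      by (auto simp: S.add T.add S.scaleR T.scaleR assms(3))
  qed (simp add: S.zero T.zero)
  then have "span {c *\<^sub>C ket x |c x. True} \<subseteq> {u. S u = T u}"
    by blast
  moreover have "closed {u. S u = T u}"
    by (intro closed_Collect_eq S.continuous_on T.continuous_on continuous_on_id)
  ultimately show ?thesis
    using closure_minimal closure_span_ket by blast
qed

section \<open>Complex linear operators\<close>

text \<open>\<open>complex_ops\<close> covers only endomorphisms; pullbacks go between different
  spaces and need the notion as well.\<close>

definition clinear_op :: "('x ell2 \<Rightarrow>\<^sub>L 'y ell2) \<Rightarrow> bool"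
  where "clinear_op T \<longleftrightarrow> (\<forall>c f. T (c *\<^sub>C f) = c *\<^sub>C T f)"

lemma clinear_opD: "clinear_op T \<Longrightarrow> T (c *\<^sub>C f) = c *\<^sub>C T f"
  by (simp add: clinear_op_def)

lemma complex_ops_iff: "T \<in> complex_ops \<longleftrightarrow> clinear_op T"
  by (simp add: complex_ops_def clinear_op_def)

lemma scaleR_scaleC: "r *\<^sub>R c *\<^sub>C x = c *\<^sub>C r *\<^sub>R (x :: 'a::complex_normed_vector)"
  by (simp add: scaleC_of_real[symmetric] scaleC_scaleC mult.commute)

lemma blinfun_apply_scaleC [simp]: "blinfun_apply (c *\<^sub>C T) f = c *\<^sub>C T f"
  by (simp add: scaleC_blinfun.rep_eq)

lemma clinear_op_zero: "clinear_op 0"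
  and clinear_op_id: "clinear_op id_blinfun"
  and clinear_op_add: "clinear_op S \<Longrightarrow> clinear_op T \<Longrightarrow> clinear_op (S + T)"
  and clinear_op_scaleC: "clinear_op T \<Longrightarrow> clinear_op (c *\<^sub>C T)"
  by (simp_all add: clinear_op_def scaleC_add_right blinfun.add_left scaleC_scaleC mult.commute)

lemma clinear_op_compose: "clinear_op S \<Longrightarrow> clinear_op T \<Longrightarrow> clinear_op (S o\<^sub>L T)"
  by (simp add: clinear_op_def)

lemma bounded_linear_scaleC: "bounded_linear (\<lambda>x. c *\<^sub>C x :: 'a::complex_normed_vector)"
  by (rule bounded_linear_intro[where K = "cmod c"])
    (simp_all add: scaleC_add_right scaleR_scaleC norm_scaleC mult.commute)

lemma closed_complex_ops: "closed complex_ops"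
proof -
  have "complex_ops = (\<Inter>c. \<Inter>f. {T :: 'x op. T (c *\<^sub>C f) = c *\<^sub>C T f})"
    by (auto simp: complex_ops_def)
  also have "closed \<dots>"
    by (intro closed_INT ballI closed_Collect_eq blinfun.continuous_on continuous_on_id continuous_on_const
        bounded_linear.continuous_on[OF bounded_linear_scaleC])
  finally show ?thesis .
qed

lemma clinear_op_eqI:
  assumes "clinear_op S" "clinear_op T" "\<And>x. S (ket x) = T (ket x)"
  shows "S = T"
  by (rule blinfun_eqI, rule bounded_linear_eq_on_kets)
    (simp_all add: blinfun.bounded_linear_right assms(3) clinear_opD[OF assms(1)] clinear_opD[OF assms(2)])

lemma norm_op_le_cinnerI:
  assumes "\<And>f g. cmod (cinner g (blinfun_apply T f)) \<le> K * norm g * norm f" "0 \<le> K"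
  shows "norm T \<le> K"
proof (rule norm_blinfun_bound)
  show "norm (T f) \<le> K * norm f" for f
    by (rule norm_le_cinnerI) (use assms(1)[of _ f] in \<open>simp add: ac_simps\<close>)
qed fact

section \<open>Adjoints\<close>

lemma cinner_ext:
  assumes "\<And>g. cinner f g = cinner f' g"
  shows "f = f'"
proof -
  have "cinner (f - f') (f - f') = 0"
    by (simp only: cinner_diff_left assms) simp
  then show ?thesis
    by (simp add: cinner_self)
qed

lemma adj_eqI:
  fixes S T :: "'x op"
  assumes "\<And>f g. cinner (S f) g = cinner f (T g)"
  shows "adj T = S"
  unfolding adj_def
proof (rule the_equality)
  fix S' :: "'x op"
  assume "\<forall>f g. cinner (S' f) g = cinner f (T g)"
  then show "S' = S"
    by (intro blinfun_eqI cinner_ext) (simp add: assms)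
qed (simp add: assms)

text \<open>The coordinates of the adjoint are forced: the one of \<open>S f\<close> at x must be
  \<open>cinner (T (ket x)) f\<close>. It remains to see that these numbers are square summable with
  the right bound.\<close>

lemma adj_exists:
  fixes T :: "'x op"
  assumes "clinear_op T"
  obtains S :: "'x op" where "clinear_op S" "\<And>f g. cinner (S f) g = cinner f (T g)" "norm S \<le> norm T"
proof -
  define P where "P f x = cinner (T (ket x)) f" for f x
  have bd: "(\<Sum>x\<in>F. (cmod (P f x))\<^sup>2) \<le> (norm T * norm f)\<^sup>2" if "finite F" for f and F :: "'x set"
  proof -
    \<comment> \<open>The finite vector made of the coordinates in question serves as its own test
      vector: \<open>s\<close> is its squared norm and is at most
      \<open>norm T * norm f * norm v\<close>, so one factor cancels.\<close>
    define v where "v = (\<Sum>x\<in>F. P f x *\<^sub>C ket x)"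
    define s where "s = (\<Sum>x\<in>F. (cmod (P f x))\<^sup>2)"
    have "0 \<le> s"
      by (simp add: s_def sum_nonneg)
    have "cinner (T v) f = of_real s"
      by (simp add: v_def s_def blinfun.sum_right clinear_opD[OF assms] cinner_sum_left cinner_scaleC_left
          complex_norm_square mult.commute P_def[symmetric] del: of_real_power)
    then have "s = cmod (cinner (T v) f)"
      using \<open>0 \<le> s\<close> by simp
    also have "\<dots> \<le> norm T * norm v * norm f"
      by (rule order_trans[OF cmod_cinner_le]) (simp add: norm_blinfun mult_right_mono)
    finally have le: "s \<le> norm T * norm f * norm v"
      by (simp add: mult.assoc mult.commute[of "norm v"])
    have "Rep_ell2 v x = (if x \<in> F then P f x else 0)" for x
    proof -
      have "Rep_ell2 v x = (\<Sum>y\<in>F. if x = y then P f y else 0)"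
        unfolding v_def Rep_ell2_sum by (intro sum.cong) (auto simp: scaleC_ell2.rep_eq Rep_ell2_ket)
      then show ?thesis
        using that by simp
    qed
    then have "cinner v v = of_real s"
      by (subst (1) v_def) (simp add: s_def cinner_sum_left cinner_scaleC_left cinner_ket complex_norm_square
         mult.commute del: of_real_power)
    then have s: "s = (norm v)\<^sup>2"
      using of_real_eq_iff by (metis cinner_self)
    have "norm v \<le> norm T * norm f"
    proof (cases "norm v = 0")
      case False
      then show ?thesis
        using le unfolding s power2_eq_square by simp
    qed simp
    then have "(norm v)\<^sup>2 \<le> (norm T * norm f)\<^sup>2"
      by (rule power_mono) simp
    then show ?thesis
      by (simp add: s[symmetric] s_def)
  qed
  have rep: "Rep_ell2 (Abs_ell2 (P f)) = P f" and nrm: "norm (Abs_ell2 (P f)) \<le> norm T * norm f" for f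
    by (rule ell2_exI[OF bd]; simp)+
  have "bounded_linear (\<lambda>f. Abs_ell2 (P f))"
    by (rule bounded_linear_intro[where K = "norm T"])
      (auto intro!: ell2_eqI simp: rep nrm plus_ell2.rep_eq scaleR_ell2.rep_eq P_def cinner_add_right
        cinner_scaleR_right mult.commute[of _ "norm T"] scaleR_conv_of_real)
  then obtain S :: "'x op" where S: "\<And>f. S f = Abs_ell2 (P f)"
    by (metis bounded_linear_Blinfun_apply)
  have "clinear_op S"
    unfolding clinear_op_def S
    by (auto intro!: ell2_eqI simp: rep scaleC_ell2.rep_eq P_def cinner_scaleC_right)
  moreover have "cinner (S f) g = cinner f (T g)" for f g
  proof (rule bounded_linear_eq_on_kets[where S = "cinner (S f)" and T = "\<lambda>g. cinner f (T g)"])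
    show "bounded_linear (cinner (S f))" "bounded_linear (\<lambda>g. cinner f (T g))"
      by (auto intro: bounded_linear_cinner_right bounded_linear_compose[OF bounded_linear_cinner_right]
          simp: blinfun.bounded_linear_right)
    have "cinner (S f) (ket x) = cinner f (T (ket x))" for x
      by (subst (1 2) cinner_cnj[symmetric]) (simp add: cinner_ket S rep P_def)
    then show "cinner (S f) (c *\<^sub>C ket x) = cinner f (T (c *\<^sub>C ket x))" for c x
      by (simp add: cinner_scaleC_right clinear_opD[OF assms])
  qed
  moreover have "norm S \<le> norm T"
    by (rule norm_blinfun_bound) (simp_all add: S nrm)
  ultimately show ?thesis
    by (rule that)
qed

lemma
  fixes T :: "'x op"
  assumes "clinear_op T"
  shows cinner_adj_left: "cinner (adj T f) g = cinner f (T g)"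
    and clinear_op_adj: "clinear_op (adj T)"
    and norm_adj_le: "norm (adj T) \<le> norm T"
proof -
  obtain S where S: "clinear_op S" "\<And>f g. cinner (blinfun_apply S f) g = cinner f (T g)" "norm S \<le> norm T"
    using adj_exists[OF assms] by metis
  then have "adj T = S"
    by (intro adj_eqI)
  then show "cinner (adj T f) g = cinner f (T g)" "clinear_op (adj T)" "norm (adj T) \<le> norm T"
    using S by simp_all
qed

lemma cinner_adj_right: "clinear_op T \<Longrightarrow> cinner f (adj T g) = cinner (blinfun_apply T f) g"
  by (subst (1 2) cinner_cnj[symmetric]) (simp add: cinner_adj_left)

lemma adj_adj: "clinear_op T \<Longrightarrow> adj (adj T) = T"
  by (rule adj_eqI) (simp add: cinner_adj_right)

lemma adj_add: "clinear_op S \<Longrightarrow> clinear_op T \<Longrightarrow> adj (S + T) = adj S + adj T"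
  by (rule adj_eqI) (simp add: cinner_adj_left blinfun.add_left cinner_add_left cinner_add_right)

lemma adj_scaleC: "clinear_op T \<Longrightarrow> adj (c *\<^sub>C T) = cnj c *\<^sub>C adj T"
  by (rule adj_eqI) (simp add: cinner_adj_left cinner_scaleC_left cinner_scaleC_right)

lemma adj_compose: "clinear_op S \<Longrightarrow> clinear_op T \<Longrightarrow> adj (S o\<^sub>L T) = adj T o\<^sub>L adj S"
  by (rule adj_eqI) (simp add: cinner_adj_left)

lemma cinner_adj_compose: "clinear_op T \<Longrightarrow> cinner f (adj T (blinfun_apply T f)) = of_real ((norm (T f))\<^sup>2)"
  by (simp add: cinner_adj_right cinner_self)

lemma adj_eq_on_kets:
  fixes S T :: "'x op"
  assumes "clinear_op S" "clinear_op T"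
    "\<And>x y. Rep_ell2 (S (ket x)) y = cnj (Rep_ell2 (T (ket y)) x)"
  shows "adj T = S"
proof (rule clinear_op_eqI)
  show "adj T (ket x) = S (ket x)" for x
  proof (rule ell2_eqI)
    fix y
    have "Rep_ell2 (adj T (ket x)) y = cinner (T (ket y)) (ket x)"
      by (simp add: cinner_ket[symmetric] cinner_adj_right assms)
    then show "Rep_ell2 (adj T (ket x)) y = Rep_ell2 (S (ket x)) y"
      by (subst (asm) cinner_cnj[symmetric]) (simp add: cinner_ket assms(3))
  qed
qed (simp_all add: clinear_op_adj assms)

section \<open>Partial isometries induced by injections\<close>

lemma clinear_op_pullback: "inj_on p S \<Longrightarrow> clinear_op (pullback S p)"
  unfolding clinear_op_def by (auto intro!: ell2_eqI simp: pullback_apply scaleC_ell2.rep_eq)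

lemma norm_pullback_le:
  assumes "inj_on p S"
  shows "norm (pullback S p) \<le> 1"
proof (rule norm_blinfun_bound)
  fix f :: "'b ell2"
  show "norm (pullback S p f) \<le> 1 * norm f"
  proof (rule norm_ell2_le)
    fix F :: "'a set"
    assume "finite F"
    have "(\<Sum>x\<in>F. (cmod (Rep_ell2 (pullback S p f) x))\<^sup>2) = (\<Sum>x\<in>F \<inter> S. (cmod (Rep_ell2 f (p x)))\<^sup>2)"
      using \<open>finite F\<close> by (auto simp: pullback_apply[OF assms]
        intro!: sum.mono_neutral_cong_right split: if_splits)
    also have "\<dots> = (\<Sum>y\<in>p ` (F \<inter> S). (cmod (Rep_ell2 f y))\<^sup>2)"
      by (subst sum.reindex) (auto intro: inj_on_subset[OF assms])
    also have "\<dots> \<le> (norm f)\<^sup>2"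
      by (rule sum_cmod_le_norm_ell2) (simp add: \<open>finite F\<close>)
    finally show "(\<Sum>x\<in>F. (cmod (Rep_ell2 (pullback S p f) x))\<^sup>2) \<le> (1 * norm f)\<^sup>2"
      by simp
  qed simp
qed simp

lemma pullback_ket_zero:
  assumes "inj_on p S" "y \<notin> p ` S"
  shows "pullback S p (ket y) = 0"
  by (rule ell2_eqI) (use assms(2) in \<open>auto simp: pullback_apply[OF assms(1)] Rep_ell2_ket zero_ell2.rep_eq\<close>)

lemma pullback_ket:
  assumes "inj_on p S" "x \<in> S" "p x = y"
  shows "pullback S p (ket y) = ket x"
  by (rule ell2_eqI) (use assms in \<open>auto simp: pullback_apply[OF assms(1)] Rep_ell2_ket dest: inj_onD\<close>)


section \<open>Tensor products of operators\<close>

lemma Rep_tensor_ell2: "Rep_ell2 (f \<otimes>\<^sub>v g) (x, y) = Rep_ell2 f x * Rep_ell2 g y"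
  by (simp add: tensor_ell2.rep_eq)

lemma ket_tensor: "ket x \<otimes>\<^sub>v ket y = ket (x, y)"
  by (rule ell2_eqI) (auto simp: tensor_ell2.rep_eq Rep_ell2_ket split: prod.splits if_splits)

lemma tensor_ell2_scaleC_left: "(c *\<^sub>C f) \<otimes>\<^sub>v g = c *\<^sub>C (f \<otimes>\<^sub>v g)"
  and tensor_ell2_scaleC_right: "f \<otimes>\<^sub>v (c *\<^sub>C g) = c *\<^sub>C (f \<otimes>\<^sub>v g)"
  and tensor_ell2_add_left: "(f + f') \<otimes>\<^sub>v g = f \<otimes>\<^sub>v g + f' \<otimes>\<^sub>v g"
  and tensor_ell2_add_right: "f \<otimes>\<^sub>v (g + g') = f \<otimes>\<^sub>v g + f \<otimes>\<^sub>v g'"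
  and tensor_ell2_zero_left: "0 \<otimes>\<^sub>v g = 0"
  and tensor_ell2_zero_right: "f \<otimes>\<^sub>v 0 = 0"
  by (rule ell2_eqI; auto simp: tensor_ell2.rep_eq scaleC_ell2.rep_eq plus_ell2.rep_eq zero_ell2.rep_eq
    algebra_simps)+

lemma cinner_tensor_ell2: "cinner (f \<otimes>\<^sub>v g) (f' \<otimes>\<^sub>v g') = cinner f f' * cinner g g'"
proof -
  define P where "P x y = (cnj (Rep_ell2 f x) * Rep_ell2 f' x) * (cnj (Rep_ell2 g y) * Rep_ell2 g' y)" for x y
  have *: "(\<lambda>z. cnj (Rep_ell2 (f \<otimes>\<^sub>v g) z) * Rep_ell2 (f' \<otimes>\<^sub>v g') z) = (\<lambda>(x, y). P x y)"
    by (auto simp: P_def Rep_tensor_ell2 algebra_simps)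
  have "(\<lambda>(x, y). P x y) summable_on UNIV \<times> UNIV"
    using cinner_summable[of "f \<otimes>\<^sub>v g" "f' \<otimes>\<^sub>v g'"] by (simp add: *)
  from infsum_Sigma'_banach[OF this]
  have "cinner (f \<otimes>\<^sub>v g) (f' \<otimes>\<^sub>v g') = (\<Sum>\<^sub>\<infinity>x. \<Sum>\<^sub>\<infinity>y. P x y)"
    by (simp add: cinner.rep_eq *)
  then show ?thesis
    unfolding P_def infsum_cmult_right' infsum_cmult_left' cinner.rep_eq .
qed

lemma norm_tensor_ell2: "norm (f \<otimes>\<^sub>v g) = norm f * norm g"
proof -
  have "(norm (f \<otimes>\<^sub>v g))\<^sup>2 = (norm f * norm g)\<^sup>2"
    using cinner_tensor_ell2[of f g f g] unfolding cinner_self power_mult_distrib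
    by (metis of_real_eq_iff of_real_mult)
  then show ?thesis
    by (simp add: power2_eq_iff_nonneg)
qed

text \<open>S acts on each slice with fixed second coordinate. The squared norms of finitely many
  slices add up to at most the squared norm of the vector, so the bound of S survives.\<close>

lemma amplification_exists:
  fixes S :: "'x op"
  assumes "clinear_op S"
  obtains R :: "('x \<times> 'y) op"
  where "clinear_op R" "\<And>f g. R (f \<otimes>\<^sub>v g) = S f \<otimes>\<^sub>v g" "norm R \<le> norm S"
proof -
  define slice where "slice f y = Abs_ell2 (\<lambda>x. Rep_ell2 f (x, y))" for f :: "('x \<times> 'y) ell2" and y
  have slice: "Rep_ell2 (slice f y) x = Rep_ell2 f (x, y)" for f x y
  proof -
    have "(\<Sum>x\<in>F. (cmod (Rep_ell2 f (x, y)))\<^sup>2) \<le> (norm f)\<^sup>2" if "finite F" for F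
      using sum_cmod_le_norm_ell2[of "(\<lambda>x. (x, y)) ` F" f] that by (simp add: sum.reindex inj_on_def)
    then show ?thesis
      unfolding slice_def by (subst ell2_exI(1)[where B = "norm f"]) auto
  qed
  have slices: "(\<Sum>y\<in>D. (norm (slice f y))\<^sup>2) \<le> (norm f)\<^sup>2" if "finite D" for f D
  proof (rule has_sum_mono2)
    let ?q = "\<lambda>z. (cmod (Rep_ell2 f z))\<^sup>2"
    show "(?q has_sum (norm f)\<^sup>2) UNIV"
      by (simp add: norm_ell2_power2 ell2_summable)
    show "(?q has_sum (\<Sum>y\<in>D. (norm (slice f y))\<^sup>2)) (\<Union>y\<in>D. (\<lambda>x. (x, y)) ` UNIV)"
    proof (rule sum_has_sum)
      have "((?q \<circ> (\<lambda>x. (x, y))) has_sum (norm (slice f y))\<^sup>2) UNIV" for y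
        using ell2_summable[of "slice f y"] by (simp add: norm_ell2_power2 slice o_def)
      then show "(?q has_sum (norm (slice f y))\<^sup>2) ((\<lambda>x. (x, y)) ` UNIV)" for y
        by (subst has_sum_reindex) (auto simp: inj_on_def)
    qed (use that in auto)
  qed auto
  define P where "P f = (\<lambda>(x, y). Rep_ell2 (S (slice f y)) x)" for f
  then have P: "P f (x, y) = Rep_ell2 (S (slice f y)) x" for f x y
    by simp
  have bd: "(\<Sum>z\<in>F. (cmod (P f z))\<^sup>2) \<le> (norm S * norm f)\<^sup>2" if "finite F" for f F
  proof -
    have "(\<Sum>z\<in>F. (cmod (P f z))\<^sup>2) \<le> (\<Sum>z\<in>fst ` F \<times> snd ` F. (cmod (P f z))\<^sup>2)"
      using that by (intro sum_mono2) (auto simp: rev_image_eqI)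
    also have "\<dots> = (\<Sum>y\<in>snd ` F. \<Sum>x\<in>fst ` F. (cmod (Rep_ell2 (S (slice f y)) x))\<^sup>2)"
      by (subst sum.swap) (simp add: P_def sum.cartesian_product case_prod_unfold)
    also have "\<dots> \<le> (\<Sum>y\<in>snd ` F. (norm (S (slice f y)))\<^sup>2)"
      using that by (intro sum_mono sum_cmod_le_norm_ell2) simp
    also have "\<dots> \<le> (\<Sum>y\<in>snd ` F. (norm S)\<^sup>2 * (norm (slice f y))\<^sup>2)"
      by (intro sum_mono) (metis norm_blinfun norm_ge_zero power_mono power_mult_distrib)
    also have "\<dots> \<le> (norm S * norm f)\<^sup>2"
      unfolding sum_distrib_left[symmetric] power_mult_distrib
      using that by (intro mult_left_mono slices) auto
    finally show ?thesis .
  qed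
  have rep: "Rep_ell2 (Abs_ell2 (P f)) = P f" and nrm: "norm (Abs_ell2 (P f)) \<le> norm S * norm f" for f
    by (rule ell2_exI[OF bd]; simp)+
  have [simp]: "slice (f + g) y = slice f y + slice g y" "slice (r *\<^sub>R f) y = r *\<^sub>R slice f y"
    "slice (c *\<^sub>C f) y = c *\<^sub>C slice f y" for f g r c y
    by (auto intro!: ell2_eqI simp: slice plus_ell2.rep_eq scaleR_ell2.rep_eq scaleC_ell2.rep_eq)
  have sl: "slice (f \<otimes>\<^sub>v g) y = Rep_ell2 g y *\<^sub>C f" for f g y
    by (auto intro!: ell2_eqI simp: slice scaleC_ell2.rep_eq Rep_tensor_ell2)
  have "bounded_linear (\<lambda>f. Abs_ell2 (P f))"
    by (rule bounded_linear_intro[where K = "norm S"])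
      (auto intro!: ell2_eqI simp: rep nrm plus_ell2.rep_eq scaleR_ell2.rep_eq P blinfun.add_right
        blinfun.scaleR_right mult.commute[of _ "norm S"])
  then obtain R :: "('x \<times> 'y) op" where R: "\<And>f. R f = Abs_ell2 (P f)"
    by (metis bounded_linear_Blinfun_apply)
  have "clinear_op R"
    unfolding clinear_op_def R
    by (auto intro!: ell2_eqI simp: rep scaleC_ell2.rep_eq P clinear_opD[OF assms])
  moreover have "R (f \<otimes>\<^sub>v g) = S f \<otimes>\<^sub>v g" for f g
    by (auto intro!: ell2_eqI simp: R rep P sl clinear_opD[OF assms] scaleC_ell2.rep_eq Rep_tensor_ell2)
  moreover have "norm R \<le> norm S"
    by (rule norm_blinfun_bound) (simp_all add: R nrm)
  ultimately show ?thesis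
    by (rule that)
qed

text \<open>Only amplifications on the left factor are available; conjugating with the coordinate
  flip supplies the right factor, and the tensor product is the product of the two.\<close>

lemma tensor_op_exists:
  fixes S :: "'x op" and T :: "'y op"
  assumes "clinear_op S" "clinear_op T"
  obtains R :: "('x \<times> 'y) op"
  where "clinear_op R" "\<And>f g. R (f \<otimes>\<^sub>v g) = S f \<otimes>\<^sub>v T g" "norm R \<le> norm S * norm T"
proof -
  obtain R1 :: "('x \<times> 'y) op" where R1: "clinear_op R1" "\<And>f g. R1 (f \<otimes>\<^sub>v g) = S f \<otimes>\<^sub>v g" "norm R1 \<le> norm S"
    using amplification_exists[OF assms(1)] by metis
  obtain R2 :: "('y \<times> 'x) op" where R2: "clinear_op R2" "\<And>f g. R2 (f \<otimes>\<^sub>v g) = T f \<otimes>\<^sub>v g" "norm R2 \<le> norm T"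
    using amplification_exists[OF assms(2)] by metis
  define F1 :: "('x \<times> 'y) ell2 \<Rightarrow>\<^sub>L ('y \<times> 'x) ell2" where "F1 = pullback UNIV prod.swap"
  define F2 :: "('y \<times> 'x) ell2 \<Rightarrow>\<^sub>L ('x \<times> 'y) ell2" where "F2 = pullback UNIV prod.swap"
  have F: "clinear_op F1" "clinear_op F2" "norm F1 \<le> 1" "norm F2 \<le> 1"
    by (simp_all add: F1_def F2_def clinear_op_pullback norm_pullback_le)
  have sw: "F1 (f \<otimes>\<^sub>v g) = g \<otimes>\<^sub>v f" "F2 (g \<otimes>\<^sub>v f) = f \<otimes>\<^sub>v g" for f g
    by (auto intro!: ell2_eqI simp: F1_def F2_def pullback_apply Rep_tensor_ell2)
  have "norm (R1 o\<^sub>L (F2 o\<^sub>L (R2 o\<^sub>L F1))) \<le> norm R1 * (norm F2 * (norm R2 * norm F1))"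
    by (meson norm_blinfun_compose mult_left_mono norm_ge_zero order_trans)
  also have "\<dots> \<le> norm S * (1 * (norm T * 1))"
    using R1 R2 F by (intro mult_mono) auto
  finally show ?thesis
    using R1 R2 F by (intro that[of "R1 o\<^sub>L (F2 o\<^sub>L (R2 o\<^sub>L F1))"])
      (auto intro!: clinear_op_compose simp: sw)
qed

lemma tensor_op_unique:
  fixes R R' :: "('x \<times> 'y) op"
  assumes "\<And>f g. R (f \<otimes>\<^sub>v g) = R' (f \<otimes>\<^sub>v g)"
  shows "R = R'"
proof (rule blinfun_eqI, rule bounded_linear_eq_on_kets[where S = R and T = R'])
  show "R (c *\<^sub>C ket z) = R' (c *\<^sub>C ket z)" for c z
    using assms[of "c *\<^sub>C ket (fst z)" "ket (snd z)"] by (simp add: tensor_ell2_scaleC_left ket_tensor)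
qed (simp_all add: blinfun.bounded_linear_right)

lemma
  fixes S :: "'x op" and T :: "'y op"
  assumes "clinear_op S" "clinear_op T"
  shows tensor_op_apply: "(S \<otimes>\<^sub>o T) (f \<otimes>\<^sub>v g) = S f \<otimes>\<^sub>v T g"
    and clinear_op_tensor: "clinear_op (S \<otimes>\<^sub>o T)"
    and norm_tensor_op_le: "norm (S \<otimes>\<^sub>o T) \<le> norm S * norm T"
proof -
  obtain R where R: "clinear_op R" "\<And>f g. R (f \<otimes>\<^sub>v g) = S f \<otimes>\<^sub>v T g" "norm R \<le> norm S * norm T"
    using tensor_op_exists[OF assms] by metis
  have "S \<otimes>\<^sub>o T = R"
    unfolding tensor_op_def by (rule the_equality) (auto simp: R intro: tensor_op_unique)
  then show "(S \<otimes>\<^sub>o T) (f \<otimes>\<^sub>v g) = S f \<otimes>\<^sub>v T g" "clinear_op (S \<otimes>\<^sub>o T)" "norm (S \<otimes>\<^sub>o T) \<le> norm S * norm T"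
    using R by simp_all
qed

lemma tensor_op_eqI:
  fixes S :: "'x op" and T :: "'y op"
  assumes "clinear_op S" "clinear_op T" "clinear_op R"
    "\<And>x y. R (ket (x, y)) = S (ket x) \<otimes>\<^sub>v T (ket y)"
  shows "S \<otimes>\<^sub>o T = R"
proof (rule clinear_op_eqI)
  show "(S \<otimes>\<^sub>o T) (ket z) = R (ket z)" for z
    using tensor_op_apply[OF assms(1,2), of "ket (fst z)" "ket (snd z)"]
      by (simp add: ket_tensor assms(4)[symmetric])
qed (simp_all add: clinear_op_tensor assms)

lemma tensor_op_add_left:
    "clinear_op S \<Longrightarrow> clinear_op S' \<Longrightarrow> clinear_op T \<Longrightarrow> (S + S') \<otimes>\<^sub>o T = S \<otimes>\<^sub>o T + S' \<otimes>\<^sub>o T"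
  and tensor_op_scaleC_left: "clinear_op S \<Longrightarrow> clinear_op T \<Longrightarrow> (c *\<^sub>C S) \<otimes>\<^sub>o T = c *\<^sub>C (S \<otimes>\<^sub>o T)"
  and tensor_op_add_right:
    "clinear_op T \<Longrightarrow> clinear_op T' \<Longrightarrow> clinear_op S \<Longrightarrow> S \<otimes>\<^sub>o (T + T') = S \<otimes>\<^sub>o T + S \<otimes>\<^sub>o T'"
  and tensor_op_scaleC_right: "clinear_op S \<Longrightarrow> clinear_op T \<Longrightarrow> S \<otimes>\<^sub>o (c *\<^sub>C T) = c *\<^sub>C (S \<otimes>\<^sub>o T)"
  by (rule tensor_op_unique; simp add: tensor_op_apply clinear_op_tensor clinear_op_add clinear_op_scaleC
      blinfun.add_left tensor_ell2_add_left tensor_ell2_add_right tensor_ell2_scaleC_left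
        tensor_ell2_scaleC_right)+

section \<open>Bounded linear maps on closed spans\<close>

lemma subspace_closure:
  fixes V :: "'a::complex_normed_vector set"
  assumes "complex_vector.subspace V"
  shows "complex_vector.subspace (closure V)"
proof -
  have "x + y \<in> closure V" if x: "x \<in> closure V" and y: "y \<in> closure V" for x y
  proof -
    obtain f where f: "\<And>n. f n \<in> V" "f \<longlonglongrightarrow> x"
      using x unfolding closure_sequential by blast
    obtain g where g: "\<And>n. g n \<in> V" "g \<longlonglongrightarrow> y"
      using y unfolding closure_sequential by blast
    note fg = f g
    then have "(\<lambda>n. f n + g n) \<longlonglongrightarrow> x + y"
      by (intro tendsto_add)
    then show ?thesis
      using fg complex_vector.subspace_add[OF assms] unfolding closure_sequential
      by (intro exI[of _ "\<lambda>n. f n + g n"]) blast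
  qed
  moreover have "c *\<^sub>C x \<in> closure V" if x: "x \<in> closure V" for c x
  proof -
    obtain f where f: "\<And>n. f n \<in> V" "f \<longlonglongrightarrow> x"
      using x unfolding closure_sequential by blast
    then have "(\<lambda>n. c *\<^sub>C f n) \<longlonglongrightarrow> c *\<^sub>C x"
      by (intro bounded_linear.tendsto[OF bounded_linear_scaleC])
    then show ?thesis
      using f complex_vector.subspace_scale[OF assms] unfolding closure_sequential
      by (intro exI[of _ "\<lambda>n. c *\<^sub>C f n"]) blast
  qed
  moreover have "0 \<in> closure V"
    using complex_vector.subspace_0[OF assms] closure_subset by blast
  ultimately show ?thesis
    by (simp add: complex_vector.subspace_def)
qed

definition cspace :: "'a::complex_normed_vector set \<Rightarrow> 'a set"
  where "cspace S = closure (cspan S)"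

lemma subspace_cspace: "complex_vector.subspace (cspace S)"
  unfolding cspace_def by (intro subspace_closure complex_vector.subspace_span)

lemma closed_cspace: "closed (cspace S)"
  by (simp add: cspace_def)

lemma cspace_base: "x \<in> S \<Longrightarrow> x \<in> cspace S"
  unfolding cspace_def using closure_subset complex_vector.span_base by blast

lemma cspan_subset_cspace: "cspan S \<subseteq> cspace S"
  unfolding cspace_def by (rule closure_subset)

lemma cspace_zero: "0 \<in> cspace S"
  and cspace_add: "x \<in> cspace S \<Longrightarrow> y \<in> cspace S \<Longrightarrow> x + y \<in> cspace S"
  and cspace_scaleC: "x \<in> cspace S \<Longrightarrow> c *\<^sub>C x \<in> cspace S"
  using subspace_cspace[of S]
  by (auto intro: complex_vector.subspace_0 complex_vector.subspace_add complex_vector.subspace_scale)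

lemma cspace_minimal:
  assumes "S \<subseteq> M" "complex_vector.subspace M" "closed M"
  shows "cspace S \<subseteq> M"
  unfolding cspace_def by (intro closure_minimal complex_vector.span_minimal assms)

lemma bounded_clinear_onI:
  assumes "\<And>x y. x \<in> V \<Longrightarrow> y \<in> V \<Longrightarrow> L (x + y) = L x + L y"
    "\<And>c x. x \<in> V \<Longrightarrow> L (c *\<^sub>C x) = c *\<^sub>C L x"
    "\<And>x. x \<in> V \<Longrightarrow> norm (L x) \<le> K * norm x"
  shows "bounded_clinear_on V L"
  using assms unfolding bounded_clinear_on_def by blast

lemma bounded_clinear_on_cong:
  assumes "bounded_clinear_on V L" "\<And>x. x \<in> V \<Longrightarrow> L x = L' x" "complex_vector.subspace V"
  shows "bounded_clinear_on V L'"
proof -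
  obtain K where "\<And>x. x \<in> V \<Longrightarrow> norm (L x) \<le> K * norm x"
    using assms(1) unfolding bounded_clinear_on_def by blast
  moreover have "x + y \<in> V" "c *\<^sub>C x \<in> V" if "x \<in> V" "y \<in> V" for x y c
    using that assms(3) by (simp_all add: complex_vector.subspace_add complex_vector.subspace_scale)
  ultimately show ?thesis
    using assms(1)[unfolded bounded_clinear_on_def]
    by (intro bounded_clinear_onI[of V L' K]) (simp_all flip: assms(2))
qed

lemma bounded_clinear_on_compose:
  assumes "bounded_clinear_on V L" "bounded_clinear_on W M" "L ` V \<subseteq> W"
  shows "bounded_clinear_on V (\<lambda>x. M (L x))"
proof -
  obtain K K' where K: "\<And>x. x \<in> V \<Longrightarrow> norm (L x) \<le> K * norm x" "\<And>y. y \<in> W \<Longrightarrow> norm (M y) \<le> K' * norm y"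
    using assms(1,2) unfolding bounded_clinear_on_def by blast
  show ?thesis
  proof (rule bounded_clinear_onI[where K = "\<bar>K'\<bar> * \<bar>K\<bar>"])
    fix x
    assume "x \<in> V"
    then have "norm (M (L x)) \<le> \<bar>K'\<bar> * norm (L x)"
      using K(2)[of "L x"] assms(3) by (smt (verit) image_subset_iff mult_right_mono norm_ge_zero)
    also have "norm (L x) \<le> \<bar>K\<bar> * norm x"
      using K(1)[OF \<open>x \<in> V\<close>] by (smt (verit) mult_right_mono norm_ge_zero)
    finally show "norm (M (L x)) \<le> \<bar>K'\<bar> * \<bar>K\<bar> * norm x"
      by (simp add: mult_left_mono mult.assoc)
  qed (use assms in \<open>auto simp: bounded_clinear_on_def image_subset_iff\<close>)
qed

lemma bounded_clinear_on_linear: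
  assumes "bounded_clinear_on V L" "x \<in> V" "y \<in> V" "complex_vector.subspace V"
  shows "L (x + y) = L x + L y" "L (c *\<^sub>C x) = c *\<^sub>C L x" "L (x - y) = L x - L y" "L 0 = 0"
proof -
  show add: "L (x + y) = L x + L y" and scale: "L (c *\<^sub>C x) = c *\<^sub>C L x"
    using assms unfolding bounded_clinear_on_def by blast+
  have "x - y \<in> V"
    using assms by (simp add: complex_vector.subspace_diff)
  then have "L (x - y + y) = L (x - y) + L y"
    using assms unfolding bounded_clinear_on_def by blast
  then show "L (x - y) = L x - L y"
    by simp
  have "L (0 *\<^sub>C x) = 0 *\<^sub>C L x"
    using assms unfolding bounded_clinear_on_def by blast
  then show "L 0 = 0"
    by simp
qed

lemma bounded_clinear_on_sum:
  assumes "bounded_clinear_on V L" "complex_vector.subspace V" "\<And>i. i \<in> I \<Longrightarrow> v i \<in> V"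
  shows "L (\<Sum>i\<in>I. c i *\<^sub>C v i) = (\<Sum>i\<in>I. c i *\<^sub>C L (v i))"
  using assms(3)
proof (induction I rule: infinite_finite_induct)
  case (insert i I)
  then have "(\<Sum>i\<in>I. c i *\<^sub>C v i) \<in> V" "c i *\<^sub>C v i \<in> V" "v i \<in> V"
    using assms(2) by (auto intro: complex_vector.subspace_sum complex_vector.subspace_scale)
  then show ?case
    using insert bounded_clinear_on_linear[OF assms(1) _ _ assms(2)] by simp
qed (use bounded_clinear_on_linear[OF assms(1) _ _ assms(2)] complex_vector.subspace_0[OF assms(2)] in auto)

lemma bounded_clinear_on_continuous:
  assumes "bounded_clinear_on V L" "complex_vector.subspace V"
  shows "continuous_on V L"
proof -
  obtain K where K: "\<And>x. x \<in> V \<Longrightarrow> norm (L x) \<le> K * norm x"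
    using assms unfolding bounded_clinear_on_def by blast
  have "(\<bar>K\<bar>)-lipschitz_on V L"
  proof (rule lipschitz_onI)
    fix x y
    assume xy: "x \<in> V" "y \<in> V"
    then have "norm (L (x - y)) \<le> \<bar>K\<bar> * norm (x - y)"
      using K[of "x - y"] complex_vector.subspace_diff[OF assms(2) xy]
        by (smt (verit) mult_right_mono norm_ge_zero)
    then show "dist (L x) (L y) \<le> \<bar>K\<bar> * dist x y"
      using bounded_clinear_on_linear(3)[OF assms(1) xy assms(2)] by (simp add: dist_norm)
  qed simp
  then show ?thesis
    by (rule lipschitz_on_continuous_on)
qed

text \<open>The preimage of a closed subspace is again one, so it contains the closed span once it
  contains the generators. The choice of M decides the use: a target algebra for range statements,
  \<open>complex_ops\<close> for complex linearity, \<open>{0}\<close> for identities.\<close>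

lemma bounded_clinear_on_preimage:
  assumes "bounded_clinear_on (cspace S) L" "complex_vector.subspace M" "closed M" "\<And>s. s \<in> S \<Longrightarrow> L s \<in> M"
    "x \<in> cspace S"
  shows "L x \<in> M"
proof -
  let ?P = "{x \<in> cspace S. L x \<in> M}"
  have lin: "L (x + y) = L x + L y" "L (c *\<^sub>C x) = c *\<^sub>C L x" "L 0 = 0"
    if "x \<in> cspace S" "y \<in> cspace S" for x y c
    using bounded_clinear_on_linear[OF assms(1) that subspace_cspace] by auto
  have "cspace S \<subseteq> ?P"
  proof (rule cspace_minimal)
    show "complex_vector.subspace ?P"
      unfolding complex_vector.subspace_def
      using lin lin(3)[OF cspace_zero cspace_zero] assms(2)
        by (auto simp: cspace_zero cspace_add cspace_scaleC complex_vector.subspace_def)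
    have "closedin (top_of_set (cspace S)) (cspace S \<inter> L -` M)"
      using bounded_clinear_on_continuous[OF assms(1) subspace_cspace] assms(3)
      by (rule continuous_closedin_preimage)
    then have "closed (cspace S \<inter> L -` M)"
      using closed_cspace closedin_closed_trans by blast
    also have "cspace S \<inter> L -` M = ?P"
      by auto
    finally show "closed ?P" .
  qed (use assms(4) in \<open>auto intro: cspace_base\<close>)
  then show ?thesis
    using assms(5) by blast
qed

lemma bounded_clinear_on_eqI:
  assumes L: "bounded_clinear_on (cspace S) L" and L': "bounded_clinear_on (cspace S) L'"
    and "\<And>s. s \<in> S \<Longrightarrow> L s = L' s" "x \<in> cspace S"
  shows "L x = L' x"
proof -
  obtain K K' where K: "\<And>x. x \<in> cspace S \<Longrightarrow> norm (L x) \<le> K * norm x"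
      "\<And>x. x \<in> cspace S \<Longrightarrow> norm (L' x) \<le> K' * norm x"
    using L L' unfolding bounded_clinear_on_def by blast
  have "bounded_clinear_on (cspace S) (\<lambda>x. L x - L' x)"
  proof (rule bounded_clinear_onI[where K = "K + K'"])
    fix x
    assume "x \<in> cspace S"
    then show "norm (L x - L' x) \<le> (K + K') * norm x"
      using K[of x] norm_triangle_ineq4[of "L x" "L' x"] by (simp add: algebra_simps)
  qed (simp_all add: bounded_clinear_on_linear(1,2)[OF L _ _ subspace_cspace]
      bounded_clinear_on_linear(1,2)[OF L' _ _ subspace_cspace] complex_vector.scale_right_diff_distrib)
  then have "L x - L' x \<in> {0}"
    by (rule bounded_clinear_on_preimage) (use assms in auto)
  then show ?thesis
    by simp
qed

lemma cspan_image_finite: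
  assumes "u \<in> cspan (v ` I)"
  obtains F c where "finite F" "F \<subseteq> I" "u = (\<Sum>i\<in>F. c i *\<^sub>C v i)"
proof -
  obtain t r where t: "finite t" "t \<subseteq> v ` I" "u = (\<Sum>a\<in>t. r a *\<^sub>C a)"
    using assms unfolding complex_vector.span_explicit by auto
  \<comment> \<open>Several indices may carry the same vector; one index is selected for each, so
    that coefficients can be indexed by I.\<close>
  obtain F where F: "F \<subseteq> I" "inj_on v F" "t = v ` F"
    using t(2) unfolding subset_image_inj by blast
  then show ?thesis
    using t by (intro that[of F "\<lambda>i. r (v i)"]) (auto simp: sum.reindex dest: finite_imageD)
qed

text \<open>The family \<open>v\<close> need not be linearly independent. The norm inequality does
  two things: a vanishing combination of the \<open>v i\<close> forces the same combination of the
  \<open>m i\<close> to vanish, and the resulting map is Lipschitz, so completeness of the target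
  extends it to the closure.\<close>

theorem bounded_clinear_extension:
  fixes v :: "'i \<Rightarrow> 'a::complex_normed_vector" and m :: "'i \<Rightarrow> 'b::{complex_normed_vector,banach}"
  assumes le: "\<And>F c. finite F \<Longrightarrow> F \<subseteq> I \<Longrightarrow>
    norm (\<Sum>i\<in>F. c i *\<^sub>C m i) \<le> K * norm (\<Sum>i\<in>F. c i *\<^sub>C v i)"
  obtains L where "bounded_clinear_on (cspace (v ` I)) L" "\<And>i. i \<in> I \<Longrightarrow> L (v i) = m i"
proof -
  let ?V = "cspan (v ` I)"
  \<comment> \<open>A relation rather than a function, as u may have many representations;
    \<open>Runique\<close> applies the bound to the difference of two of them.\<close>
  define R where "R u w \<longleftrightarrow> (\<exists>F c. finite F \<and> F \<subseteq> I \<and> u = (\<Sum>i\<in>F. c i *\<^sub>C v i) \<and> w = (\<Sum>i\<in>F. c i *\<^sub>C m i))"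
    for u w
  have Rex: "\<exists>w. R u w" if "u \<in> ?V" for u
    using cspan_image_finite[OF that] unfolding R_def by metis
  have Rscale: "R (c *\<^sub>C u) (c *\<^sub>C w)" if uw: "R u w" for c u w
  proof -
    obtain F d where "finite F" "F \<subseteq> I" "u = (\<Sum>i\<in>F. d i *\<^sub>C v i)" "w = (\<Sum>i\<in>F. d i *\<^sub>C m i)"
      using uw unfolding R_def by blast
    then show ?thesis
      unfolding R_def
      by (intro exI[of _ F] exI[of _ "\<lambda>i. c * d i"]) (simp add: complex_vector.scale_sum_right scaleC_scaleC)
  qed
  have Radd: "R (u + u') (w + w')" if uw: "R u w" "R u' w'" for u u' w w'
  proof -
    obtain F c where F: "finite F" "F \<subseteq> I" "u = (\<Sum>i\<in>F. c i *\<^sub>C v i)" "w = (\<Sum>i\<in>F. c i *\<^sub>C m i)"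
      using uw(1) unfolding R_def by blast
    obtain F' c' where F': "finite F'" "F' \<subseteq> I" "u' = (\<Sum>i\<in>F'. c' i *\<^sub>C v i)" "w' = (\<Sum>i\<in>F'. c' i *\<^sub>C m i)"
      using uw(2) unfolding R_def by blast
    define d where "d i = (if i \<in> F then c i else 0) + (if i \<in> F' then c' i else 0)" for i
    have "(\<Sum>i\<in>F \<union> F'. d i *\<^sub>C x i) = (\<Sum>i\<in>F. c i *\<^sub>C x i) + (\<Sum>i\<in>F'. c' i *\<^sub>C x i)"
      for x :: "'i \<Rightarrow> 'c::complex_normed_vector"
    proof -
      have "(\<Sum>i\<in>F. c i *\<^sub>C x i) = (\<Sum>i\<in>F \<union> F'. (if i \<in> F then c i else 0) *\<^sub>C x i)"
        "(\<Sum>i\<in>F'. c' i *\<^sub>C x i) = (\<Sum>i\<in>F \<union> F'. (if i \<in> F' then c' i else 0) *\<^sub>C x i)"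
        using F(1) F'(1) by (auto intro!: sum.mono_neutral_cong_left)
      then show ?thesis
        by (simp add: d_def complex_vector.scale_left_distrib sum.distrib)
    qed
    note split = this
    show ?thesis
      unfolding R_def by (intro exI[of _ "F \<union> F'"] exI[of _ d]) (use F F' in \<open>simp add: split\<close>)
  qed
  have Rle: "norm w \<le> \<bar>K\<bar> * norm u" if "R u w" for u w
    using that le unfolding R_def by (smt (verit) mult_right_mono norm_ge_zero)
  have Runique: "w = w'" if "R u w" "R u w'" for u w w'
    using Rle[OF Radd[OF that(1) Rscale[OF that(2), of "-1"]]] by simp
  define L0 where "L0 u = (THE w. R u w)" for u
  have L0: "R u w \<Longrightarrow> L0 u = w" for u w
    unfolding L0_def using Runique by blast
  have RL0: "R u (L0 u)" if "u \<in> ?V" for u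
    using Rex[OF that] L0 by blast
  have Vdiff: "u - u' \<in> ?V" if "u \<in> ?V" "u' \<in> ?V" for u u'
    using that by (rule complex_vector.span_diff)
  have L0diff: "L0 (u - u') = L0 u - L0 u'" if "u \<in> ?V" "u' \<in> ?V" for u u'
    using L0[OF Radd[OF RL0[OF that(1)] Rscale[OF RL0[OF that(2)], of "-1"]]] by simp
  have "\<bar>K\<bar>-lipschitz_on ?V L0"
  proof (rule lipschitz_onI)
    fix u u'
    assume "u \<in> ?V" "u' \<in> ?V"
    then show "dist (L0 u) (L0 u') \<le> \<bar>K\<bar> * dist u u'"
      using Rle[OF RL0[OF Vdiff]] by (simp add: dist_norm L0diff)
  qed simp
  then have "uniformly_continuous_on ?V L0"
    by (rule lipschitz_on_uniformly_continuous)
  then obtain L where uc: "uniformly_continuous_on (closure ?V) L" and L: "\<And>u. u \<in> ?V \<Longrightarrow> L0 u = L u"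
    by (rule uniformly_continuous_on_extension_on_closure) (rule that)
  have cont: "continuous_on (cspace (v ` I)) L"
    using uc unfolding cspace_def by (rule uniformly_continuous_imp_continuous)
  have seq: "\<exists>f. (\<forall>n. f n \<in> ?V) \<and> f \<longlonglongrightarrow> u" if "u \<in> cspace (v ` I)" for u
    using that unfolding cspace_def closure_sequential .
  have lim: "(\<lambda>n. L0 (f n)) \<longlonglongrightarrow> L u" if "\<And>n. f n \<in> ?V" "f \<longlonglongrightarrow> u" "u \<in> cspace (v ` I)" for f u
  proof -
    have "(\<lambda>n. L (f n)) \<longlonglongrightarrow> L u"
      using cspan_subset_cspace that by (intro continuous_on_tendsto_compose[OF cont])
        (auto intro!: always_eventually)
    then show ?thesis
      using that(1) by (simp add: L)
  qed
  have "bounded_clinear_on (cspace (v ` I)) L"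
  proof (rule bounded_clinear_onI[where K = "\<bar>K\<bar>"])
    fix x y
    assume xy: "x \<in> cspace (v ` I)" "y \<in> cspace (v ` I)"
    obtain f g where fg: "\<And>n. f n \<in> ?V" "f \<longlonglongrightarrow> x" "\<And>n. g n \<in> ?V" "g \<longlonglongrightarrow> y"
      using seq[OF xy(1)] seq[OF xy(2)] by blast
    have "(\<lambda>n. L0 (f n + g n)) \<longlonglongrightarrow> L (x + y)"
      by (intro lim tendsto_add fg complex_vector.span_add cspace_add xy)
    moreover have "(\<lambda>n. L0 (f n + g n)) \<longlonglongrightarrow> L x + L y"
      using L0[OF Radd[OF RL0[OF fg(1)] RL0[OF fg(3)]]] lim[OF fg(1,2) xy(1)] lim[OF fg(3,4) xy(2)]
      by (simp add: tendsto_add)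
    ultimately show "L (x + y) = L x + L y"
      by (rule LIMSEQ_unique)
  next
    fix c x
    assume x: "x \<in> cspace (v ` I)"
    obtain f where f: "\<And>n. f n \<in> ?V" "f \<longlonglongrightarrow> x"
      using seq[OF x] by blast
    have "(\<lambda>n. L0 (c *\<^sub>C f n)) \<longlonglongrightarrow> L (c *\<^sub>C x)"
      by (intro lim bounded_linear.tendsto[OF bounded_linear_scaleC]
        f complex_vector.span_scale cspace_scaleC x)
    moreover have "(\<lambda>n. L0 (c *\<^sub>C f n)) \<longlonglongrightarrow> c *\<^sub>C L x"
      using L0[OF Rscale[OF RL0[OF f(1)]]] lim[OF f x]
      by (simp add: bounded_linear.tendsto[OF bounded_linear_scaleC])
    ultimately show "L (c *\<^sub>C x) = c *\<^sub>C L x"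
      by (rule LIMSEQ_unique)
  next
    fix x
    assume x: "x \<in> cspace (v ` I)"
    obtain f where f: "\<And>n. f n \<in> ?V" "f \<longlonglongrightarrow> x"
      using seq[OF x] by blast
    show "norm (L x) \<le> \<bar>K\<bar> * norm x"
    proof (rule tendsto_le[OF _ _ _])
      show "(\<lambda>n. norm (L0 (f n))) \<longlonglongrightarrow> norm (L x)" "(\<lambda>n. \<bar>K\<bar> * norm (f n)) \<longlonglongrightarrow> \<bar>K\<bar> * norm x"
        by (intro tendsto_intros lim f x)+
    qed (auto intro!: always_eventually Rle RL0 f)
  qed
  moreover have "L (v i) = m i" if "i \<in> I" for i
  proof -
    have "R (v i) (m i)"
      unfolding R_def using that by (intro exI[of _ "{i}"] exI[of _ "\<lambda>_. 1"]) simp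
    moreover have "v i \<in> ?V"
      using that by (simp add: complex_vector.span_base)
    ultimately show ?thesis
      using L L0 by metis
  qed
  ultimately show ?thesis
    by (rule that)
qed

section \<open>Group algebras acting by permutations\<close>

text \<open>The action is constrained on X only, as X is a subset of a type. The operators below
  vanish on basis vectors outside X and are therefore partial isometries rather than
  unitaries.\<close>

definition group_acts :: "('g, 'b) monoid_scheme \<Rightarrow> 'x set \<Rightarrow> ('g \<Rightarrow> 'x \<Rightarrow> 'x) \<Rightarrow> bool"
  where "group_acts G X \<alpha> \<longleftrightarrow> group G \<and> (\<forall>g\<in>carrier G. \<forall>x\<in>X. \<alpha> g x \<in> X) \<and> (\<forall>x\<in>X. \<alpha> \<one>\<^bsub>G\<^esub> x = x) \<and>
    (\<forall>g\<in>carrier G. \<forall>h\<in>carrier G. \<forall>x\<in>X. \<alpha> (g \<otimes>\<^bsub>G\<^esub> h) x = \<alpha> g (\<alpha> h x))"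

text \<open>A pullback moves basis vectors against the map composed with; thanks to the inverse,
  \<open>ket x\<close> goes to \<open>ket (\<alpha> g x)\<close>.\<close>

definition perm_op :: "('g, 'b) monoid_scheme \<Rightarrow> 'x set \<Rightarrow> ('g \<Rightarrow> 'x \<Rightarrow> 'x) \<Rightarrow> 'g \<Rightarrow> 'x op"
  where "perm_op G X \<alpha> g = pullback X (\<alpha> (inv\<^bsub>G\<^esub> g))"

lemma left_translation_eq_perm_op: "left_translation G g = perm_op G (carrier G) (\<otimes>\<^bsub>G\<^esub>) g"
  by (simp add: left_translation_def perm_op_def)

lemma group_acts_mult: "group G \<Longrightarrow> group_acts G (carrier G) (\<otimes>\<^bsub>G\<^esub>)"
  by (simp add: group_acts_def group.is_monoid monoid.m_assoc monoid.m_closed)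

lemma group_acts_hom:
  assumes "group G" "group K" "\<theta> \<in> hom G K"
  shows "group_acts G (carrier K) (\<lambda>g x. \<theta> g \<otimes>\<^bsub>K\<^esub> x)"
  using assms hom_in_carrier[OF assms(3)] hom_mult[OF assms(3)]
  by (auto simp: group_acts_def group.is_monoid monoid.m_assoc monoid.m_closed hom_one)

lemma left_translation_hom:
  assumes "group G" "group K" "\<theta> \<in> hom G K" "g \<in> carrier G"
  shows "left_translation K (\<theta> g) = perm_op G (carrier K) (\<lambda>g x. \<theta> g \<otimes>\<^bsub>K\<^esub> x) g"
  using assms group_hom.hom_inv[of G K \<theta> g]
  by (simp add: left_translation_def perm_op_def group_hom_def group_hom_axioms_def)

context
  fixes G :: "('g, 'b) monoid_scheme" and X :: "'x set" and \<alpha> :: "'g \<Rightarrow> 'x \<Rightarrow> 'x"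
  assumes acts: "group_acts G X \<alpha>"
begin

lemma group_acts_inv:
  assumes "g \<in> carrier G" "x \<in> X"
  shows "\<alpha> (inv\<^bsub>G\<^esub> g) (\<alpha> g x) = x" "\<alpha> g (\<alpha> (inv\<^bsub>G\<^esub> g) x) = x" "\<alpha> g x \<in> X" "\<alpha> (inv\<^bsub>G\<^esub> g) x \<in> X"
proof -
  interpret group G
    using acts by (simp add: group_acts_def)
  have "\<alpha> (inv\<^bsub>G\<^esub> g \<otimes>\<^bsub>G\<^esub> g) x = \<alpha> (inv\<^bsub>G\<^esub> g) (\<alpha> g x)" "\<alpha> (g \<otimes>\<^bsub>G\<^esub> inv\<^bsub>G\<^esub> g) x = \<alpha> g (\<alpha> (inv\<^bsub>G\<^esub> g) x)"
    "\<alpha> \<one>\<^bsub>G\<^esub> x = x"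
    using acts assms unfolding group_acts_def by blast+
  then show "\<alpha> (inv\<^bsub>G\<^esub> g) (\<alpha> g x) = x" "\<alpha> g (\<alpha> (inv\<^bsub>G\<^esub> g) x) = x"
    using assms by simp_all
  show "\<alpha> g x \<in> X" "\<alpha> (inv\<^bsub>G\<^esub> g) x \<in> X"
    using acts assms unfolding group_acts_def by simp_all
qed

lemma group_acts_inj_on: "g \<in> carrier G \<Longrightarrow> inj_on (\<alpha> g) X"
  by (metis group_acts_inv(1) inj_on_inverseI)

lemma group_acts_inj_on_inv: "g \<in> carrier G \<Longrightarrow> inj_on (\<alpha> (inv\<^bsub>G\<^esub> g)) X"
  by (metis group_acts_inv(2) inj_on_inverseI)

lemma clinear_op_perm_op: "g \<in> carrier G \<Longrightarrow> clinear_op (perm_op G X \<alpha> g)"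
  unfolding perm_op_def by (rule clinear_op_pullback[OF group_acts_inj_on_inv])

lemma perm_op_ket:
  assumes "g \<in> carrier G"
  shows "perm_op G X \<alpha> g (ket x) = (if x \<in> X then ket (\<alpha> g x) else 0)"
proof (cases "x \<in> X")
  case True
  then show ?thesis
    unfolding perm_op_def using group_acts_inv[OF assms True]
    by (simp add: pullback_ket[OF group_acts_inj_on_inv[OF assms], of "\<alpha> g x"])
next
  case False
  then have "x \<notin> \<alpha> (inv\<^bsub>G\<^esub> g) ` X"
    using group_acts_inv(4)[OF assms] by auto
  then show ?thesis
    unfolding perm_op_def using False by (simp add: pullback_ket_zero[OF group_acts_inj_on_inv[OF assms]])
qed

lemma perm_op_mult:
  assumes "g \<in> carrier G" "h \<in> carrier G"
  shows "perm_op G X \<alpha> g o\<^sub>L perm_op G X \<alpha> h = perm_op G X \<alpha> (g \<otimes>\<^bsub>G\<^esub> h)"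
proof -
  interpret group G
    using acts by (simp add: group_acts_def)
  show ?thesis
    by (rule clinear_op_eqI)
      (use acts assms in \<open>auto simp: perm_op_ket clinear_op_perm_op clinear_op_compose group_acts_def\<close>)
qed

lemma perm_op_adj:
  assumes "g \<in> carrier G"
  shows "adj (perm_op G X \<alpha> g) = perm_op G X \<alpha> (inv\<^bsub>G\<^esub> g)"
proof -
  interpret group G
    using acts by (simp add: group_acts_def)
  show ?thesis
  proof (rule adj_eq_on_kets)
    fix x y
    have "y = \<alpha> (inv\<^bsub>G\<^esub> g) x \<longleftrightarrow> x = \<alpha> g y" if "x \<in> X" "y \<in> X"
      using that group_acts_inv[OF assms] by metis
    then show "Rep_ell2 (perm_op G X \<alpha> (inv\<^bsub>G\<^esub> g) (ket x)) y = cnj (Rep_ell2 (perm_op G X \<alpha> g (ket y)) x)"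
      using assms group_acts_inv[OF assms]
      by (auto simp: perm_op_ket Rep_ell2_ket zero_ell2.rep_eq)
  qed (use assms in \<open>simp_all add: clinear_op_perm_op\<close>)
qed

end

lemma group_acts_prod:
  assumes "group_acts G X \<alpha>" "group_acts K Y \<beta>"
  shows "group_acts (G \<times>\<times> K) (X \<times> Y) (\<lambda>(g, k) (x, y). (\<alpha> g x, \<beta> k y))"
  using assms by (auto simp: group_acts_def DirProd_group)

lemma perm_op_prod:
  assumes "group_acts G X \<alpha>" "group_acts K Y \<beta>" "g \<in> carrier G" "k \<in> carrier K"
  shows "perm_op G X \<alpha> g \<otimes>\<^sub>o perm_op K Y \<beta> k
    = perm_op (G \<times>\<times> K) (X \<times> Y) (\<lambda>(g, k) (x, y). (\<alpha> g x, \<beta> k y)) (g, k)"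
  by (rule tensor_op_eqI)
    (use assms group_acts_prod[OF assms(1,2)] in \<open>auto simp: clinear_op_perm_op perm_op_ket ket_tensor
      tensor_ell2_zero_left tensor_ell2_zero_right\<close>)

lemma left_translation_prod:
  assumes "group G" "group K" "g \<in> carrier G" "k \<in> carrier K"
  shows "left_translation G g \<otimes>\<^sub>o left_translation K k = left_translation (G \<times>\<times> K) (g, k)"
proof -
  have "(\<otimes>\<^bsub>G \<times>\<times> K\<^esub>) = (\<lambda>(g, k) (x, y). (g \<otimes>\<^bsub>G\<^esub> x, k \<otimes>\<^bsub>K\<^esub> y))"
    by (auto simp: DirProd_def)
  then show ?thesis
    unfolding left_translation_eq_perm_op
    by (simp add: perm_op_prod group_acts_mult assms DirProd_def)
qed

lemmas left_translation_mult = perm_op_mult[OF group_acts_mult, folded left_translation_eq_perm_op]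
  and left_translation_adj = perm_op_adj[OF group_acts_mult, folded left_translation_eq_perm_op]
  and left_translation_ket = perm_op_ket[OF group_acts_mult, folded left_translation_eq_perm_op]
  and clinear_op_left_translation = clinear_op_perm_op[OF group_acts_mult, folded left_translation_eq_perm_op]


section \<open>The group algebra as a closed span\<close>

lemma subspace_complex_ops: "complex_vector.subspace complex_ops"
  by (simp add: complex_vector.subspace_def complex_ops_iff clinear_op_zero clinear_op_add clinear_op_scaleC)

lemma bounded_clinear_on_compose_left: "bounded_clinear_on V (\<lambda>a. a o\<^sub>L (b :: 'x ell2 \<Rightarrow>\<^sub>L 'y ell2))"
  by (rule bounded_clinear_onI[where K = "norm b"])
    (auto intro: blinfun_eqI norm_blinfun_compose simp: blinfun.add_left mult.commute[of "norm b"])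

lemma bounded_clinear_on_compose_right:
  "clinear_op (a :: 'x ell2 \<Rightarrow>\<^sub>L 'y ell2) \<Longrightarrow> bounded_clinear_on V (\<lambda>b. a o\<^sub>L b)"
  by (rule bounded_clinear_onI[where K = "norm a"])
    (auto intro: blinfun_eqI norm_blinfun_compose simp: blinfun.add_left blinfun.add_right clinear_opD)

lemma bounded_clinear_on_tensor_left:
  "V \<subseteq> complex_ops \<Longrightarrow> clinear_op T \<Longrightarrow> bounded_clinear_on V (\<lambda>S. S \<otimes>\<^sub>o T)"
  by (rule bounded_clinear_onI[where K = "norm T"])
    (auto simp: tensor_op_add_left tensor_op_scaleC_left norm_tensor_op_le complex_ops_iff subset_iff
      mult.commute[of "norm T"])

lemma bounded_clinear_on_tensor_right:
  "V \<subseteq> complex_ops \<Longrightarrow> clinear_op S \<Longrightarrow> bounded_clinear_on V (\<lambda>T. S \<otimes>\<^sub>o T)"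
  by (rule bounded_clinear_onI[where K = "norm S"])
    (auto simp: tensor_op_add_right tensor_op_scaleC_right norm_tensor_op_le complex_ops_iff subset_iff)

lemma bounded_clinear_on_cinner:
  fixes V :: "('x ell2 \<Rightarrow>\<^sub>L 'y ell2) set"
  shows "bounded_clinear_on V (\<lambda>T. cinner f (blinfun_apply T g))"
proof (rule bounded_clinear_onI[where K = "norm f * norm g"])
  show "norm (cinner f (T g)) \<le> norm f * norm g * norm T" for T :: "'x ell2 \<Rightarrow>\<^sub>L 'y ell2"
    using order_trans[OF cmod_cinner_le mult_left_mono[OF norm_blinfun]] by (simp add: ac_simps)
qed (simp_all add: blinfun.add_left cinner_add_right cinner_scaleC_right scaleC_complex_def)

lemma tendsto_adj:
  fixes f :: "nat \<Rightarrow> 'x op"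
  assumes "\<And>n. clinear_op (f n)" "clinear_op a" "f \<longlonglongrightarrow> a"
  shows "(\<lambda>n. adj (f n)) \<longlonglongrightarrow> adj a"
proof (rule Lim_null_comparison[THEN Lim_null[THEN iffD2]])
  have "norm (adj (f n) - adj a) \<le> norm (f n - a)" for n
  proof -
    have "clinear_op (f n + (-1) *\<^sub>C a)"
      by (intro clinear_op_add clinear_op_scaleC assms)
    then have "norm (adj (f n - a)) \<le> norm (f n - a)"
      by (intro norm_adj_le) simp
    moreover have "adj (f n - a) = adj (f n) - adj a"
      using adj_add[OF assms(1)[of n] clinear_op_scaleC[OF assms(2), of "-1"]] adj_scaleC[OF assms(2), of "-1"]
      by simp
    ultimately show ?thesis
      by simp
  qed
  then show "\<forall>\<^sub>F n in sequentially. norm (adj (f n) - adj a) \<le> norm (f n - a)"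
    by simp
  show "(\<lambda>n. norm (f n - a)) \<longlonglongrightarrow> 0"
    using assms(3) by (simp add: LIM_zero tendsto_norm_zero)
qed

lemma cstar_algebra_subspace: "cstar_algebra A \<Longrightarrow> complex_vector.subspace A"
  by (simp add: cstar_algebra_def complex_vector.subspace_def)

text \<open>Translations are closed under products and adjoints, so their closed linear span already
  is the generated algebra. Later arguments can thus proceed by linearity and continuity from single
  translations.\<close>

theorem group_cstar_eq:
  assumes "group G"
  shows "group_cstar G = cspace (left_translation G ` carrier G)" (is "_ = ?A")
    and "cstar_algebra (group_cstar G)"
proof -
  interpret group G by fact
  note gens = left_translation_mult[OF assms] left_translation_adj[OF assms]
    clinear_op_left_translation[OF assms]
  have sub: "?A \<subseteq> complex_ops"
    by (rule cspace_minimal) (auto simp: subspace_complex_ops closed_complex_ops complex_ops_iff gens)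
  \<comment> \<open>Products are handled one factor at a time: a translation on the right, then an
    arbitrary element.\<close>
  have comp1: "a o\<^sub>L left_translation G h \<in> ?A" if "a \<in> ?A" "h \<in> carrier G" for a h
    by (rule bounded_clinear_on_preimage[OF bounded_clinear_on_compose_left subspace_cspace closed_cspace
      _ that(1)])
      (use that in \<open>auto simp: gens intro!: cspace_base\<close>)
  have comp: "a o\<^sub>L b \<in> ?A" if "a \<in> ?A" "b \<in> ?A" for a b
    by (rule bounded_clinear_on_preimage[OF bounded_clinear_on_compose_right subspace_cspace closed_cspace
      _ that(2)])
      (use that sub comp1 in \<open>auto simp: complex_ops_iff\<close>)
  \<comment> \<open>Taking adjoints is conjugate linear, so
    \<open>bounded_clinear_on_preimage\<close> does not apply; the set is shown directly to be a
    closed subspace.\<close>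
  let ?P = "{a \<in> ?A. adj a \<in> ?A}"
  have "?A \<subseteq> ?P"
  proof (rule cspace_minimal)
    show "complex_vector.subspace ?P"
      unfolding complex_vector.subspace_def
    proof (intro conjI ballI allI)
      have "adj (0 *\<^sub>C 0 :: 'a op) = 0 *\<^sub>C adj 0"
        by (subst adj_scaleC) (simp_all add: clinear_op_zero)
      then show "0 \<in> ?P"
        by (simp add: cspace_zero)
    qed (use sub in \<open>auto intro: cspace_add cspace_scaleC simp: adj_add adj_scaleC complex_ops_iff subset_iff\<close>)
    show "closed ?P"
      unfolding closed_sequential_limits
    proof safe
      fix f a
      assume f: "\<forall>n. f n \<in> ?P" and lim: "f \<longlonglongrightarrow> a"
      show a: "a \<in> ?A"
        by (rule closed_sequentially[OF closed_cspace _ lim]) (use f in auto)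
      have lim': "(\<lambda>n. adj (f n)) \<longlonglongrightarrow> adj a"
        using f sub a lim by (intro tendsto_adj) (auto simp: complex_ops_iff subset_iff)
      show "adj a \<in> ?A"
        by (rule closed_sequentially[OF closed_cspace _ lim']) (use f in auto)
    qed
  qed (auto simp: gens intro!: cspace_base)
  then have star: "adj a \<in> ?A" if "a \<in> ?A" for a
    using that by blast
  have alg: "cstar_algebra ?A"
    unfolding cstar_algebra_def
    using sub closed_cspace comp star by (auto intro: cspace_zero cspace_add cspace_scaleC)
  show "group_cstar G = ?A"
    unfolding group_cstar_def
  proof (rule hull_unique)
    show "left_translation G ` carrier G \<subseteq> ?A"
      by (auto intro: cspace_base)
    fix B
    assume "left_translation G ` carrier G \<subseteq> B" "cstar_algebra B"
    then show "?A \<subseteq> B"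
      by (intro cspace_minimal cstar_algebra_subspace) (auto simp: cstar_algebra_def)
  qed (rule alg)
  then show "cstar_algebra (group_cstar G)"
    using alg by simp
qed

lemma unit_of_eqI: "is_unit A e \<Longrightarrow> unit_of A = e"
  unfolding unit_of_def is_unit_def by (rule the_equality) metis+

context
  fixes G :: "('g, 'b) monoid_scheme"
  assumes grp: "group G"
begin

interpretation group G by (rule grp)

lemma left_translation_in_group_cstar: "g \<in> carrier G \<Longrightarrow> left_translation G g \<in> group_cstar G"
  unfolding group_cstar_eq[OF grp] by (auto intro: cspace_base)

lemma group_cstar_clinear: "a \<in> group_cstar G \<Longrightarrow> clinear_op a"
  using group_cstar_eq(2)[OF grp] by (auto simp: cstar_algebra_def complex_ops_iff subset_iff)

lemma group_cstar_compose: "a \<in> group_cstar G \<Longrightarrow> b \<in> group_cstar G \<Longrightarrow> a o\<^sub>L b \<in> group_cstar G"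
  and group_cstar_adj: "a \<in> group_cstar G \<Longrightarrow> adj a \<in> group_cstar G"
  using group_cstar_eq(2)[OF grp] by (auto simp: cstar_algebra_def)

lemma subspace_group_cstar: "complex_vector.subspace (group_cstar G)"
  and closed_group_cstar: "closed (group_cstar G)"
  unfolding group_cstar_eq[OF grp] by (rule subspace_cspace closed_cspace)+

lemma group_cstar_eqI:
  assumes "bounded_clinear_on (group_cstar G) L" "bounded_clinear_on (group_cstar G) L'"
    "\<And>g. g \<in> carrier G \<Longrightarrow> L (left_translation G g) = L' (left_translation G g)" "a \<in> group_cstar G"
  shows "L a = L' a"
  using assms unfolding group_cstar_eq[OF grp] by (auto intro: bounded_clinear_on_eqI)

lemma group_cstar_preimage:
  assumes "bounded_clinear_on (group_cstar G) L" "complex_vector.subspace M" "closed M"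
    "\<And>g. g \<in> carrier G \<Longrightarrow> L (left_translation G g) \<in> M" "a \<in> group_cstar G"
  shows "L a \<in> M"
  using assms unfolding group_cstar_eq[OF grp] by (auto intro: bounded_clinear_on_preimage)

lemma is_unit_group_cstar: "is_unit (group_cstar G) (left_translation G \<one>\<^bsub>G\<^esub>)"
proof -
  note gens = left_translation_mult[OF grp]
  have "left_translation G \<one>\<^bsub>G\<^esub> o\<^sub>L a = a" if "a \<in> group_cstar G" for a
    by (rule group_cstar_eqI[where L = "\<lambda>a. left_translation G \<one>\<^bsub>G\<^esub> o\<^sub>L a" and L' = "\<lambda>a. a", OF _ _ _ that])
      (auto simp: gens clinear_op_left_translation[OF grp] intro: bounded_clinear_on_compose_right
        bounded_clinear_onI[where K = 1])
  moreover have "a o\<^sub>L left_translation G \<one>\<^bsub>G\<^esub> = a" if "a \<in> group_cstar G" for a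
    by (rule group_cstar_eqI[where L = "\<lambda>a. a o\<^sub>L left_translation G \<one>\<^bsub>G\<^esub>" and L' = "\<lambda>a. a", OF _ _ _ that])
      (auto simp: gens intro: bounded_clinear_on_compose_left bounded_clinear_onI[where K = 1])
  ultimately show ?thesis
    by (simp add: is_unit_def left_translation_in_group_cstar)
qed

lemma unit_of_group_cstar: "unit_of (group_cstar G) = left_translation G \<one>\<^bsub>G\<^esub>"
  by (rule unit_of_eqI[OF is_unit_group_cstar])

lemma unital_cstar_algebra_group_cstar: "unital_cstar_algebra (group_cstar G)"
  unfolding unital_cstar_algebra_def using group_cstar_eq(2)[OF grp] is_unit_group_cstar by blast

text \<open>Both sides of each identity can be made bounded and linear in one variable at a time, so
  it spreads from translations to the algebra.\<close>

lemma group_cstar_star_hom: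
  fixes J :: "'g op \<Rightarrow> 'y op"
  assumes J: "bounded_clinear_on (group_cstar G) J"
    and U: "\<And>g. g \<in> carrier G \<Longrightarrow> clinear_op (J (left_translation G g))"
    and mult: "\<And>g h. g \<in> carrier G \<Longrightarrow> h \<in> carrier G \<Longrightarrow>
      J (left_translation G (g \<otimes>\<^bsub>G\<^esub> h)) = J (left_translation G g) o\<^sub>L J (left_translation G h)"
    and star: "\<And>g. g \<in> carrier G \<Longrightarrow> J (left_translation G (inv\<^bsub>G\<^esub> g)) = adj (J (left_translation G g))"
    and a: "a \<in> group_cstar G"
  shows "clinear_op (J a)" "b \<in> group_cstar G \<Longrightarrow> J (a o\<^sub>L b) = J a o\<^sub>L J b" "J (adj a) = adj (J a)"
proof -
  let ?A = "group_cstar G"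
  have clin: "clinear_op (J a)" if "a \<in> ?A" for a
    using group_cstar_preimage[OF J subspace_complex_ops closed_complex_ops _ that] U
    by (simp add: complex_ops_iff)
  then show "clinear_op (J a)"
    using a .
  have right: "bounded_clinear_on ?A (\<lambda>b. J (a o\<^sub>L b))" "bounded_clinear_on ?A (\<lambda>b. J a o\<^sub>L J b)"
    if "a \<in> ?A" for a
    using that group_cstar_clinear group_cstar_compose
    by (auto intro!: bounded_clinear_on_compose[OF bounded_clinear_on_compose_right J]
        bounded_clinear_on_compose[OF J bounded_clinear_on_compose_right] clin subset_UNIV)
  have left: "bounded_clinear_on ?A (\<lambda>a. J (a o\<^sub>L b))" "bounded_clinear_on ?A (\<lambda>a. J a o\<^sub>L J b)"
    if "b \<in> ?A" for b
    using that group_cstar_compose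
    by (auto intro!: bounded_clinear_on_compose[OF bounded_clinear_on_compose_left J]
        bounded_clinear_on_compose[OF J bounded_clinear_on_compose_left] subset_UNIV)
  have 1: "J (a o\<^sub>L left_translation G h) = J a o\<^sub>L J (left_translation G h)" if "a \<in> ?A" "h \<in> carrier G" for a h
    by (rule group_cstar_eqI[OF left[OF left_translation_in_group_cstar[OF that(2)]] _ that(1)])
      (use that mult in \<open>auto simp: left_translation_mult[OF grp]\<close>)
  show "J (a o\<^sub>L b) = J a o\<^sub>L J b" if "b \<in> ?A"
    by (rule group_cstar_eqI[OF right[OF a] _ that]) (use a 1 in auto)
  obtain K where K: "\<And>x. x \<in> ?A \<Longrightarrow> norm (J x) \<le> K * norm x"
    using J unfolding bounded_clinear_on_def by blast
  \<comment> \<open>The two conjugations cancel, so this map is linear and can be compared with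
    \<open>J\<close> on translations.\<close>
  have "bounded_clinear_on ?A (\<lambda>a. adj (J (adj a)))"
  proof (rule bounded_clinear_onI[where K = "\<bar>K\<bar>"])
    fix x assume x: "x \<in> ?A"
    have "norm (adj (J (adj x))) \<le> norm (J (adj x))"
      using clin[OF group_cstar_adj[OF x]] by (rule norm_adj_le)
    also have "\<dots> \<le> \<bar>K\<bar> * norm (adj x)"
      using K[OF group_cstar_adj[OF x]] by (smt (verit) mult_right_mono norm_ge_zero)
    also have "\<dots> \<le> \<bar>K\<bar> * norm x"
      using norm_adj_le[OF group_cstar_clinear[OF x]] by (simp add: mult_left_mono)
    finally show "norm (adj (J (adj x))) \<le> \<bar>K\<bar> * norm x" .
    show "adj (J (adj (c *\<^sub>C x))) = c *\<^sub>C adj (J (adj x))" for c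
      using bounded_clinear_on_linear[OF J group_cstar_adj[OF x] group_cstar_adj[OF x] subspace_group_cstar] x
      by (simp add: adj_scaleC group_cstar_clinear clin group_cstar_adj)
  next
    fix x y assume xy: "x \<in> ?A" "y \<in> ?A"
    then show "adj (J (adj (x + y))) = adj (J (adj x)) + adj (J (adj y))"
      using bounded_clinear_on_linear[OF J group_cstar_adj[OF xy(1)] group_cstar_adj[OF xy(2)]
        subspace_group_cstar]
      by (simp add: adj_add group_cstar_clinear clin group_cstar_adj)
  qed
  then have "adj (J (adj a)) = J a"
    by (rule group_cstar_eqI[OF _ J _ a])
      (simp add: left_translation_adj[OF grp] star adj_adj U)
  then show "J (adj a) = adj (J a)"
    using adj_adj[OF clin[OF group_cstar_adj[OF a]]] by simp
qed

end

text \<open>The tensor product of two translations is translation by the pair. Statements about the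
  spatial tensor product thereby become statements about the group algebra of the product group,
  where generator arguments and the extension of permutation representations apply.\<close>

theorem group_cstar_tensor:
  assumes "group G" "group K"
  shows "group_cstar G \<otimes>\<^sub>A group_cstar K = group_cstar (G \<times>\<times> K)"
proof
  note GK = DirProd_group[OF assms]
  let ?S = "{a \<otimes>\<^sub>o b |a b. a \<in> group_cstar G \<and> b \<in> group_cstar K}"
  have 1: "a \<otimes>\<^sub>o left_translation K k \<in> group_cstar (G \<times>\<times> K)" if "a \<in> group_cstar G" "k \<in> carrier K" for a k
    by (rule group_cstar_preimage[OF assms(1) bounded_clinear_on_tensor_left subspace_group_cstar[OF GK]
          closed_group_cstar[OF GK] _ that(1)])
      (use that in \<open>auto simp: complex_ops_iff group_cstar_clinear[OF assms(1)]
        clinear_op_left_translation[OF assms(2)]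
        left_translation_prod[OF assms] intro!: left_translation_in_group_cstar[OF GK]\<close>)
  have 2: "a \<otimes>\<^sub>o b \<in> group_cstar (G \<times>\<times> K)" if "a \<in> group_cstar G" "b \<in> group_cstar K" for a b
    by (rule group_cstar_preimage[OF assms(2) bounded_clinear_on_tensor_right subspace_group_cstar[OF GK]
          closed_group_cstar[OF GK] _ that(2)])
      (use that 1 in \<open>auto simp: complex_ops_iff group_cstar_clinear[OF assms(1)]
        group_cstar_clinear[OF assms(2)]\<close>)
  have tens: "group_cstar G \<otimes>\<^sub>A group_cstar K = cspace ?S"
    by (simp add: spatial_tensor_def cspace_def)
  show "group_cstar G \<otimes>\<^sub>A group_cstar K \<subseteq> group_cstar (G \<times>\<times> K)"
    unfolding tens by (rule cspace_minimal) (use 2 in \<open>auto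
      simp: subspace_group_cstar[OF GK] closed_group_cstar[OF GK]\<close>)
  show "group_cstar (G \<times>\<times> K) \<subseteq> group_cstar G \<otimes>\<^sub>A group_cstar K"
    unfolding tens group_cstar_eq(1)[OF GK]
  proof (rule cspace_minimal)
    show "left_translation (G \<times>\<times> K) ` carrier (G \<times>\<times> K) \<subseteq> cspace ?S"
    proof safe
      fix g k
      assume "(g, k) \<in> carrier (G \<times>\<times> K)"
      then have "g \<in> carrier G" "k \<in> carrier K"
        by auto
      then have "left_translation G g \<otimes>\<^sub>o left_translation K k \<in> ?S"
        using left_translation_in_group_cstar[OF assms(1)] left_translation_in_group_cstar[OF assms(2)] by blast
      then show "left_translation (G \<times>\<times> K) (g, k) \<in> cspace ?S"
        unfolding left_translation_prod[OF assms \<open>g \<in> carrier G\<close> \<open>k \<in> carrier K\<close>] by (rule cspace_base)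
    qed
  qed (rule subspace_cspace closed_cspace)+
qed

text \<open>Elementary tensors are bounded and linear in each factor separately; one factor is
  passed from translations to the whole algebra, then the other.\<close>

lemma tensor_values_from_generators:
  fixes j :: "'g op \<Rightarrow> 'u op" and k :: "'h op \<Rightarrow> 'v op"
  assumes grp: "group G" "group K"
    and J: "bounded_clinear_on (group_cstar (G \<times>\<times> K)) J"
    and j: "bounded_clinear_on (group_cstar G) j" "j ` group_cstar G \<subseteq> complex_ops"
    and k: "bounded_clinear_on (group_cstar K) k" "k ` group_cstar K \<subseteq> complex_ops"
    and gen: "\<And>g h. g \<in> carrier G \<Longrightarrow> h \<in> carrier K \<Longrightarrow>
      J (left_translation (G \<times>\<times> K) (g, h)) = j (left_translation G g) \<otimes>\<^sub>o k (left_translation K h)"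
    and ab: "a \<in> group_cstar G" "b \<in> group_cstar K"
  shows "J (a \<otimes>\<^sub>o b) = j a \<otimes>\<^sub>o k b"
proof -
  have mem: "a \<otimes>\<^sub>o b \<in> group_cstar (G \<times>\<times> K)" if "a \<in> group_cstar G" "b \<in> group_cstar K" for a b
    unfolding group_cstar_tensor[OF grp, symmetric] spatial_tensor_def cspace_def[symmetric]
    using that by (intro cspace_base) blast
  have sub: "group_cstar G \<subseteq> complex_ops" "group_cstar K \<subseteq> complex_ops"
    using group_cstar_clinear grp by (auto simp: complex_ops_iff)
  have clin: "clinear_op (j a)" "clinear_op a" if "a \<in> group_cstar G" for a
    using j sub that by (auto simp: complex_ops_iff[symmetric])
  have clin': "clinear_op (k b)" "clinear_op b" if "b \<in> group_cstar K" for b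
    using k sub that by (auto simp: complex_ops_iff[symmetric])
  have 1: "J (a \<otimes>\<^sub>o left_translation K h) = j a \<otimes>\<^sub>o k (left_translation K h)"
    if "a \<in> group_cstar G" and h: "h \<in> carrier K" for a h
  proof (rule group_cstar_eqI[OF grp(1) _ _ _ that(1)])
    have h': "left_translation K h \<in> group_cstar K"
      using left_translation_in_group_cstar[OF grp(2) h] .
    show "bounded_clinear_on (group_cstar G) (\<lambda>a. J (a \<otimes>\<^sub>o left_translation K h))"
      by (rule bounded_clinear_on_compose[OF bounded_clinear_on_tensor_left J])
        (use sub mem h' clin' in auto)
    show "bounded_clinear_on (group_cstar G) (\<lambda>a. j a \<otimes>\<^sub>o k (left_translation K h))"
      by (rule bounded_clinear_on_compose[OF j(1) bounded_clinear_on_tensor_left[where V = complex_ops]])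
        (use j h' clin' in auto)
  qed (use h in \<open>simp add: left_translation_prod[OF grp] gen\<close>)
  show ?thesis
  proof (rule group_cstar_eqI[OF grp(2) _ _ _ ab(2)])
    show "bounded_clinear_on (group_cstar K) (\<lambda>b. J (a \<otimes>\<^sub>o b))"
      by (rule bounded_clinear_on_compose[OF bounded_clinear_on_tensor_right J])
        (use sub mem ab clin in auto)
    show "bounded_clinear_on (group_cstar K) (\<lambda>b. j a \<otimes>\<^sub>o k b)"
      by (rule bounded_clinear_on_compose[OF k(1) bounded_clinear_on_tensor_right[where V = complex_ops]])
        (use k ab clin in auto)
  qed (simp add: 1 ab)
qed

section \<open>The Hahn--Banach theorem\<close>

text \<open>Homogeneity is demanded only as an inequality for positive r, which is what the infimum
  constructions yield most easily; replacing r by 1 / r upgrades it to equality.\<close>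

definition sublinear :: "('a::real_vector \<Rightarrow> real) \<Rightarrow> bool"
  where "sublinear q \<longleftrightarrow> (\<forall>x y. q (x + y) \<le> q x + q y) \<and> (\<forall>r>0. \<forall>x. q (r *\<^sub>R x) \<le> r * q x) \<and> q 0 = 0"

lemma sublinear_scale:
  assumes "sublinear q" "0 \<le> r"
  shows "q (r *\<^sub>R x) = r * q x"
proof (cases "r = 0")
  case False
  then have "0 < r"
    using assms by simp
  have "q ((1 / r) *\<^sub>R r *\<^sub>R x) \<le> (1 / r) * q (r *\<^sub>R x)"
    using assms(1) \<open>0 < r\<close> unfolding sublinear_def by (meson zero_less_divide_1_iff)
  then have "r * q x \<le> q (r *\<^sub>R x)"
    using \<open>0 < r\<close> by (simp add: field_simps)
  then show ?thesis
    using assms(1) \<open>0 < r\<close> unfolding sublinear_def by (simp add: order_antisym)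
qed (use assms in \<open>simp add: sublinear_def\<close>)

lemma sublinear_lower:
  assumes "sublinear q"
  shows "q v - q (- x) \<le> q (x + v)" "- q (- x) \<le> q x"
proof -
  have "q (- x + (x + v)) \<le> q (- x) + q (x + v)" "q (- x + x) \<le> q (- x) + q x"
    using assms unfolding sublinear_def by blast+
  then show "q v - q (- x) \<le> q (x + v)" "- q (- x) \<le> q x"
    using assms by (simp_all add: sublinear_def)
qed

text \<open>Lowering a sublinear functional \<open>q\<close> along a convex cone \<open>K\<close> forces every linear functional
  below the result to be at least \<open>s\<close> at \<open>v\<close> for \<open>(v, s) \<in> K\<close>.\<close>

lemma sublinear_cone:
  fixes q :: "'a::real_vector \<Rightarrow> real" and K :: "('a \<times> real) set"
  assumes q: "sublinear q" and zero: "(0, 0) \<in> K"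
    and add: "\<And>v s v' s'. (v, s) \<in> K \<Longrightarrow> (v', s') \<in> K \<Longrightarrow> (v + v', s + s') \<in> K"
    and scale: "\<And>r v s. 0 < r \<Longrightarrow> (v, s) \<in> K \<Longrightarrow> (r *\<^sub>R v, r * s) \<in> K"
    and le: "\<And>v s. (v, s) \<in> K \<Longrightarrow> s \<le> q v"
  obtains u where "sublinear u" "\<And>x. u x \<le> q x" "\<And>v s. (v, s) \<in> K \<Longrightarrow> u (- v) \<le> - s"
    "\<And>x v s. (v, s) \<in> K \<Longrightarrow> u x \<le> q (x + v) - s"
proof -
  define u where "u x = (INF k\<in>K. q (x + fst k) - snd k)" for x
  have low: "- q (- x) \<le> q (x + v) - s" if "(v, s) \<in> K" for x v s
    using sublinear_lower(1)[OF q, of v x] le[OF that] by simp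
  have bdd: "bdd_below ((\<lambda>k. q (x + fst k) - snd k) ` K)" for x
    by (rule bdd_belowI2[where m = "- q (- x)"]) (use low in force)
  have upper: "u x \<le> q (x + v) - s" if "(v, s) \<in> K" for x v s
    unfolding u_def using cINF_lower[OF bdd that] by simp
  have greatest: "b \<le> u x" if "\<And>v s. (v, s) \<in> K \<Longrightarrow> b \<le> q (x + v) - s" for b x
    unfolding u_def by (rule cINF_greatest) (use that zero in auto)
  have qle: "u x \<le> q x" for x
    using upper[OF zero, of x] by simp
  have "u (x + y) \<le> u x + u y" for x y
  proof -
    have "u (x + y) \<le> (q (x + v) - s) + (q (y + v') - s')" if "(v, s) \<in> K" "(v', s') \<in> K" for v s v' s'
    proof -
      have "q ((x + v) + (y + v')) \<le> q (x + v) + q (y + v')"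
        using q unfolding sublinear_def by blast
      then show ?thesis
        using upper[OF add[OF that], of "x + y"] by (simp add: ac_simps)
    qed
    then have "u (x + y) - (q (y + v') - s') \<le> u x" if "(v', s') \<in> K" for v' s'
      by (intro greatest) (use that in \<open>force simp: algebra_simps\<close>)
    then have "u (x + y) - u x \<le> u y"
      by (intro greatest) (force simp: algebra_simps)
    then show ?thesis
      by simp
  qed
  moreover have "u (r *\<^sub>R x) \<le> r * u x" if "0 < r" for r x
  proof -
    have "u (r *\<^sub>R x) / r \<le> q (x + v) - s" if "(v, s) \<in> K" for v s
    proof -
      have "u (r *\<^sub>R x) \<le> q (r *\<^sub>R (x + v)) - r * s"
        using upper[OF scale[OF \<open>0 < r\<close> that], of "r *\<^sub>R x"] by (simp add: scaleR_add_right)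
      also have "\<dots> = r * (q (x + v) - s)"
        using sublinear_scale[OF q, of r "x + v"] \<open>0 < r\<close> by (simp add: right_diff_distrib)
      finally show ?thesis
        using \<open>0 < r\<close> by (simp add: field_simps)
    qed
    then have "u (r *\<^sub>R x) / r \<le> u x"
      by (rule greatest)
    then show ?thesis
      using \<open>0 < r\<close> by (simp add: field_simps)
  qed
  moreover have "u 0 = 0"
    using qle[of 0] greatest[of 0 0] le q by (simp add: sublinear_def order_antisym)
  ultimately have "sublinear u"
    by (simp add: sublinear_def)
  moreover have "u (- v) \<le> - s" if "(v, s) \<in> K" for v s
    using upper[OF that, of "- v"] q by (simp add: sublinear_def)
  ultimately show ?thesis
    using that qle upper by blast
qed

text \<open>Lowering \<open>m\<close> along the ray spanned by \<open>(y, m y)\<close> yields a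
  sublinear functional below \<open>m\<close>, hence \<open>m\<close> itself by minimality. Its
  upper bound then reads \<open>m x \<le> m (x + y) - m y\<close>, the half of additivity that
  sublinearity lacks.\<close>

lemma minimal_sublinear_linear:
  fixes m :: "'a::real_vector \<Rightarrow> real"
  assumes m: "sublinear m" and min: "\<And>q. sublinear q \<Longrightarrow> (\<And>x. q x \<le> m x) \<Longrightarrow> q = m"
  shows "linear m"
proof -
  have add: "m (x + y) = m x + m y" for x y
  proof -
    define K where "K = {(t *\<^sub>R y, t * m y) |t. 0 \<le> t}"
    obtain u where u: "sublinear u" "\<And>x. u x \<le> m x" "\<And>x v s. (v, s) \<in> K \<Longrightarrow> u x \<le> m (x + v) - s"
    proof (rule sublinear_cone[OF m, of K])
      show "(0, 0) \<in> K"
        unfolding K_def by (auto intro: exI[of _ 0])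
      show "(v + v', s + s') \<in> K" if "(v, s) \<in> K" "(v', s') \<in> K" for v s v' s'
        using that unfolding K_def by (auto simp: scaleR_add_left[symmetric] distrib_right[symmetric]
          intro: add_nonneg_nonneg)
      show "(r *\<^sub>R v, r * s) \<in> K" if "0 < r" and vs: "(v, s) \<in> K" for r v s
      proof -
        obtain t where "0 \<le> t" "v = t *\<^sub>R y" "s = t * m y"
          using vs unfolding K_def by blast
        then show ?thesis
          unfolding K_def using \<open>0 < r\<close> by (auto intro!: exI[of _ "r * t"])
      qed
      show "s \<le> m v" if "(v, s) \<in> K" for v s
        using that unfolding K_def by (auto simp: sublinear_scale[OF m])
    qed (rule that)
    have "(y, m y) \<in> K"
      unfolding K_def by (auto intro!: exI[of _ 1])
    then have "m x \<le> m (x + y) - m y"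
      using u(3)[of y "m y" x] min[OF u(1,2)] by simp
    then show ?thesis
      using m unfolding sublinear_def by (simp add: order_antisym add.commute)
  qed
  have neg: "m (- x) = - m x" for x
    using add[of "- x" x] m by (simp add: sublinear_def)
  show ?thesis
  proof (rule linearI)
    fix r x
    show "m (r *\<^sub>R x) = r *\<^sub>R m x"
    proof (cases "0 \<le> r")
      case False
      then have "m ((- r) *\<^sub>R x) = (- r) * m x"
        by (intro sublinear_scale[OF m]) simp
      then show ?thesis
        by (simp add: neg)
    qed (simp add: sublinear_scale[OF m])
  qed (rule add)
qed

text \<open>No functional is extended from a subspace; constraints are built into the sublinear
  functional beforehand by \<open>sublinear_cone\<close>. Zorn's lemma gives a minimal sublinear
  functional below \<open>p\<close>, and minimality forces linearity.\<close>

theorem hahn_banach: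
  fixes p :: "'a::real_vector \<Rightarrow> real"
  assumes p: "sublinear p"
  obtains F where "linear F" "\<And>x. F x \<le> p x"
proof -
  define A where "A = {q. sublinear q \<and> (\<forall>x. q x \<le> p x)}"
  \<comment> \<open>The order is reversed because Zorn's lemma delivers maximal elements.\<close>
  define P where "P q q' \<longleftrightarrow> (\<forall>x. q' x \<le> q x)" for q q' :: "'a \<Rightarrow> real"
  have "\<exists>m\<in>A. \<forall>a\<in>A. P m a \<longrightarrow> a = m"
  proof (rule predicate_Zorn)
    show "partial_order_on A (relation_of P A)"
      unfolding P_def by (rule partial_order_on_relation_ofI) (auto intro: order_trans intro!: ext antisym)
    fix C
    assume C: "C \<in> Chains (relation_of P A)"
    show "\<exists>u\<in>A. \<forall>a\<in>C. P a u"
    proof (cases "C = {}")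
      case True
      then show ?thesis
        using p by (auto simp: A_def)
    next
      case False
      have CA: "q \<in> A" if "q \<in> C" for q
        using C that unfolding Chains_def relation_of_def by blast
      have dir: "P q q' \<or> P q' q" if "q \<in> C" "q' \<in> C" for q q'
        using C that unfolding Chains_def relation_of_def by blast
      have low: "- p (- x) \<le> q x" if "q \<in> C" for q x
      proof -
        have "sublinear q" "q (- x) \<le> p (- x)"
          using CA[OF that] by (auto simp: A_def)
        then show ?thesis
          using sublinear_lower(2)[of q x] by simp
      qed
      define u where "u x = (INF q\<in>C. q x)" for x
      have bdd: "bdd_below ((\<lambda>q. q x) ` C)" for x
        by (rule bdd_belowI2[where m = "- p (- x)"]) (use low in auto)
      have upper: "u x \<le> q x" if "q \<in> C" for q x
        unfolding u_def by (rule cINF_lower[OF bdd that])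
      have greatest: "b \<le> u x" if "\<And>q. q \<in> C \<Longrightarrow> b \<le> q x" for b x
        unfolding u_def using False that by (rule cINF_greatest)
      have "u (x + y) \<le> u x + u y" for x y
      proof -
        have *: "u (x + y) \<le> q x + q' y" if qq: "q \<in> C" "q' \<in> C" for q q'
        proof -
          \<comment> \<open>In a chain one of q and q' lies below the other, so a single member
            serves both arguments.\<close>
          obtain r where r: "r \<in> C" "r x \<le> q x" "r y \<le> q' y"
            using dir[OF qq] qq unfolding P_def by blast
          have "r (x + y) \<le> r x + r y"
            using CA[OF r(1)] unfolding A_def sublinear_def by blast
          then show ?thesis
            using upper[OF r(1), of "x + y"] r by simp
        qed
        have "u (x + y) - q' y \<le> u x" if "q' \<in> C" for q'
          by (intro greatest) (use *[OF _ that] in \<open>simp add: algebra_simps\<close>)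
        then have "u (x + y) - u x \<le> u y"
          by (intro greatest) (simp add: algebra_simps)
        then show ?thesis
          by simp
      qed
      moreover have "u (r *\<^sub>R x) \<le> r * u x" if "0 < r" for r x
      proof -
        have "u (r *\<^sub>R x) / r \<le> q x" if "q \<in> C" for q
          using upper[OF that, of "r *\<^sub>R x"] CA[OF that] sublinear_scale[of q r x] \<open>0 < r\<close>
          by (simp add: A_def field_simps)
        then have "u (r *\<^sub>R x) / r \<le> u x"
          by (rule greatest)
        then show ?thesis
          using \<open>0 < r\<close> by (simp add: field_simps)
      qed
      moreover have "q 0 = 0" if "q \<in> C" for q
        using CA[OF that] by (simp add: A_def sublinear_def)
      then have "u 0 = 0"
        using False upper[of _ 0] greatest[of 0 0] by (metis all_not_in_conv order_antisym order_refl)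
      moreover have "u x \<le> p x" for x
      proof -
        obtain q where "q \<in> C"
          using False by blast
        then show ?thesis
          using upper[of q x] CA[of q] by (auto simp: A_def intro: order_trans)
      qed
      ultimately have "u \<in> A"
        by (simp add: A_def sublinear_def)
      then show ?thesis
        using upper unfolding P_def by blast
    qed
  qed
  then obtain m where m: "m \<in> A" "\<And>a. a \<in> A \<Longrightarrow> P m a \<Longrightarrow> a = m"
    by blast
  have "linear m"
  proof (rule minimal_sublinear_linear)
    show "q = m" if "sublinear q" "\<And>x. q x \<le> m x" for q
      using m that unfolding A_def P_def by (smt (verit) mem_Collect_eq)
  qed (use m in \<open>simp add: A_def\<close>)
  then show ?thesis
    using m(1) that unfolding A_def by blast
qed

text \<open>The cone generated by the pairs \<open>(c, e)\<close> prescribes a value of at least e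
  on C, and the norm admits this because it is at least e there. Convexity of C is what closes the
  cone under addition.\<close>

theorem separation_from_ball:
  fixes C :: "'a::real_normed_vector set"
  assumes "convex C" "\<And>c. c \<in> C \<Longrightarrow> e \<le> norm c"
  obtains F where "linear F" "\<And>x. F x \<le> norm x" "\<And>c. c \<in> C \<Longrightarrow> e \<le> F c"
proof -
  define K where "K = insert (0, 0) {(t *\<^sub>R c, t * e) |t c. 0 < t \<and> c \<in> C}"
  have K: "(t *\<^sub>R c, t * e) \<in> K" if "0 < t" "c \<in> C" for t c
    unfolding K_def using that by blast
  have norm: "sublinear (norm :: 'a \<Rightarrow> real)"
    by (simp add: sublinear_def norm_triangle_ineq)
  obtain u where u: "sublinear u" "\<And>x. u x \<le> norm x" "\<And>v s. (v, s) \<in> K \<Longrightarrow> u (- v) \<le> - s"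
  proof (rule sublinear_cone[OF norm, of K])
    show "(0, 0) \<in> K"
      by (simp add: K_def)
    show "(v + v', s + s') \<in> K" if vs: "(v, s) \<in> K" "(v', s') \<in> K" for v s v' s'
    proof (cases "(v, s) = (0, 0) \<or> (v', s') = (0, 0)")
      case False
      obtain t c where t: "0 < t" "c \<in> C" "v = t *\<^sub>R c" "s = t * e"
        using vs(1) False unfolding K_def by blast
      obtain t' c' where t': "0 < t'" "c' \<in> C" "v' = t' *\<^sub>R c'" "s' = t' * e"
        using vs(2) False unfolding K_def by blast
      define d where "d = (t / (t + t')) *\<^sub>R c + (t' / (t + t')) *\<^sub>R c'"
      have "d \<in> C"
        unfolding d_def using t t' by (intro convexD[OF assms(1)]) (auto simp: add_divide_distrib[symmetric])
      moreover have "v + v' = (t + t') *\<^sub>R d" "s + s' = (t + t') * e"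
      proof -
        have "(t + t') * (t / (t + t')) = t" "(t + t') * (t' / (t + t')) = t'"
          using t t' by simp_all
        then show "v + v' = (t + t') *\<^sub>R d"
          unfolding d_def scaleR_add_right scaleR_scaleR using t t' by simp
      qed (simp add: t t' distrib_right)
      ultimately show ?thesis
        using K[of "t + t'" d] t t' by simp
    qed (use vs in auto)
    show "(r *\<^sub>R v, r * s) \<in> K" if "0 < r" and vs: "(v, s) \<in> K" for r v s
    proof (cases "(v, s) = (0, 0)")
      case False
      then obtain t c where "0 < t" "c \<in> C" "v = t *\<^sub>R c" "s = t * e"
        using vs unfolding K_def by blast
      then show ?thesis
        using K[of "r * t" c] \<open>0 < r\<close> by (simp add: mult.assoc)
    qed (use vs in simp)
    show "s \<le> norm v" if "(v, s) \<in> K" for v s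
      using that assms(2) unfolding K_def by auto
  qed (rule that)
  obtain F where F: "linear F" "\<And>x. F x \<le> u x"
    using hahn_banach[OF u(1)] by blast
  have "e \<le> F c" if "c \<in> C" for c
    using u(3)[OF K[of 1 c]] F(2)[of "- c"] that by (simp add: linear_neg[OF F(1)])
  then show ?thesis
    using that F u(2) order_trans by blast
qed


section \<open>Almost invariant vectors\<close>

text \<open>Stated through coefficients close to 1 rather than small displacements: coefficients are
  what enters Fell's argument, and they multiply under tensor products.\<close>

definition almost_invariant_vectors :: "('g, 'b) monoid_scheme \<Rightarrow> bool"
  where "almost_invariant_vectors G \<longleftrightarrow> (\<forall>F e. finite F \<longrightarrow> F \<subseteq> carrier G \<longrightarrow> 0 < e \<longrightarrow>
    (\<exists>\<xi> :: 'g ell2. norm \<xi> = 1 \<and> (\<forall>g\<in>F. cmod (cinner \<xi> (left_translation G g \<xi>) - 1) \<le> e)))"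

text \<open>The norm on \<open>poly_mapping\<close> is the l1 norm, so functionals dominated by it
  are given by bounded functions, to which a mean can be applied. This is why the separation
  argument takes place there.\<close>

lemma sum_norm_lookup_le: "finite Z \<Longrightarrow> (\<Sum>z\<in>Z. norm (Poly_Mapping.lookup f z)) \<le> norm f"
  for f :: "('a, 'b::real_normed_vector) poly_mapping"
proof -
  assume "finite Z"
  have "(\<Sum>z\<in>Z. norm (Poly_Mapping.lookup f z)) = (\<Sum>z\<in>Z \<inter> Poly_Mapping.keys f. norm (Poly_Mapping.lookup f z))"
    using \<open>finite Z\<close> by (intro sum.mono_neutral_right) (auto simp: in_keys_iff)
  also have "\<dots> \<le> (\<Sum>z\<in>Poly_Mapping.keys f. norm (Poly_Mapping.lookup f z))"
    by (intro sum_mono2) auto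
  also have "\<dots> = norm f"
    by (simp add: norm_poly_mapping_def dist_poly_mapping_def)
  finally show ?thesis .
qed

lemma norm_single: "norm (Poly_Mapping.single k v) = norm v"
  by (simp add: norm_poly_mapping_def dist_poly_mapping_def)

lemma lookup_scaleR: "Poly_Mapping.lookup (r *\<^sub>R f) k = r *\<^sub>R Poly_Mapping.lookup f k"
proof -
  have "finite {i. r *\<^sub>R Poly_Mapping.lookup f i \<noteq> 0}"
    by (rule finite_subset[OF _ finite_lookup[of f]]) auto
  then show ?thesis
    by (simp add: scaleR_poly_mapping_def Abs_poly_mapping_inverse)
qed

text \<open>If the displacements of the densities \<open>p\<close> were bounded away from \<open>0\<close> in the
  \<open>\<ell>\<^sup>1\<close>-norm, a separating functional would consist of bounded functions \<open>f g\<close> such that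
  \<open>\<Sum>g\<in>F. f g (g x) - f g x\<close> is bounded below by a positive constant, but its mean is zero.\<close>

lemma amenable_reiter:
  fixes G :: "('g, 'b) monoid_scheme"
  assumes "group G" "amenable G" "finite F" "F \<subseteq> carrier G" "0 < e"
  obtains p :: "'g \<Rightarrow> real" and S where "finite S" "S \<subseteq> carrier G" "\<And>x. 0 \<le> p x" "\<And>x. x \<notin> S \<Longrightarrow> p x = 0"
    "sum p S = 1" "\<And>g Z. g \<in> F \<Longrightarrow> finite Z \<Longrightarrow> Z \<subseteq> carrier G \<Longrightarrow>
      (\<Sum>y\<in>Z. \<bar>p (inv\<^bsub>G\<^esub> g \<otimes>\<^bsub>G\<^esub> y) - p y\<bar>) \<le> e"
proof -
  interpret group G by fact
  obtain m :: "('g \<Rightarrow> real) \<Rightarrow> real" where m: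
    "\<forall>f f'. bounded (f ` carrier G) \<longrightarrow> bounded (f' ` carrier G) \<longrightarrow> m (\<lambda>x. f x + f' x) = m f + m f'"
    "\<forall>f r. bounded (f ` carrier G) \<longrightarrow> m (\<lambda>x. r * f x) = r * m f"
    "\<forall>f. bounded (f ` carrier G) \<longrightarrow> (\<forall>x\<in>carrier G. 0 \<le> f x) \<longrightarrow> 0 \<le> m f"
    "m (\<lambda>_. 1) = 1"
    "\<forall>f. bounded (f ` carrier G) \<longrightarrow> (\<forall>g\<in>carrier G. m (\<lambda>x. f (g \<otimes>\<^bsub>G\<^esub> x)) = m f)"
    using assms(2) unfolding amenable_def by (elim exE conjE) (rule that)
  note m_add = m(1)[rule_format] and m_scale = m(2)[rule_format] and m_nonneg = m(3)[rule_format]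
    and m_one = m(4) and m_inv = m(5)[rule_format]
  \<comment> \<open>One vector for all g in F: coordinate (g, y) holds the displacement under g of
    the point mass at x, so \<open>d\<close> takes values in a direct sum of copies of l1 indexed by
    F.\<close>
  define d :: "'g \<Rightarrow> ('g \<times> 'g, real) poly_mapping"
    where "d x = (\<Sum>g\<in>F. Poly_Mapping.single (g, g \<otimes>\<^bsub>G\<^esub> x) 1 - Poly_Mapping.single (g, x) 1)" for x
  have "\<exists>c\<in>convex hull (d ` carrier G). norm c < e"
  proof (rule ccontr)
    assume "\<not> ?thesis"
    then obtain L where L: "linear L" "\<And>x. L x \<le> norm x" "\<And>c. c \<in> convex hull (d ` carrier G) \<Longrightarrow> e \<le> L c"
      using separation_from_ball[of "convex hull (d ` carrier G)" e] convex_convex_hull by (metis not_less)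
    define f where "f g y = L (Poly_Mapping.single (g, y) 1)" for g y
    have "\<bar>f g y\<bar> \<le> 1" for g y
      using L(2)[of "Poly_Mapping.single (g, y) 1"] L(2)[of "- Poly_Mapping.single (g, y) 1"]
      by (simp add: f_def norm_single linear_neg[OF L(1)] abs_le_iff)
    then have bf: "bounded ((\<lambda>x. f g (h x)) ` carrier G)" for g and h :: "'g \<Rightarrow> 'g"
      unfolding bounded_iff by auto
    have bneg: "bounded ((\<lambda>x. (-1) * f g x) ` carrier G)" for g
      using bf[of g "\<lambda>x. x"] unfolding bounded_iff by auto
    have diff: "m (\<lambda>x. f g (g \<otimes>\<^bsub>G\<^esub> x) - f g x) = 0" if "g \<in> carrier G" for g
    proof -
      have "m (\<lambda>x. f g (g \<otimes>\<^bsub>G\<^esub> x) + (-1) * f g x) = m (\<lambda>x. f g (g \<otimes>\<^bsub>G\<^esub> x)) + m (\<lambda>x. (-1) * f g x)"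
        by (rule m_add[OF bf bneg])
      then show ?thesis
        using m_inv[OF bf[of g "\<lambda>x. x"] that] m_scale[OF bf[of g "\<lambda>x. x"], of "-1"] by simp
    qed
    have bdiff: "bounded ((\<lambda>x. f g (g \<otimes>\<^bsub>G\<^esub> x) - f g x) ` carrier G)" for g
      by (rule bounded_minus_comp[OF bf bf[of g "\<lambda>x. x"]])
    have bconst: "bounded ((\<lambda>x. k :: real) ` carrier G)" for k
      by (auto simp: bounded_iff intro: exI[of _ "\<bar>k\<bar>"])
    \<comment> \<open>The mean is known to be additive only for two bounded functions, so
      boundedness is carried along the induction.\<close>
    have sum: "m (\<lambda>x. \<Sum>g\<in>F'. f g (g \<otimes>\<^bsub>G\<^esub> x) - f g x) = 0 \<and>
        bounded ((\<lambda>x. \<Sum>g\<in>F'. f g (g \<otimes>\<^bsub>G\<^esub> x) - f g x) ` carrier G)" if "F' \<subseteq> F" for F'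
      using finite_subset[OF that assms(3)] that
    proof (induction F' rule: finite_induct)
      case empty
      have "m (\<lambda>x. 0 * 1) = 0 * m (\<lambda>x. 1)"
        by (rule m_scale[OF bconst])
      then show ?case
        using bconst[of 0] by simp
    next
      case (insert g F')
      let ?\<Psi> = "\<lambda>x. \<Sum>g\<in>F'. f g (g \<otimes>\<^bsub>G\<^esub> x) - f g x"
      have IH: "m ?\<Psi> = 0" "bounded (?\<Psi> ` carrier G)"
        using insert by simp_all
      have "m (\<lambda>x. (f g (g \<otimes>\<^bsub>G\<^esub> x) - f g x) + ?\<Psi> x) = 0"
        using m_add[OF bdiff IH(2)] diff[of g] IH(1) insert.prems assms(4) by auto
      moreover have "bounded ((\<lambda>x. (f g (g \<otimes>\<^bsub>G\<^esub> x) - f g x) + ?\<Psi> x) ` carrier G)"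
        by (rule bounded_plus_comp[OF bdiff IH(2)])
      ultimately show ?case
        using insert.hyps by simp
    qed
    define \<Phi> where "\<Phi> x = (\<Sum>g\<in>F. f g (g \<otimes>\<^bsub>G\<^esub> x) - f g x)" for x
    have \<Phi>: "m \<Phi> = 0" "bounded (\<Phi> ` carrier G)"
      using sum[of F] by (simp_all add: \<Phi>_def[abs_def])
    have "e \<le> \<Phi> x" if "x \<in> carrier G" for x
    proof -
      have "L (d x) = \<Phi> x"
        by (simp add: d_def \<Phi>_def f_def linear_sum[OF L(1)] linear_diff[OF L(1)])
      then show ?thesis
        using L(3)[of "d x"] that by (simp add: hull_inc)
    qed
    \<comment> \<open>Here \<open>\<Phi> - e\<close> is nonnegative on the group, while its mean is
      -e.\<close>
    then have "0 \<le> m (\<lambda>x. \<Phi> x + (- e) * 1)"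
      by (intro m_nonneg bounded_plus_comp[OF \<Phi>(2) bconst]) simp
    also have "\<dots> = m \<Phi> + m (\<lambda>x. (- e) * 1)"
      by (rule m_add[OF \<Phi>(2) bconst])
    also have "\<dots> = - e"
      using m_scale[OF bconst[of 1], of "- e"] \<Phi>(1) m_one by simp
    finally show False
      using assms(5) by simp
  qed
  then obtain c where c: "c \<in> convex hull (d ` carrier G)" "norm c < e"
    by blast
  obtain D u where D: "finite D" "D \<subseteq> d ` carrier G" "\<And>v. v \<in> D \<Longrightarrow> 0 \<le> u v" "sum u D = 1" "(\<Sum>v\<in>D. u v *\<^sub>R v) = c"
    using c(1) unfolding convex_hull_explicit by blast
  \<comment> \<open>The convex weights live on displacement vectors, and \<open>d\<close> need not
    be injective; a set of representatives turns them into weights on group elements.\<close>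
  obtain S where S: "S \<subseteq> carrier G" "inj_on d S" "D = d ` S"
    using D(2) unfolding subset_image_inj by blast
  have "finite S"
    using D(1) S(2,3) by (simp add: finite_image_iff)
  define p where "p x = (if x \<in> S then u (d x) else 0)" for x
  have p: "sum p S = 1" "c = (\<Sum>x\<in>S. p x *\<^sub>R d x)"
    using D(4,5) S by (simp_all add: p_def sum.reindex)
  have "(\<Sum>y\<in>Z. \<bar>p (inv\<^bsub>G\<^esub> g \<otimes>\<^bsub>G\<^esub> y) - p y\<bar>) \<le> e" if g: "g \<in> F" and Z: "finite Z" "Z \<subseteq> carrier G" for g Z
  proof -
    have [simp]: "g \<in> carrier G"
      using g assms(4) by blast
    have "Poly_Mapping.lookup (d x) (g, y) = of_bool (y = g \<otimes>\<^bsub>G\<^esub> x) - of_bool (y = x)" for x y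
    proof -
      have "Poly_Mapping.lookup (d x) (g, y) = (\<Sum>h\<in>F. if h = g then of_bool (y = g \<otimes>\<^bsub>G\<^esub> x) - of_bool (y
        = x) else 0)"
        unfolding d_def lookup_sum by (intro sum.cong) (auto simp: lookup_minus lookup_single when_def)
      then show ?thesis
        using assms(3) g by simp
    qed
    note dl = this
    have "Poly_Mapping.lookup c (g, y) = p (inv\<^bsub>G\<^esub> g \<otimes>\<^bsub>G\<^esub> y) - p y" if y: "y \<in> carrier G" for y
    proof -
      have eq: "y = g \<otimes>\<^bsub>G\<^esub> x \<longleftrightarrow> x = inv\<^bsub>G\<^esub> g \<otimes>\<^bsub>G\<^esub> y" if "x \<in> S" for x
        using S(1) that y group_acts_inv(1,2)[OF group_acts_mult[OF assms(1)] \<open>g \<in> carrier G\<close>] by auto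
      have "Poly_Mapping.lookup c (g, y) = (\<Sum>x\<in>S. p x * (of_bool (y = g \<otimes>\<^bsub>G\<^esub> x) - of_bool (y = x)))"
        by (simp add: p(2) lookup_sum lookup_scaleR dl)
      also have "\<dots> = (\<Sum>x\<in>S. (if x = inv\<^bsub>G\<^esub> g \<otimes>\<^bsub>G\<^esub> y then p x else 0) - (if x = y then p x else 0))"
        by (intro sum.cong) (auto simp: eq)
      also have "\<dots> = p (inv\<^bsub>G\<^esub> g \<otimes>\<^bsub>G\<^esub> y) - p y"
        using \<open>finite S\<close> by (simp add: sum_subtractf) (simp add: p_def)
      finally show ?thesis .
    qed
    then have "(\<Sum>y\<in>Z. \<bar>p (inv\<^bsub>G\<^esub> g \<otimes>\<^bsub>G\<^esub> y) - p y\<bar>) = (\<Sum>y\<in>Z. norm (Poly_Mapping.lookup c (g, y)))"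
      using Z(2) by (intro sum.cong) auto
    also have "\<dots> = (\<Sum>z\<in>Pair g ` Z. norm (Poly_Mapping.lookup c z))"
      by (subst sum.reindex) (auto simp: inj_on_def)
    also have "\<dots> \<le> norm c"
      using Z(1) by (intro sum_norm_lookup_le) simp
    finally show ?thesis
      using c(2) by simp
  qed
  moreover have "0 \<le> p x" for x
    using D(3) S(3) by (simp add: p_def)
  moreover have "p x = 0" if "x \<notin> S" for x
    using that by (simp add: p_def)
  ultimately show ?thesis
    using that[of S p] S(1) \<open>finite S\<close> p(1) by blast
qed

text \<open>Converts an l1 estimate for densities into an l2 estimate for their square roots: a - b
  factors as (sqrt a - sqrt b) (sqrt a + sqrt b), and the second factor dominates the first in
  modulus.\<close>

lemma power2_diff_sqrt_le:
  assumes "0 \<le> a" "0 \<le> b"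
  shows "(sqrt a - sqrt b)\<^sup>2 \<le> \<bar>a - b\<bar>"
proof -
  have "a - b = (sqrt a - sqrt b) * (sqrt a + sqrt b)"
    using assms by (simp add: algebra_simps)
  then have "\<bar>a - b\<bar> = \<bar>sqrt a - sqrt b\<bar> * (sqrt a + sqrt b)"
    using assms by (simp add: abs_mult)
  moreover have "\<bar>sqrt a - sqrt b\<bar> \<le> sqrt a + sqrt b"
    using assms by (simp add: abs_le_iff)
  ultimately show ?thesis
    by (metis abs_ge_zero mult_left_mono power2_abs power2_eq_square)
qed

text \<open>The vector is the square root of a density from \<open>amenable_reiter\<close>, applied
  with e squared to compensate for the root. Pairing the displacement of a unit vector with the
  vector itself turns the displacement bound into a coefficient bound.\<close>

theorem amenable_almost_invariant_vectors:
  fixes G :: "('g, 'b) monoid_scheme"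
  assumes "group G" "amenable G"
  shows "almost_invariant_vectors G"
  unfolding almost_invariant_vectors_def
proof (intro allI impI)
  fix F and e :: real
  assume F: "finite F" "F \<subseteq> carrier G" "0 < e"
  interpret group G by fact
  obtain p :: "'g \<Rightarrow> real" and S where p: "finite S" "S \<subseteq> carrier G" "\<And>x. 0 \<le> p x" "\<And>x. x \<notin> S \<Longrightarrow> p x = 0"
    "sum p S = 1" "\<And>g Z. g \<in> F \<Longrightarrow> finite Z \<Longrightarrow> Z \<subseteq> carrier G \<Longrightarrow>
      (\<Sum>y\<in>Z. \<bar>p (inv\<^bsub>G\<^esub> g \<otimes>\<^bsub>G\<^esub> y) - p y\<bar>) \<le> e\<^sup>2"
  proof (rule amenable_reiter[OF assms F(1,2)])
    show "0 < e\<^sup>2"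
      using F(3) by simp
  qed (rule that)
  define \<xi> where "\<xi> = Abs_ell2 (\<lambda>x. complex_of_real (sqrt (p x)))"
  have "(\<lambda>x. (cmod (complex_of_real (sqrt (p x))))\<^sup>2) = p"
    using p(3) by auto
  moreover have "(p has_sum 1) UNIV"
    by (rule has_sum_finite_neutralI[where B = S]) (use p in auto)
  ultimately have rep: "Rep_ell2 \<xi> x = sqrt (p x)" and "norm \<xi> = 1" for x
    unfolding \<xi>_def
    by (auto simp: Abs_ell2_inverse has_sum_imp_summable norm_ell2_def inner_ell2.rep_eq infsumI
        simp flip: power2_norm_eq_inner)
  moreover have "cmod (cinner \<xi> (left_translation G g \<xi>) - 1) \<le> e" if "g \<in> F" for g
  proof -
    have g: "g \<in> carrier G"
      using that F by blast
    have "norm (left_translation G g \<xi> - \<xi>) \<le> e"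
    proof (rule norm_ell2_le)
      fix Z :: "'g set"
      assume "finite Z"
      have "(\<Sum>x\<in>Z. (cmod (Rep_ell2 (left_translation G g \<xi> - \<xi>) x))\<^sup>2)
          = (\<Sum>x\<in>Z \<inter> carrier G. (cmod (Rep_ell2 (left_translation G g \<xi> - \<xi>) x))\<^sup>2)"
        using \<open>finite Z\<close> p(2,4) by (intro sum.mono_neutral_right)
          (auto simp: Rep_ell2_minus left_translation_apply[OF assms(1) g] rep)
      also have "\<dots> \<le> (\<Sum>x\<in>Z \<inter> carrier G. \<bar>p (inv\<^bsub>G\<^esub> g \<otimes>\<^bsub>G\<^esub> x) - p x\<bar>)"
        using p(3) by (intro sum_mono)
          (simp add: Rep_ell2_minus left_translation_apply[OF assms(1) g]
            rep power2_diff_sqrt_le flip: of_real_diff)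
      also have "\<dots> \<le> e\<^sup>2"
        using \<open>finite Z\<close> by (intro p(6)[OF that]) auto
      finally show "(\<Sum>x\<in>Z. (cmod (Rep_ell2 (left_translation G g \<xi> - \<xi>) x))\<^sup>2) \<le> e\<^sup>2" .
    qed (use F in simp)
    moreover have "cinner \<xi> (left_translation G g \<xi>) - 1 = cinner \<xi> (left_translation G g \<xi> - \<xi>)"
      by (simp add: cinner_diff_right cinner_self \<open>norm \<xi> = 1\<close>)
    ultimately show ?thesis
      using cmod_cinner_le[of \<xi> "left_translation G g \<xi> - \<xi>"] \<open>norm \<xi> = 1\<close> by simp
  qed
  ultimately show "\<exists>\<xi> :: 'g ell2. norm \<xi> = 1 \<and> (\<forall>g\<in>F. cmod (cinner \<xi> (left_translation G g \<xi>) - 1) \<le> e)"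
    by blast
qed

text \<open>Coefficients of tensors multiply, and a b - 1 = (a - 1) b + (b - 1) with b of modulus at
  most 1, so e / 2 in each factor is enough. This supplies the product group without constructing a
  mean on it.\<close>

lemma almost_invariant_vectors_prod:
  fixes G :: "('g, 'b) monoid_scheme" and K :: "('h, 'c) monoid_scheme"
  assumes "group G" "group K" "almost_invariant_vectors G" "almost_invariant_vectors K"
  shows "almost_invariant_vectors (G \<times>\<times> K)"
  unfolding almost_invariant_vectors_def
proof (intro allI impI)
  fix F :: "('g \<times> 'h) set" and e :: real
  assume F: "finite F" "F \<subseteq> carrier (G \<times>\<times> K)" "0 < e"
  have sub: "finite (fst ` F)" "fst ` F \<subseteq> carrier G" "finite (snd ` F)"
    "snd ` F \<subseteq> carrier K" and half: "0 < e / 2"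
    using F by auto
  obtain \<xi> :: "'g ell2" where \<xi>: "norm \<xi> = 1"
    "\<And>g. g \<in> fst ` F \<Longrightarrow> cmod (cinner \<xi> (left_translation G g \<xi>) - 1) \<le> e / 2"
    using assms(3)[unfolded almost_invariant_vectors_def, rule_format, OF sub(1,2) half] by blast
  obtain \<eta> :: "'h ell2" where \<eta>: "norm \<eta> = 1"
    "\<And>k. k \<in> snd ` F \<Longrightarrow> cmod (cinner \<eta> (left_translation K k \<eta>) - 1) \<le> e / 2"
    using assms(4)[unfolded almost_invariant_vectors_def, rule_format, OF sub(3,4) half] by blast
  have "cmod (cinner (\<xi> \<otimes>\<^sub>v \<eta>) (left_translation (G \<times>\<times> K) z (\<xi> \<otimes>\<^sub>v \<eta>)) - 1) \<le> e" if zF: "z \<in> F" for z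
  proof -
    obtain g k where z: "z = (g, k)" "g \<in> carrier G" "k \<in> carrier K"
      using zF F(2) by (cases z) auto
    define a where "a = cinner \<xi> (left_translation G g \<xi>)"
    define b where "b = cinner \<eta> (left_translation K k \<eta>)"
    have le: "cmod (a - 1) \<le> e / 2" "cmod (b - 1) \<le> e / 2"
      using \<xi>(2)[of g] \<eta>(2)[of k] zF z by (auto simp: a_def b_def rev_image_eqI)
    have "norm (left_translation K k) \<le> 1"
      unfolding left_translation_def
      by (rule norm_pullback_le[OF group_acts_inj_on_inv[OF group_acts_mult[OF assms(2)] z(3)]])
    then have "norm (left_translation K k \<eta>) \<le> 1"
      using norm_blinfun[of "left_translation K k" \<eta>] \<eta>(1) by simp
    then have "cmod b \<le> 1"
      using cmod_cinner_le[of \<eta> "left_translation K k \<eta>"] \<eta>(1) by (simp add: b_def)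
    have "cinner (\<xi> \<otimes>\<^sub>v \<eta>) (left_translation (G \<times>\<times> K) z (\<xi> \<otimes>\<^sub>v \<eta>)) = a * b"
      using z assms by (simp add: a_def b_def left_translation_prod[symmetric] tensor_op_apply
        clinear_op_left_translation cinner_tensor_ell2)
    moreover have "a * b - 1 = (a - 1) * b + (b - 1)"
      by (simp add: algebra_simps)
    moreover have "cmod ((a - 1) * b) \<le> e / 2 * 1"
      unfolding norm_mult using le \<open>cmod b \<le> 1\<close> F by (intro mult_mono) auto
    ultimately show ?thesis
      using le norm_triangle_ineq[of "(a - 1) * b" "b - 1"] by (simp only:)
  qed
  moreover have "norm (\<xi> \<otimes>\<^sub>v \<eta>) = 1"
    by (simp add: norm_tensor_ell2 \<xi> \<eta>)
  ultimately show "\<exists>\<zeta> :: ('g \<times> 'h) ell2. norm \<zeta> = 1 \<and>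
      (\<forall>z\<in>F. cmod (cinner \<zeta> (left_translation (G \<times>\<times> K) z \<zeta>) - 1) \<le> e)"
    by blast
qed

section \<open>Weak containment of permutation representations\<close>

text \<open>On basis vectors \<open>W1\<close> applies the inverse of y to the second coordinate of
  (y, x), the translation moves y to g y, and \<open>W2\<close> applies the new first coordinate,
  which leaves g acting on x. Thus the action is absorbed into an amplification of the regular
  representation.\<close>

lemma left_times_perm_op:
  fixes G :: "('g, 'b) monoid_scheme" and X :: "'x set"
  assumes acts: "group_acts G X \<alpha>" and g: "g \<in> carrier G"
  defines "W1 \<equiv> pullback (carrier G \<times> X) (\<lambda>(y, x). (y, \<alpha> y x))"
    and "W2 \<equiv> pullback (carrier G \<times> X) (\<lambda>(y, x). (y, \<alpha> (inv\<^bsub>G\<^esub> y) x))"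
  shows "left_translation G g \<otimes>\<^sub>o perm_op G X \<alpha> g = W2 o\<^sub>L (left_translation G g \<otimes>\<^sub>o id_blinfun) o\<^sub>L W1"
    and "clinear_op W1" "clinear_op W2" "norm W1 \<le> 1" "norm W2 \<le> 1"
proof -
  have grp: "group G"
    using acts by (simp add: group_acts_def)
  interpret group G by fact
  note inv = group_acts_inv[OF acts]
  have inj: "inj_on (\<lambda>(y, x). (y, \<alpha> y x)) (carrier G \<times> X)" "inj_on (\<lambda>(y, x). (y, \<alpha> (inv\<^bsub>G\<^esub> y) x)) (carrier G \<times> X)"
    using group_acts_inj_on[OF acts] group_acts_inj_on_inv[OF acts] by (auto simp: inj_on_def)
  show W: "clinear_op W1" "clinear_op W2" "norm W1 \<le> 1" "norm W2 \<le> 1"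
    unfolding W1_def W2_def by (intro clinear_op_pullback norm_pullback_le inj)+
  have W1: "W1 (ket (y, x)) = (if y \<in> carrier G \<and> x \<in> X then ket (y, \<alpha> (inv\<^bsub>G\<^esub> y) x) else 0)" for x y
  proof (cases "y \<in> carrier G \<and> x \<in> X")
    case True
    then show ?thesis
      unfolding W1_def using inv by (simp add: pullback_ket[OF inj(1), of "(y, \<alpha> (inv\<^bsub>G\<^esub> y) x)"])
  next
    case False
    then have "(y, x) \<notin> (\<lambda>(y, x). (y, \<alpha> y x)) ` (carrier G \<times> X)"
      using inv by auto
    then show ?thesis
      unfolding W1_def using False by (auto simp: pullback_ket_zero[OF inj(1)])
  qed
  have W2: "W2 (ket (y, x)) = ket (y, \<alpha> y x)" if "y \<in> carrier G" "x \<in> X" for x y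
    unfolding W2_def using that inv by (simp add: pullback_ket[OF inj(2), of "(y, \<alpha> y x)"])
  show "left_translation G g \<otimes>\<^sub>o perm_op G X \<alpha> g = W2 o\<^sub>L (left_translation G g \<otimes>\<^sub>o id_blinfun) o\<^sub>L W1"
  proof (rule tensor_op_eqI)
    fix y x
    show "(W2 o\<^sub>L (left_translation G g \<otimes>\<^sub>o id_blinfun) o\<^sub>L W1) (ket (y, x))
      = left_translation G g (ket y) \<otimes>\<^sub>v perm_op G X \<alpha> g (ket x)"
    proof (cases "y \<in> carrier G \<and> x \<in> X")
      case True
      have "(left_translation G g \<otimes>\<^sub>o id_blinfun) (ket y \<otimes>\<^sub>v ket z) = ket (g \<otimes>\<^bsub>G\<^esub> y) \<otimes>\<^sub>v ket z" for z :: 'x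
        using True g by (simp add: tensor_op_apply clinear_op_left_translation[OF grp]
          clinear_op_id left_translation_ket[OF grp])
      then show ?thesis
        using True g acts inv
        by (simp add: W1 W2 ket_tensor left_translation_ket[OF grp] perm_op_ket[OF acts])
          (simp add: group_acts_def)
    next
      case False
      then show ?thesis
        using g by (auto simp: W1 left_translation_ket[OF grp] perm_op_ket[OF acts]
          tensor_ell2_zero_left tensor_ell2_zero_right)
    qed
  qed (use g W in \<open>simp_all add: clinear_op_left_translation[OF grp] clinear_op_perm_op[OF acts]
      clinear_op_compose clinear_op_tensor clinear_op_id\<close>)
qed

text \<open>Fell's absorption principle bounds \<open>\<Sum>g. c g \<lambda>\<^sub>g \<otimes> \<pi>\<^sub>g\<close> by \<open>\<Sum>g. c g \<lambda>\<^sub>g\<close>. Tensoring with an almost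
  invariant vector in the first factor then recovers \<open>\<Sum>g. c g \<pi>\<^sub>g\<close>.\<close>

theorem norm_sum_perm_op_le:
  fixes G :: "('g, 'b) monoid_scheme" and X :: "'x set"
  assumes acts: "group_acts G X \<alpha>" and aiv: "almost_invariant_vectors G" and F: "finite F" "F \<subseteq> carrier G"
  shows "norm (\<Sum>g\<in>F. c g *\<^sub>C perm_op G X \<alpha> g) \<le> norm (\<Sum>g\<in>F. c g *\<^sub>C left_translation G g)"
    (is "norm ?P \<le> norm ?T")
proof -
  have grp: "group G"
    using acts by (simp add: group_acts_def)
  define W1 where "W1 = pullback (carrier G \<times> X) (\<lambda>(y, x). (y, \<alpha> y x))"
  define W2 where "W2 = pullback (carrier G \<times> X) (\<lambda>(y, x). (y, \<alpha> (inv\<^bsub>G\<^esub> y) x))"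
  have W: "clinear_op W1" "clinear_op W2" "norm W1 \<le> 1" "norm W2 \<le> 1"
    unfolding W1_def W2_def
    using left_times_perm_op(2-5)[OF acts group.is_monoid[OF grp, THEN monoid.one_closed]] by blast+
  let ?L = "left_translation G"
  have sub: "complex_vector.subspace complex_ops" "?L g \<in> complex_ops" "clinear_op (?L g)" if "g \<in> F" for g
    using that F clinear_op_left_translation[OF grp] by (auto simp: subspace_complex_ops complex_ops_iff)
  define R where "R = (\<Sum>g\<in>F. c g *\<^sub>C (?L g \<otimes>\<^sub>o perm_op G X \<alpha> g))"
  have "bounded_clinear_on (complex_ops :: 'g op set) (\<lambda>a. (W2 o\<^sub>L (a \<otimes>\<^sub>o (id_blinfun :: 'x op))) o\<^sub>L W1)"
    by (intro bounded_clinear_on_compose[OF bounded_clinear_on_compose[OF bounded_clinear_on_tensor_left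
            bounded_clinear_on_compose_right] bounded_clinear_on_compose_left])
      (auto simp: clinear_op_id W)
  from bounded_clinear_on_sum[OF this subspace_complex_ops, of F ?L c]
  have R: "R = (W2 o\<^sub>L (?T \<otimes>\<^sub>o id_blinfun)) o\<^sub>L W1"
    unfolding R_def W1_def W2_def using sub F(2) by (auto intro!: sum.cong simp: left_times_perm_op(1)[OF acts])
  have "?T \<in> complex_ops"
    using sub F(2) by (intro complex_vector.subspace_sum[OF subspace_complex_ops]
        complex_vector.subspace_scale[OF subspace_complex_ops]) auto
  then have "norm (?T \<otimes>\<^sub>o (id_blinfun :: 'x op)) \<le> norm ?T * norm (id_blinfun :: 'x op)"
    by (intro norm_tensor_op_le) (simp_all add: complex_ops_iff clinear_op_id)
  also have "\<dots> \<le> norm ?T * 1"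
    by (intro mult_left_mono norm_blinfun_id_le) simp
  finally have T1: "norm (?T \<otimes>\<^sub>o (id_blinfun :: 'x op)) \<le> norm ?T"
    by simp
  have "norm R \<le> (norm W2 * norm (?T \<otimes>\<^sub>o (id_blinfun :: 'x op))) * norm W1"
    unfolding R by (meson norm_blinfun_compose mult_right_mono norm_ge_zero order_trans)
  also have "\<dots> \<le> (1 * norm ?T) * 1"
    by (intro mult_mono W T1) auto
  finally have normR: "norm R \<le> norm ?T"
    by simp
  show ?thesis
  proof (rule norm_op_le_cinnerI)
    fix \<zeta> \<eta> :: "'x ell2"
    define b where "b g = cinner \<zeta> (perm_op G X \<alpha> g \<eta>)" for g
    define M where "M = (\<Sum>g\<in>F. cmod (c g) * cmod (b g))"
    have "0 \<le> M"
      by (simp add: M_def sum_nonneg)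
    have P: "cinner \<zeta> (?P \<eta>) = (\<Sum>g\<in>F. c g * b g)"
      by (simp add: blinfun.sum_left cinner_sum_right cinner_scaleC_right b_def)
    \<comment> \<open>The error is e times a number \<open>M\<close> that does not depend on the
      almost invariant vector, so it can be removed at the end.\<close>
    have "cmod (cinner \<zeta> (?P \<eta>)) \<le> norm ?T * norm \<zeta> * norm \<eta> + e * M" if e: "0 < e" for e
    proof -
      obtain \<xi> :: "'g ell2" where \<xi>: "norm \<xi> = 1" "\<And>g. g \<in> F \<Longrightarrow> cmod (cinner \<xi> (?L g \<xi>) - 1) \<le> e"
        using aiv[unfolded almost_invariant_vectors_def, rule_format, OF F e] by blast
      define a where "a g = cinner \<xi> (?L g \<xi>)" for g
      have "cinner (\<xi> \<otimes>\<^sub>v \<zeta>) (R (\<xi> \<otimes>\<^sub>v \<eta>)) = (\<Sum>g\<in>F. c g * (a g * b g))"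
        unfolding R_def blinfun.sum_left cinner_sum_right
        using sub(3) F(2) clinear_op_perm_op[OF acts]
        by (intro sum.cong) (auto simp: cinner_scaleC_right tensor_op_apply subset_iff cinner_tensor_ell2
          a_def b_def)
      then have "cinner \<zeta> (?P \<eta>) = cinner (\<xi> \<otimes>\<^sub>v \<zeta>) (R (\<xi> \<otimes>\<^sub>v \<eta>)) - (\<Sum>g\<in>F. c g * ((a g - 1) * b g))"
        unfolding P by (simp add: sum_subtractf[symmetric] algebra_simps)
      then have "cmod (cinner \<zeta> (?P \<eta>)) \<le> cmod (cinner (\<xi> \<otimes>\<^sub>v \<zeta>) (R (\<xi> \<otimes>\<^sub>v \<eta>)))
          + cmod (\<Sum>g\<in>F. c g * ((a g - 1) * b g))"
        by (simp add: norm_triangle_ineq4)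
      also have "cmod (\<Sum>g\<in>F. c g * ((a g - 1) * b g)) \<le> (\<Sum>g\<in>F. e * (cmod (c g) * cmod (b g)))"
      proof (rule sum_norm_le)
        fix g
        assume "g \<in> F"
        then have "cmod (a g - 1) * (cmod (c g) * cmod (b g)) \<le> e * (cmod (c g) * cmod (b g))"
          using \<xi>(2) by (intro mult_right_mono) (auto simp: a_def)
        then show "cmod (c g * ((a g - 1) * b g)) \<le> e * (cmod (c g) * cmod (b g))"
          by (simp add: norm_mult ac_simps)
      qed
      also have "\<dots> = e * M"
        by (simp add: M_def sum_distrib_left)
      also have "cmod (cinner (\<xi> \<otimes>\<^sub>v \<zeta>) (R (\<xi> \<otimes>\<^sub>v \<eta>))) \<le> norm (\<xi> \<otimes>\<^sub>v \<zeta>) * (norm R * norm (\<xi> \<otimes>\<^sub>v \<eta>))"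
        by (rule order_trans[OF cmod_cinner_le mult_left_mono[OF norm_blinfun]]) simp
      also have "\<dots> \<le> norm ?T * norm \<zeta> * norm \<eta>"
        using normR by (simp add: norm_tensor_ell2 \<xi>(1) mult_left_mono mult_right_mono ac_simps)
      finally show ?thesis
        by simp
    qed
    note bd = this
    show "cmod (cinner \<zeta> (?P \<eta>)) \<le> norm ?T * norm \<zeta> * norm \<eta>"
    proof (rule field_le_epsilon)
      fix e :: real
      assume "0 < e"
      then have "e / (M + 1) * M \<le> e"
        using \<open>0 \<le> M\<close> by (simp add: field_simps)
      then show "cmod (cinner \<zeta> (?P \<eta>)) \<le> norm ?T * norm \<zeta> * norm \<eta> + e"
        using bd[of "e / (M + 1)"] \<open>0 < e\<close> \<open>0 \<le> M\<close> by simp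
    qed
  qed simp
qed

text \<open>The source of all concrete maps: the action on cosets yields the states of subgroups,
  the action on another group through a homomorphism yields
  \<open>group_cstar_functorial\<close>.\<close>

theorem perm_representation:
  fixes G :: "('g, 'b) monoid_scheme" and X :: "'x set"
  assumes acts: "group_acts G X \<alpha>" and aiv: "almost_invariant_vectors G"
  obtains \<rho> where "bounded_clinear_on (group_cstar G) \<rho>"
    "\<And>g. g \<in> carrier G \<Longrightarrow> \<rho> (left_translation G g) = perm_op G X \<alpha> g"
    "\<And>a. a \<in> group_cstar G \<Longrightarrow> clinear_op (\<rho> a)"
    "\<And>a b. a \<in> group_cstar G \<Longrightarrow> b \<in> group_cstar G \<Longrightarrow> \<rho> (a o\<^sub>L b) = \<rho> a o\<^sub>L \<rho> b"
    "\<And>a. a \<in> group_cstar G \<Longrightarrow> \<rho> (adj a) = adj (\<rho> a)"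
proof -
  have grp: "group G"
    using acts by (simp add: group_acts_def)
  interpret group G by fact
  obtain \<rho> where \<rho>': "bounded_clinear_on (cspace (left_translation G ` carrier G)) \<rho>"
    and gen: "\<And>g. g \<in> carrier G \<Longrightarrow> \<rho> (left_translation G g) = perm_op G X \<alpha> g"
  proof (rule bounded_clinear_extension[of "carrier G" "perm_op G X \<alpha>" 1 "left_translation G"])
    show "norm (\<Sum>g\<in>F. c g *\<^sub>C perm_op G X \<alpha> g) \<le> 1 * norm (\<Sum>g\<in>F. c g *\<^sub>C left_translation G g)"
      if "finite F" "F \<subseteq> carrier G" for F c
      using norm_sum_perm_op_le[OF acts aiv that] by simp
  qed (rule that)
  note \<rho> = \<rho>'[folded group_cstar_eq(1)[OF grp]] gen
  note gens = gen clinear_op_perm_op[OF acts] perm_op_mult[OF acts] perm_op_adj[OF acts]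
  show ?thesis
  proof (rule that[OF \<rho>])
    fix a
    assume a: "a \<in> group_cstar G"
    show "clinear_op (\<rho> a)"
      by (rule group_cstar_star_hom(1)[OF grp \<rho>(1) _ _ _ a]) (simp_all add: gens)
    show "\<rho> (adj a) = adj (\<rho> a)"
      by (rule group_cstar_star_hom(3)[OF grp \<rho>(1) _ _ _ a]) (simp_all add: gens)
    show "\<rho> (a o\<^sub>L b) = \<rho> a o\<^sub>L \<rho> b" if "b \<in> group_cstar G" for b
      by (rule group_cstar_star_hom(2)[OF grp \<rho>(1) _ _ _ a that]) (simp_all add: gens)
  qed
qed

text \<open>G acts on K by left translation through \<theta>, and the operators of this permutation
  action are translations of K, so the extended representation has its range in the algebra of
  K.\<close>

theorem group_cstar_functorial:
  assumes "group G" "group K" "almost_invariant_vectors G" "\<theta> \<in> hom G K"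
  obtains J where "unital_star_hom (group_cstar G) (group_cstar K) J" "bounded_clinear_on (group_cstar G) J"
    "\<And>g. g \<in> carrier G \<Longrightarrow> J (left_translation G g) = left_translation K (\<theta> g)"
proof -
  obtain J where J: "bounded_clinear_on (group_cstar G) J"
    "\<And>g. g \<in> carrier G \<Longrightarrow> J (left_translation G g) = left_translation K (\<theta> g)"
    "\<And>a b. a \<in> group_cstar G \<Longrightarrow> b \<in> group_cstar G \<Longrightarrow> J (a o\<^sub>L b) = J a o\<^sub>L J b"
    "\<And>a. a \<in> group_cstar G \<Longrightarrow> J (adj a) = adj (J a)"
    using perm_representation[OF group_acts_hom[OF assms(1,2,4)] assms(3)] left_translation_hom[OF assms(1,2,4)]
    by metis
  have "J a \<in> group_cstar K" if "a \<in> group_cstar G" for a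
    using J(2) hom_in_carrier[OF assms(4)]
    by (intro group_cstar_preimage[OF assms(1) J(1) subspace_group_cstar[OF assms(2)]
      closed_group_cstar[OF assms(2)] _ that])
      (simp add: left_translation_in_group_cstar[OF assms(2)])
  moreover have "J (unit_of (group_cstar G)) = unit_of (group_cstar K)"
    using assms by (simp add: unit_of_group_cstar J(2) group.is_monoid monoid.one_closed hom_one)
  moreover have "J (a + b) = J a + J b" "J (c *\<^sub>C a) = c *\<^sub>C J a" if "a \<in> group_cstar G" "b \<in> group_cstar G"
    for a b c
    using bounded_clinear_on_linear[OF J(1) that subspace_group_cstar[OF assms(1)]] by auto
  ultimately have "unital_star_hom (group_cstar G) (group_cstar K) J"
    unfolding unital_star_hom_def using J(3,4) by (simp add: image_subset_iff)
  then show ?thesis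
    using that J(1,2) by blast
qed

theorem subgroup_state:
  fixes G :: "('g, 'b) monoid_scheme"
  assumes "group G" "almost_invariant_vectors G" "subgroup H G"
  obtains \<phi> where "state (group_cstar G) \<phi>" "\<And>g. g \<in> carrier G \<Longrightarrow> \<phi> (left_translation G g) = of_bool (g \<in> H)"
proof -
  interpret group G by fact
  interpret H: subgroup H G by fact
  define X where "X = (\<lambda>g. g <#\<^bsub>G\<^esub> H) ` carrier G"
  have XG: "C \<subseteq> carrier G" if "C \<in> X" for C
    using that l_coset_subset_G[OF H.subset] by (auto simp: X_def)
  have acts: "group_acts G X (l_coset G)"
    using assms(1) XG by (auto simp: group_acts_def lcos_mult_one lcos_m_assoc)
      (auto simp: X_def lcos_m_assoc H.subset)
  have HX: "H \<in> X"
    unfolding X_def using lcos_mult_one[OF H.subset] by force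
  have fix_iff: "g <#\<^bsub>G\<^esub> H = H \<longleftrightarrow> g \<in> H" if "g \<in> carrier G" for g
  proof
    assume "g <#\<^bsub>G\<^esub> H = H"
    then show "g \<in> H"
      using that H.one_closed unfolding l_coset_def by force
  next
    assume "g \<in> H"
    then show "g <#\<^bsub>G\<^esub> H = H"
      using l_repr_independence[of g "\<one>\<^bsub>G\<^esub>" H] assms(3) by (simp add: lcos_mult_one[OF H.subset])
  qed
  obtain \<rho> where \<rho>: "bounded_clinear_on (group_cstar G) \<rho>"
    "\<And>g. g \<in> carrier G \<Longrightarrow> \<rho> (left_translation G g) = perm_op G X (l_coset G) g"
    "\<And>a. a \<in> group_cstar G \<Longrightarrow> clinear_op (\<rho> a)"
    "\<And>a b. a \<in> group_cstar G \<Longrightarrow> b \<in> group_cstar G \<Longrightarrow> \<rho> (a o\<^sub>L b) = \<rho> a o\<^sub>L \<rho> b"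
    "\<And>a. a \<in> group_cstar G \<Longrightarrow> \<rho> (adj a) = adj (\<rho> a)"
    by (rule perm_representation[OF acts assms(2)]) (rule that)
  define \<phi> where "\<phi> = restrict (\<lambda>a. cinner (ket H) (\<rho> a (ket H))) (group_cstar G)"
  have gen: "\<phi> (left_translation G g) = of_bool (g \<in> H)" if "g \<in> carrier G" for g
  proof -
    have "\<rho> (left_translation G g) (ket H) = ket (g <#\<^bsub>G\<^esub> H)"
      using that HX by (simp add: \<rho>(2) perm_op_ket[OF acts])
    then show ?thesis
      using that fix_iff[OF that, symmetric] by (simp add: \<phi>_def left_translation_in_group_cstar[OF assms(1)]
          cinner_ket Rep_ell2_ket eq_commute[of H])
  qed
  have "bounded_clinear_on (group_cstar G) (\<lambda>a. cinner (ket H) (\<rho> a (ket H)))"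
    by (rule bounded_clinear_on_compose[OF \<rho>(1) bounded_clinear_on_cinner subset_UNIV])
  then have "bounded_clinear_on (group_cstar G) \<phi>"
    by (rule bounded_clinear_on_cong) (simp_all add: \<phi>_def subspace_group_cstar[OF assms(1)])
  moreover have "\<phi> (adj a o\<^sub>L a) \<in> \<real>\<^sub>\<ge>\<^sub>0" if "a \<in> group_cstar G" for a
  proof -
    have "\<phi> (adj a o\<^sub>L a) = of_real ((norm (\<rho> a (ket H)))\<^sup>2)"
      using that by (simp add: \<phi>_def group_cstar_compose[OF assms(1)] group_cstar_adj[OF assms(1)] \<rho>(3-5)
          cinner_adj_compose del: of_real_power)
    then show ?thesis
      by (simp del: of_real_power)
  qed
  moreover have "\<phi> (unit_of (group_cstar G)) = 1"
    by (simp add: unit_of_group_cstar[OF assms(1)] gen)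
  ultimately have "state (group_cstar G) \<phi>"
    by (simp add: state_def \<phi>_def)
  then show ?thesis
    using that gen by blast
qed

text \<open>The coproduct is fixed by a choice that promises continuity, not a bound. Scaling a
  vector to norm d / 2, inside the ball where continuity at 0 keeps the values below 1, supplies one
  with constant 2 / d.\<close>

lemma continuous_linear_bounded_clinear_on:
  assumes V: "complex_vector.subspace V" and L: "continuous_on V L"
    "\<And>x y. x \<in> V \<Longrightarrow> y \<in> V \<Longrightarrow> L (x + y) = L x + L y" "\<And>c x. x \<in> V \<Longrightarrow> L (c *\<^sub>C x) = c *\<^sub>C L x"
  shows "bounded_clinear_on V L"
proof -
  have 0: "0 \<in> V"
    by (rule complex_vector.subspace_0[OF V])
  have "L 0 = 0"
    using L(3)[OF 0, of 0] by simp
  then obtain d where d: "0 < d" "\<And>x. x \<in> V \<Longrightarrow> norm x < d \<Longrightarrow> norm (L x) < 1"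
    using L(1) 0 unfolding continuous_on_iff by (metis dist_0_norm dist_commute zero_less_one)
  have "norm (L x) \<le> 2 / d * norm x" if "x \<in> V" for x
  proof (cases "x = 0")
    case False
    define r where "r = d / (2 * norm x)"
    have "0 < r"
      using False d(1) by (simp add: r_def)
    have "norm (complex_of_real r *\<^sub>C x) = r * norm x"
      using \<open>0 < r\<close> by (simp add: norm_scaleC)
    also have "\<dots> < d"
      using False d(1) by (simp add: r_def)
    finally have "norm (complex_of_real r *\<^sub>C x) < d" .
    then have "norm (L (complex_of_real r *\<^sub>C x)) < 1"
      by (intro d(2) complex_vector.subspace_scale[OF V] that)
    then have "r * norm (L x) < 1"
      using \<open>0 < r\<close> by (simp add: L(3)[OF that] norm_scaleC)
    then have "norm (L x) \<le> 1 / r"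
      using \<open>0 < r\<close> by (simp add: field_simps)
    then show ?thesis
      by (simp add: r_def)
  qed (simp add: \<open>L 0 = 0\<close>)
  then show ?thesis
    by (intro bounded_clinear_onI L(2,3))
qed

text \<open>Functoriality for the diagonal homomorphism shows that the choice in the definition is
  not void; afterwards only the chosen properties are used.\<close>

theorem dual_coproduct:
  assumes "group G" "almost_invariant_vectors G"
  shows "unital_star_hom (group_cstar G) (group_cstar G \<otimes>\<^sub>A group_cstar G) (dual_coproduct G)"
    and "bounded_clinear_on (group_cstar G) (dual_coproduct G)"
    and "g \<in> carrier G \<Longrightarrow>
      dual_coproduct G (left_translation G g) = left_translation G g \<otimes>\<^sub>o left_translation G g"
proof -
  have "(\<lambda>g. (g, g)) \<in> hom G (G \<times>\<times> G)"
    using assms(1) by (auto simp: hom_def)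
  from this obtain J where "unital_star_hom (group_cstar G) (group_cstar (G \<times>\<times> G)) J"
    "bounded_clinear_on (group_cstar G) J"
    "\<And>g. g \<in> carrier G \<Longrightarrow> J (left_translation G g) = left_translation (G \<times>\<times> G) (g, g)"
    by (rule group_cstar_functorial[OF assms(1) DirProd_group[OF assms(1,1)] assms(2)]) (rule that)
  then have "\<exists>\<Delta>. unital_star_hom (group_cstar G) (group_cstar G \<otimes>\<^sub>A group_cstar G) \<Delta> \<and>
    continuous_on (group_cstar G) \<Delta> \<and>
    (\<forall>g\<in>carrier G. \<Delta> (left_translation G g) = left_translation G g \<otimes>\<^sub>o left_translation G g)"
    using bounded_clinear_on_continuous[OF _ subspace_group_cstar[OF assms(1)]]
    by (intro exI[of _ J]) (auto simp: group_cstar_tensor[OF assms(1,1)] left_translation_prod[OF assms(1,1)])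
  from someI_ex[OF this] have \<Delta>:
    "unital_star_hom (group_cstar G) (group_cstar G \<otimes>\<^sub>A group_cstar G) (dual_coproduct G)"
    "continuous_on (group_cstar G) (dual_coproduct G)"
    "\<forall>g\<in>carrier G. dual_coproduct G (left_translation G g) = left_translation G g \<otimes>\<^sub>o left_translation G g"
    unfolding dual_coproduct_def by blast+
  show "unital_star_hom (group_cstar G) (group_cstar G \<otimes>\<^sub>A group_cstar G) (dual_coproduct G)"
    by (rule \<Delta>(1))
  show "bounded_clinear_on (group_cstar G) (dual_coproduct G)"
    using \<Delta>(1) by (intro continuous_linear_bounded_clinear_on subspace_group_cstar[OF assms(1)] \<Delta>(2))
      (auto simp: unital_star_hom_def)
  show "dual_coproduct G (left_translation G g) = left_translation G g \<otimes>\<^sub>o left_translation G g"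
    if "g \<in> carrier G"
    using \<Delta>(3) that by blast
qed

section \<open>The compact quantum group of a discrete group\<close>

text \<open>The tensor product of the homomorphisms is realized by functoriality for the product of
  the underlying group homomorphisms. The maps \<open>j\<close> and \<open>k\<close> are parameters
  because one of them may be the chosen coproduct.\<close>

lemma group_cstar_functorial_tensor:
  assumes grp: "group G" "group K" "group G'" "group K'" and aiv: "almost_invariant_vectors (G \<times>\<times> K)"
    and \<theta>: "\<theta> \<in> hom G G'" "\<eta> \<in> hom K K'"
    and j: "bounded_clinear_on (group_cstar G) j" "j ` group_cstar G \<subseteq> group_cstar G'"
      "\<And>g. g \<in> carrier G \<Longrightarrow> j (left_translation G g) = left_translation G' (\<theta> g)"
    and k: "bounded_clinear_on (group_cstar K) k" "k ` group_cstar K \<subseteq> group_cstar K'"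
      "\<And>g. g \<in> carrier K \<Longrightarrow> k (left_translation K g) = left_translation K' (\<eta> g)"
  obtains J where "tensor_hom (group_cstar G) (group_cstar K) (group_cstar G') (group_cstar K') j k J"
    "bounded_clinear_on (group_cstar (G \<times>\<times> K)) J"
proof -
  have "(\<lambda>(g, h). (\<theta> g, \<eta> h)) \<in> hom (G \<times>\<times> K) (G' \<times>\<times> K')"
    using \<theta> by (auto simp: hom_def)
  from group_cstar_functorial[OF DirProd_group[OF grp(1,2)] DirProd_group[OF grp(3,4)] aiv this]
  obtain J where J: "unital_star_hom (group_cstar (G \<times>\<times> K)) (group_cstar (G' \<times>\<times> K')) J"
    "bounded_clinear_on (group_cstar (G \<times>\<times> K)) J"
    "\<And>z. z \<in> carrier (G \<times>\<times> K) \<Longrightarrow>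
      J (left_translation (G \<times>\<times> K) z) = left_translation (G' \<times>\<times> K') (case z of (g, h) \<Rightarrow> (\<theta> g, \<eta> h))"
    by blast
  have "J (a \<otimes>\<^sub>o b) = j a \<otimes>\<^sub>o k b" if "a \<in> group_cstar G" "b \<in> group_cstar K" for a b
  proof (rule tensor_values_from_generators[OF grp(1,2) J(2) j(1) _ k(1) _ _ that])
    show "j ` group_cstar G \<subseteq> complex_ops" "k ` group_cstar K \<subseteq> complex_ops"
      using j(2) k(2) group_cstar_clinear[OF grp(3)] group_cstar_clinear[OF grp(4)]
      by (auto simp: complex_ops_iff image_subset_iff)
    show "J (left_translation (G \<times>\<times> K) (g, h)) = j (left_translation G g) \<otimes>\<^sub>o k (left_translation K h)"
      if "g \<in> carrier G" "h \<in> carrier K" for g h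
      using that hom_in_carrier[OF \<theta>(1)] hom_in_carrier[OF \<theta>(2)]
      by (simp add: J(3) j(3) k(3) left_translation_prod[OF grp(3,4)])
  qed
  then show ?thesis
    using that[of J] J unfolding tensor_hom_def
    by (simp add: group_cstar_tensor[OF grp(1,2)] group_cstar_tensor[OF grp(3,4)])
qed

lemma bounded_clinear_on_id: "bounded_clinear_on V id"
  by (rule bounded_clinear_onI[where K = 1]) simp_all

lemma bounded_clinear_on_scaleC_left: "bounded_clinear_on V (\<lambda>c :: complex. c *\<^sub>C u)"
  by (rule bounded_clinear_onI[where K = "norm u"])
    (simp_all add: scaleC_add_left scaleC_scaleC scaleC_complex_def norm_scaleC mult.commute)

lemma clinear_op_reassoc:
  "clinear_op (pullback UNIV (\<lambda>(x, (y, z)). ((x, y), z)))"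
    "clinear_op (pullback UNIV (\<lambda>((x, y), z). (x, (y, z))))"
  by (intro clinear_op_pullback; auto simp: inj_on_def)+

lemma assoc_op_left_translation:
  assumes "group G" "a \<in> carrier G" "b \<in> carrier G" "c \<in> carrier G"
  shows "assoc_op (left_translation ((G \<times>\<times> G) \<times>\<times> G) ((a, b), c)) = left_translation (G \<times>\<times> (G \<times>\<times> G)) (a, (b, c))"
    (is "_ = ?R")
proof -
  note GG = DirProd_group[OF assms(1,1)]
  note grp = DirProd_group[OF GG assms(1)] DirProd_group[OF assms(1) GG]
  have inj: "inj (\<lambda>(x, (y, z)). ((x, y), z))" "inj (\<lambda>((x, y), z). (x, (y, z)))"
    by (auto simp: inj_on_def)
  have ket: "pullback UNIV (\<lambda>(x, (y, z)). ((x, y), z)) (ket ((x, y), z)) = ket (x, (y, z))"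
    "pullback UNIV (\<lambda>((x, y), z). (x, (y, z))) (ket (x, (y, z))) = ket ((x, y), z)" for x y z
    by (rule pullback_ket; auto simp: inj)+
  have mem: "((a, b), c) \<in> carrier ((G \<times>\<times> G) \<times>\<times> G)" "(a, (b, c)) \<in> carrier (G \<times>\<times> (G \<times>\<times> G))"
    using assms by auto
  show ?thesis
  proof (rule clinear_op_eqI)
    show "assoc_op (left_translation ((G \<times>\<times> G) \<times>\<times> G) ((a, b), c)) (ket w) = ?R (ket w)" for w
      by (cases w) (auto simp: assoc_op_def ket left_translation_ket[OF grp(1) mem(1)]
        left_translation_ket[OF grp(2) mem(2)])
  qed (use mem in \<open>auto simp: assoc_op_def intro!: clinear_op_compose clinear_op_reassoc
      clinear_op_left_translation[OF grp(1)] clinear_op_left_translation[OF grp(2)]\<close>)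
qed

section \<open>The canonical trace\<close>

definition canonical_trace :: "('g, 'b) monoid_scheme \<Rightarrow> 'g op \<Rightarrow> complex"
  where "canonical_trace G = restrict (\<lambda>a :: 'g op. cinner (ket \<one>\<^bsub>G\<^esub>) (a (ket \<one>\<^bsub>G\<^esub>))) (group_cstar G)"

context
  fixes G :: "('g, 'b) monoid_scheme"
  assumes grp: "group G"
begin

interpretation group G by (rule grp)

lemma tensor_mem_group_cstar: "a \<in> group_cstar G \<Longrightarrow> b \<in> group_cstar G \<Longrightarrow> a \<otimes>\<^sub>o b \<in> group_cstar (G \<times>\<times> G)"
  unfolding group_cstar_tensor[OF grp grp, symmetric] spatial_tensor_def cspace_def[symmetric]
  by (intro cspace_base) blast

text \<open>Serves both density conditions: it is enough that the products in question include all
  translations of the product group.\<close>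

lemma closure_span_eq_group_cstar_prod:
  assumes "S \<subseteq> group_cstar (G \<times>\<times> G)"
    "\<And>g h. g \<in> carrier G \<Longrightarrow> h \<in> carrier G \<Longrightarrow> left_translation (G \<times>\<times> G) (g, h) \<in> S"
  shows "closure (cspan S) = group_cstar G \<otimes>\<^sub>A group_cstar G"
proof -
  note GG = DirProd_group[OF grp grp]
  have "cspace S \<subseteq> group_cstar (G \<times>\<times> G)"
    by (rule cspace_minimal[OF assms(1) subspace_group_cstar[OF GG] closed_group_cstar[OF GG]])
  moreover have "group_cstar (G \<times>\<times> G) \<subseteq> cspace S"
    unfolding group_cstar_eq(1)[OF GG]
    by (rule cspace_minimal[OF _ subspace_cspace closed_cspace]) (auto intro!: cspace_base assms(2))
  ultimately show ?thesis
    by (auto simp: group_cstar_tensor[OF grp grp] cspace_def)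
qed

lemma canonical_trace_bounded: "bounded_clinear_on (group_cstar G) (canonical_trace G)"
  by (rule bounded_clinear_on_cong[OF bounded_clinear_on_cinner])
    (simp_all add: canonical_trace_def subspace_group_cstar[OF grp])

lemma canonical_trace_generator: "g \<in> carrier G \<Longrightarrow> canonical_trace G (left_translation G g) = of_bool (g = \<one>\<^bsub>G\<^esub>)"
  by (auto simp: canonical_trace_def left_translation_in_group_cstar[OF grp] left_translation_ket[OF grp]
      cinner_ket Rep_ell2_ket)

lemma canonical_trace_adj_compose:
  assumes "a \<in> group_cstar G"
  shows "canonical_trace G (adj a o\<^sub>L a) = of_real ((norm (a (ket \<one>\<^bsub>G\<^esub>)))\<^sup>2)"
  using assms by (simp add: canonical_trace_def group_cstar_compose[OF grp] group_cstar_adj[OF grp]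
      group_cstar_clinear[OF grp] cinner_adj_compose del: of_real_power)

lemma state_canonical_trace: "state (group_cstar G) (canonical_trace G)"
  unfolding state_def
proof (intro conjI ballI)
  show "canonical_trace G \<in> extensional (group_cstar G)"
    by (simp add: canonical_trace_def)
  show "canonical_trace G (adj a o\<^sub>L a) \<in> \<real>\<^sub>\<ge>\<^sub>0" if "a \<in> group_cstar G" for a
    using that by (simp add: canonical_trace_adj_compose del: of_real_power)
  show "canonical_trace G (unit_of (group_cstar G)) = 1"
    by (simp add: unit_of_group_cstar[OF grp] canonical_trace_generator)
qed (rule canonical_trace_bounded)

text \<open>Elements of the group algebra commute with right translations, so they are determined by their
  values at \<^term>\<open>ket \<one>\<^bsub>G\<^esub>\<close>.\<close>

lemma faithful_canonical_trace: "faithful (group_cstar G) (canonical_trace G)"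
  unfolding faithful_def
proof (intro ballI impI)
  fix a
  assume a: "a \<in> group_cstar G" and "canonical_trace G (adj a o\<^sub>L a) = 0"
  then have zero: "a (ket \<one>\<^bsub>G\<^esub>) = 0"
    by (simp add: canonical_trace_adj_compose)
  \<comment> \<open>Commutation with right translations in terms of matrix entries: entry (y, x) of
    \<open>a\<close> is its entry at y times the inverse of x and the neutral element.\<close>
  have "cinner (ket y) (a (ket x)) = cinner (ket (y \<otimes>\<^bsub>G\<^esub> inv\<^bsub>G\<^esub> x)) (a (ket \<one>\<^bsub>G\<^esub>))"
    if "x \<in> carrier G" "y \<in> carrier G" for x y
  proof (rule group_cstar_eqI[OF grp bounded_clinear_on_cinner bounded_clinear_on_cinner _ a])
    fix g
    assume g: "g \<in> carrier G"
    then have "y = g \<otimes>\<^bsub>G\<^esub> x \<longleftrightarrow> y \<otimes>\<^bsub>G\<^esub> inv\<^bsub>G\<^esub> x = g"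
      using that inv_solve_right'[of g y x] by auto
    then show "cinner (ket y) (left_translation G g (ket x))
        = cinner (ket (y \<otimes>\<^bsub>G\<^esub> inv\<^bsub>G\<^esub> x)) (left_translation G g (ket \<one>\<^bsub>G\<^esub>))"
      using g that by (simp add: left_translation_ket[OF grp] cinner_ket Rep_ell2_ket)
  qed
  moreover have "cinner (ket y) (a (ket x)) = 0" if "x \<notin> carrier G \<or> y \<notin> carrier G" for x y
  proof -
    have "cinner (ket y) (a (ket x)) \<in> {0}"
      by (rule group_cstar_preimage[OF grp bounded_clinear_on_cinner _ _ _ a])
        (use that in \<open>auto simp: left_translation_ket[OF grp] cinner_ket Rep_ell2_ket zero_ell2.rep_eq\<close>)
    then show ?thesis
      by simp
  qed
  ultimately have "cinner (ket y) (a (ket x)) = 0" for x y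
    using zero by (cases "x \<in> carrier G \<and> y \<in> carrier G") auto
  then show "a = 0"
    by (intro clinear_op_eqI ell2_eqI)
      (simp_all add: group_cstar_clinear[OF grp a] clinear_op_zero cinner_ket zero_ell2.rep_eq)
qed

end

section \<open>The axioms for the dual compact quantum group\<close>

context
  fixes G :: "('g, 'b) monoid_scheme"
  assumes grp: "group G" and aiv: "almost_invariant_vectors G"
begin

interpretation group G by (rule grp)

lemma dual_coproduct_range: "a \<in> group_cstar G \<Longrightarrow> dual_coproduct G a \<in> group_cstar (G \<times>\<times> G)"
  using dual_coproduct(1)[OF grp aiv] unfolding unital_star_hom_def group_cstar_tensor[OF grp grp]
  by blast

lemma dual_coproduct_generator: "g \<in> carrier G \<Longrightarrow> dual_coproduct G (left_translation G g)
  = left_translation (G \<times>\<times> G) (g, g)"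
  by (simp add: dual_coproduct(3)[OF grp aiv] left_translation_prod[OF grp grp])

lemma dual_coproduct_coassociative: "coassociative (group_cstar G) (dual_coproduct G)"
proof -
  note GG = DirProd_group[OF grp grp]
  note aiv2 = almost_invariant_vectors_prod[OF grp grp aiv aiv]
  have diag: "(\<lambda>g. (g, g)) \<in> hom G (G \<times>\<times> G)" "(\<lambda>g. g) \<in> hom G G"
    by (auto simp: hom_def)
  have \<Delta>: "bounded_clinear_on (group_cstar G) (dual_coproduct G)"
    "dual_coproduct G ` group_cstar G \<subseteq> group_cstar (G \<times>\<times> G)"
    using dual_coproduct(2)[OF grp aiv] dual_coproduct_range by auto
  obtain L where L: "tensor_hom (group_cstar G) (group_cstar G) (group_cstar (G \<times>\<times> G)) (group_cstar G)
    (dual_coproduct G) id L"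
    "bounded_clinear_on (group_cstar (G \<times>\<times> G)) L"
    by (rule group_cstar_functorial_tensor[OF grp grp GG grp aiv2 diag \<Delta> _ bounded_clinear_on_id])
      (use dual_coproduct_generator in auto)
  obtain R where R: "tensor_hom (group_cstar G) (group_cstar G) (group_cstar G) (group_cstar (G \<times>\<times> G)) id
    (dual_coproduct G) R"
    "bounded_clinear_on (group_cstar (G \<times>\<times> G)) R"
    by (rule group_cstar_functorial_tensor[OF grp grp grp GG aiv2 diag(2,1) bounded_clinear_on_id _ _ \<Delta>])
      (use dual_coproduct_generator in auto)
  \<comment> \<open>On translations both sides are translation by the triple (g, g, g), up to the
    bracketing that \<open>assoc_op\<close> changes.\<close>
  have "assoc_op (L (dual_coproduct G a)) = R (dual_coproduct G a)" if "a \<in> group_cstar G" for a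
  proof (rule group_cstar_eqI[OF grp _ _ _ that])
    have "bounded_clinear_on (L ` dual_coproduct G ` group_cstar G) assoc_op"
      unfolding assoc_op_def
      by (rule bounded_clinear_on_compose[OF bounded_clinear_on_compose_right
        bounded_clinear_on_compose_left subset_UNIV])
        (rule clinear_op_reassoc)
    then show "bounded_clinear_on (group_cstar G) (\<lambda>a. assoc_op (L (dual_coproduct G a)))"
      by (rule bounded_clinear_on_compose[OF bounded_clinear_on_compose[OF \<Delta>(1) L(2) \<Delta>(2)]]) auto
    show "bounded_clinear_on (group_cstar G) (\<lambda>a. R (dual_coproduct G a))"
      by (rule bounded_clinear_on_compose[OF \<Delta>(1) R(2) \<Delta>(2)])
    fix g
    assume g: "g \<in> carrier G"
    note in_A = left_translation_in_group_cstar[OF grp g]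
    have "L (dual_coproduct G (left_translation G g))
      = dual_coproduct G (left_translation G g) \<otimes>\<^sub>o left_translation G g"
      "R (dual_coproduct G (left_translation G g))
        = left_translation G g \<otimes>\<^sub>o dual_coproduct G (left_translation G g)"
      using L(1) R(1) g in_A unfolding tensor_hom_def by (simp_all add: dual_coproduct(3)[OF grp aiv])
    then have "L (dual_coproduct G (left_translation G g)) = left_translation ((G \<times>\<times> G) \<times>\<times> G) ((g, g), g)"
      "R (dual_coproduct G (left_translation G g)) = left_translation (G \<times>\<times> (G \<times>\<times> G)) (g, (g, g))"
      using g by (simp_all add: dual_coproduct_generator left_translation_prod[OF GG grp]
        left_translation_prod[OF grp GG])
    then show "assoc_op (L (dual_coproduct G (left_translation G g)))
      = R (dual_coproduct G (left_translation G g))"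
      using g by (simp add: assoc_op_left_translation[OF grp])
  qed
  then show ?thesis
    unfolding coassociative_def group_cstar_tensor[OF grp grp] using L(1) R(1) by blast
qed

theorem compact_quantum_group_dual: "compact_quantum_group (group_cstar G) (dual_coproduct G)"
proof -
  let ?A = "group_cstar G" and ?\<Delta> = "dual_coproduct G"
  note GG = DirProd_group[OF grp grp]
  have unit: "unit_of (group_cstar G) = left_translation G \<one>\<^bsub>G\<^esub>" "unit_of (group_cstar G) \<in> group_cstar G"
    using unit_of_group_cstar[OF grp] left_translation_in_group_cstar[OF grp] by auto
  \<comment> \<open>The factorizations (g, h) = (1, h inv g) (g, g) and (g, h) = (g inv h, 1) (h, h)
    put every translation of the product group into the generating sets.\<close>
  have gen: "left_translation (G \<times>\<times> G) (g, h) = (left_translation G \<one>\<^bsub>G\<^esub> \<otimes>\<^sub>o left_translation G (h \<otimes>\<^bsub>G\<^esub> inv\<^bsub>G\<^esub> g))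
        o\<^sub>L dual_coproduct G (left_translation G g)"
    "left_translation (G \<times>\<times> G) (g, h) = (left_translation G (g \<otimes>\<^bsub>G\<^esub> inv\<^bsub>G\<^esub> h) \<otimes>\<^sub>o left_translation G \<one>\<^bsub>G\<^esub>)
        o\<^sub>L dual_coproduct G (left_translation G h)" if "g \<in> carrier G" "h \<in> carrier G" for g h
    using that by (simp_all add: dual_coproduct_generator left_translation_prod[OF grp grp]
        left_translation_mult[OF GG] m_assoc)
  have "closure (cspan {(unit_of ?A \<otimes>\<^sub>o a) o\<^sub>L ?\<Delta> b |a b. a \<in> ?A \<and> b \<in> ?A}) = ?A \<otimes>\<^sub>A ?A"
  proof (rule closure_span_eq_group_cstar_prod[OF grp])
    show "left_translation (G \<times>\<times> G) (g, h) \<in> {(unit_of ?A \<otimes>\<^sub>o a) o\<^sub>L ?\<Delta> b |a b. a \<in> ?A \<and> b \<in> ?A}"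
      if "g \<in> carrier G" "h \<in> carrier G" for g h
      using gen(1)[OF that] that left_translation_in_group_cstar[OF grp] unfolding unit(1)
      by (metis (mono_tags, lifting) inv_closed m_closed mem_Collect_eq)
  qed (auto intro!: group_cstar_compose[OF GG] tensor_mem_group_cstar[OF grp] dual_coproduct_range unit(2))
  moreover have "closure (cspan {(a \<otimes>\<^sub>o unit_of ?A) o\<^sub>L ?\<Delta> b |a b. a \<in> ?A \<and> b \<in> ?A}) = ?A \<otimes>\<^sub>A ?A"
  proof (rule closure_span_eq_group_cstar_prod[OF grp])
    show "left_translation (G \<times>\<times> G) (g, h) \<in> {(a \<otimes>\<^sub>o unit_of ?A) o\<^sub>L ?\<Delta> b |a b. a \<in> ?A \<and> b \<in> ?A}"
      if "g \<in> carrier G" "h \<in> carrier G" for g h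
      using gen(2)[OF that] that left_translation_in_group_cstar[OF grp] unfolding unit(1)
      by (metis (mono_tags, lifting) inv_closed m_closed mem_Collect_eq)
  qed (auto intro!: group_cstar_compose[OF GG] tensor_mem_group_cstar[OF grp] dual_coproduct_range unit(2))
  ultimately show ?thesis
    unfolding compact_quantum_group_def
    using unital_cstar_algebra_group_cstar[OF grp] dual_coproduct(1)[OF grp aiv] dual_coproduct_coassociative
    by blast
qed

text \<open>The coefficient vanishes unless g is the neutral element, where the translation is the
  unit. Left and right slices share the argument.\<close>

lemma coproduct_slice_eq:
  assumes L: "bounded_clinear_on (group_cstar (G \<times>\<times> G)) L"
    and val: "\<And>g. g \<in> carrier G \<Longrightarrow>
      L (left_translation G g \<otimes>\<^sub>o left_translation G g)
        = canonical_trace G (left_translation G g) *\<^sub>C left_translation G g"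
    and a: "a \<in> group_cstar G"
  shows "L (dual_coproduct G a) = canonical_trace G a *\<^sub>C unit_of (group_cstar G)"
proof (rule group_cstar_eqI[OF grp _ _ _ a])
  show "bounded_clinear_on (group_cstar G) (\<lambda>a. L (dual_coproduct G a))"
    using dual_coproduct_range by (intro bounded_clinear_on_compose[OF dual_coproduct(2)[OF grp aiv] L]) auto
  show "bounded_clinear_on (group_cstar G) (\<lambda>a. canonical_trace G a *\<^sub>C unit_of (group_cstar G))"
    by (rule bounded_clinear_on_compose[OF canonical_trace_bounded[OF grp]
      bounded_clinear_on_scaleC_left subset_UNIV])
  show "L (dual_coproduct G (left_translation G g))
    = canonical_trace G (left_translation G g) *\<^sub>C unit_of (group_cstar G)"
    if "g \<in> carrier G" for g
    using that by (cases "g = \<one>\<^bsub>G\<^esub>")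
      (simp_all add: dual_coproduct(3)[OF grp aiv] val canonical_trace_generator[OF grp]
        unit_of_group_cstar[OF grp])
qed

text \<open>The slice maps are compressions: \<open>V1\<close> tensors with the basis vector at the
  neutral element and \<open>W1\<close> reads off that coordinate, so the left slice sends T to
  \<open>W1 T V1\<close>; \<open>V2\<close> and \<open>W2\<close> do the same on the right.
  Boundedness is then automatic.\<close>

theorem haar_state_canonical_trace: "haar_state (group_cstar G) (dual_coproduct G) (canonical_trace G)"
proof -
  let ?e = "ket \<one>\<^bsub>G\<^esub>"
  have clin: "clinear_op a" if "a \<in> group_cstar G" for a
    using group_cstar_clinear[OF grp that] .
  have trace: "canonical_trace G a = Rep_ell2 (a ?e) \<one>\<^bsub>G\<^esub>" if "a \<in> group_cstar G" for a
    using that by (simp add: canonical_trace_def cinner_ket)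
  have inj: "inj_on snd ({\<one>\<^bsub>G\<^esub>} \<times> UNIV)" "inj_on fst (UNIV \<times> {\<one>\<^bsub>G\<^esub>})"
    "inj (\<lambda>y. (\<one>\<^bsub>G\<^esub>, y))" "inj (\<lambda>x. (x, \<one>\<^bsub>G\<^esub>))"
    by (auto simp: inj_on_def)
  define V1 :: "'g ell2 \<Rightarrow>\<^sub>L ('g \<times> 'g) ell2" where "V1 = pullback ({\<one>\<^bsub>G\<^esub>} \<times> UNIV) snd"
  define V2 :: "'g ell2 \<Rightarrow>\<^sub>L ('g \<times> 'g) ell2" where "V2 = pullback (UNIV \<times> {\<one>\<^bsub>G\<^esub>}) fst"
  define W1 :: "('g \<times> 'g) ell2 \<Rightarrow>\<^sub>L 'g ell2" where "W1 = pullback UNIV (\<lambda>y. (\<one>\<^bsub>G\<^esub>, y))"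
  define W2 :: "('g \<times> 'g) ell2 \<Rightarrow>\<^sub>L 'g ell2" where "W2 = pullback UNIV (\<lambda>x. (x, \<one>\<^bsub>G\<^esub>))"
  have V: "V1 f = ?e \<otimes>\<^sub>v f" "V2 f = f \<otimes>\<^sub>v ?e" for f
    by (auto intro!: ell2_eqI simp: V1_def V2_def pullback_apply inj tensor_ell2.rep_eq Rep_ell2_ket
      split: prod.splits)
  have W: "W1 (f \<otimes>\<^sub>v g) = Rep_ell2 f \<one>\<^bsub>G\<^esub> *\<^sub>C g" "W2 (f \<otimes>\<^sub>v g) = Rep_ell2 g \<one>\<^bsub>G\<^esub> *\<^sub>C f" for f g
    by (auto intro!: ell2_eqI simp: W1_def W2_def pullback_apply inj Rep_tensor_ell2 scaleC_ell2.rep_eq)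
  have "clinear_op W1" "clinear_op W2"
    by (simp_all add: W1_def W2_def clinear_op_pullback inj)
  then have bcl: "bounded_clinear_on S (\<lambda>T. (W1 o\<^sub>L T) o\<^sub>L V1)" "bounded_clinear_on S (\<lambda>T. (W2 o\<^sub>L T) o\<^sub>L V2)" for S
    by (auto intro!: bounded_clinear_on_compose[OF bounded_clinear_on_compose_right
      bounded_clinear_on_compose_left])
  have L: "left_slice (group_cstar G) (group_cstar G) (canonical_trace G) (\<lambda>T. (W1 o\<^sub>L T) o\<^sub>L V1)"
    unfolding left_slice_def
    by (auto intro!: bcl blinfun_eqI simp: V W tensor_op_apply clin trace)
  have R: "right_slice (group_cstar G) (group_cstar G) (canonical_trace G) (\<lambda>T. (W2 o\<^sub>L T) o\<^sub>L V2)"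
    unfolding right_slice_def
    by (auto intro!: bcl blinfun_eqI simp: V W tensor_op_apply clin trace)
  have "(W1 o\<^sub>L dual_coproduct G a) o\<^sub>L V1 = canonical_trace G a *\<^sub>C unit_of (group_cstar G)"
    "(W2 o\<^sub>L dual_coproduct G a) o\<^sub>L V2 = canonical_trace G a *\<^sub>C unit_of (group_cstar G)"
    if "a \<in> group_cstar G" for a
    using L R left_translation_in_group_cstar[OF grp] unfolding left_slice_def right_slice_def
    by (intro coproduct_slice_eq[OF _ _ that] bcl; simp)+
  then show ?thesis
    unfolding haar_state_def using state_canonical_trace[OF grp] L R by blast
qed

end

section \<open>Surjectivity of \<open>*\<close>-homomorphisms with dense range\<close>

lemma inner_adj_compose:
  fixes a :: "'x op"
  assumes "clinear_op a"
  shows "w \<bullet> adj a (a w) = (norm (a w))\<^sup>2"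
  using cinner_adj_compose[OF assms, of w] by (simp add: cinner_eq complex_eq_iff del: of_real_power)

lemma norm_combination_adj_compose:
  fixes a :: "'x op"
  assumes "clinear_op a"
  shows "(norm (p *\<^sub>R w + q *\<^sub>R adj a (a w)))\<^sup>2
    = p\<^sup>2 * (norm w)\<^sup>2 + 2 * p * q * (norm (a w))\<^sup>2 + q\<^sup>2 * (norm (adj a (a w)))\<^sup>2"
proof -
  let ?s = "adj a (a w)"
  have "(norm (p *\<^sub>R w + q *\<^sub>R ?s))\<^sup>2 = p\<^sup>2 * (w \<bullet> w) + 2 * p * q * (w \<bullet> ?s) + q\<^sup>2 * (?s \<bullet> ?s)"
    unfolding power2_norm_eq_inner
    by (simp add: inner_add_left inner_add_right inner_commute[of ?s w] algebra_simps power2_eq_square)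
  then show ?thesis
    by (simp only: inner_adj_compose[OF assms] dot_square_norm)
qed

text \<open>With \<open>s = a\<^sup>* a w\<close>, the squared norms of r^2 w + s and r^2 w - s
  differ by 4 r^2 times that of a w, which gives the first bound. For the second, the three terms of
  the expanded square dominate the squared norm of \<open>s\<close> once, twice and once, which
  makes four.\<close>

lemma norm_resolvent_ge:
  fixes a :: "'x op"
  assumes "clinear_op a" "0 \<le> r"
  shows "2 * r * norm (a w) \<le> norm (r\<^sup>2 *\<^sub>R w + adj a (a w))"
    and "norm a \<le> r \<Longrightarrow> 2 * norm (adj a (a w)) \<le> norm (r\<^sup>2 *\<^sub>R w + adj a (a w))"
proof -
  note sq = norm_combination_adj_compose[OF assms(1), of "r\<^sup>2" w]
  have "0 \<le> (norm (r\<^sup>2 *\<^sub>R w + (-1) *\<^sub>R adj a (a w)))\<^sup>2"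
    by simp
  then have "(2 * r * norm (a w))\<^sup>2 \<le> (norm (r\<^sup>2 *\<^sub>R w + adj a (a w)))\<^sup>2"
    using sq[of 1] unfolding sq[of "-1"] by (simp add: power_mult_distrib)
  then show "2 * r * norm (a w) \<le> norm (r\<^sup>2 *\<^sub>R w + adj a (a w))"
    by (rule power2_le_imp_le) simp
  assume "norm a \<le> r"
  then have s1: "norm (adj a (a w)) \<le> r * norm (a w)"
    using norm_blinfun[of "adj a" "a w"] norm_adj_le[OF assms(1)]
      by (meson mult_right_mono norm_ge_zero order_trans)
  have s2: "norm (a w) \<le> r * norm w"
    using norm_blinfun[of a w] \<open>norm a \<le> r\<close> by (meson mult_right_mono norm_ge_zero order_trans)
  have "(norm (adj a (a w)))\<^sup>2 \<le> (r * norm (a w))\<^sup>2"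
    by (intro power_mono s1) simp
  moreover have "(norm (adj a (a w)))\<^sup>2 \<le> (r\<^sup>2 * norm w)\<^sup>2"
    using order_trans[OF s1 mult_left_mono[OF s2 assms(2)]]
      by (intro power_mono) (simp_all add: power2_eq_square mult.assoc)
  ultimately have "(2 * norm (adj a (a w)))\<^sup>2 \<le> (norm (r\<^sup>2 *\<^sub>R w + adj a (a w)))\<^sup>2"
    using sq[of 1] by (simp add: power_mult_distrib)
  then show "2 * norm (adj a (a w)) \<le> norm (r\<^sup>2 *\<^sub>R w + adj a (a w))"
    by (rule power2_le_imp_le) simp
qed

text \<open>In spectral terms, \<open>(1 - c r\<^sup>2) - c a\<^sup>* a\<close> has its spectrum
  within plus or minus 1 - c r^2. Without spectral theory: the mixed term of the expanded square
  absorbs the last one, since \<open>c (norm a)\<^sup>2 \<le> 2 (1 - c r\<^sup>2)\<close>.\<close>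

lemma norm_contraction_le:
  fixes a :: "'x op"
  assumes "clinear_op a" "0 < c" "c * ((norm a)\<^sup>2 + 2 * r\<^sup>2) \<le> 1"
  shows "norm ((1 - c * r\<^sup>2) *\<^sub>R w - c *\<^sub>R adj a (a w)) \<le> (1 - c * r\<^sup>2) * norm w"
proof (rule power2_le_imp_le)
  have "0 \<le> c * (norm a)\<^sup>2" "0 \<le> c * r\<^sup>2"
    using assms(2) by simp_all
  then have le: "c * (norm a)\<^sup>2 \<le> 2 * (1 - c * r\<^sup>2)" "0 \<le> 1 - c * r\<^sup>2"
    using assms(3) by (simp_all add: algebra_simps)
  have "norm (adj a (a w)) \<le> norm a * norm (a w)"
    using norm_blinfun[of "adj a" "a w"] norm_adj_le[OF assms(1)]
      by (meson mult_right_mono norm_ge_zero order_trans)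
  then have "(norm (adj a (a w)))\<^sup>2 \<le> (norm a)\<^sup>2 * (norm (a w))\<^sup>2"
    unfolding power_mult_distrib[symmetric] by (rule power_mono) simp
  then have "c\<^sup>2 * (norm (adj a (a w)))\<^sup>2 \<le> c\<^sup>2 * ((norm a)\<^sup>2 * (norm (a w))\<^sup>2)"
    by (rule mult_left_mono) simp
  also have "\<dots> = c * (norm (a w))\<^sup>2 * (c * (norm a)\<^sup>2)"
    by (simp add: power2_eq_square)
  also have "\<dots> \<le> c * (norm (a w))\<^sup>2 * (2 * (1 - c * r\<^sup>2))"
    using assms(2) by (intro mult_left_mono le) simp
  finally have "c\<^sup>2 * (norm (adj a (a w)))\<^sup>2 \<le> 2 * (1 - c * r\<^sup>2) * c * (norm (a w))\<^sup>2"
    by (simp add: ac_simps)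
  then show "(norm ((1 - c * r\<^sup>2) *\<^sub>R w - c *\<^sub>R adj a (a w)))\<^sup>2 \<le> ((1 - c * r\<^sup>2) * norm w)\<^sup>2"
    using norm_combination_adj_compose[OF assms(1), of "1 - c * r\<^sup>2" w "- c"]
    by (simp add: power_mult_distrib)
  show "0 \<le> (1 - c * r\<^sup>2) * norm w"
    using le(2) by simp
qed

text \<open>Powers and partial sums of the Neumann series for the inverse of \<open>r\<^sup>2 e + a\<^sup>* a\<close>.\<close>

primrec neumann_power :: "'x op \<Rightarrow> 'x op \<Rightarrow> real \<Rightarrow> real \<Rightarrow> nat \<Rightarrow> 'x op"
  where "neumann_power e a c r 0 = e"
  | "neumann_power e a c r (Suc n) =
      (of_real (1 - c * r\<^sup>2) *\<^sub>C e + of_real (- c) *\<^sub>C (adj a o\<^sub>L a)) o\<^sub>L neumann_power e a c r n"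

primrec neumann_sum :: "'x op \<Rightarrow> 'x op \<Rightarrow> real \<Rightarrow> real \<Rightarrow> nat \<Rightarrow> 'x op"
  where "neumann_sum e a c r 0 = 0 *\<^sub>C e"
  | "neumann_sum e a c r (Suc n) = neumann_sum e a c r n + of_real c *\<^sub>C neumann_power e a c r n"

definition truncation :: "'x op \<Rightarrow> 'x op \<Rightarrow> real \<Rightarrow> real \<Rightarrow> nat \<Rightarrow> 'x op"
  where "truncation e a c r n = of_real (r\<^sup>2) *\<^sub>C (a o\<^sub>L neumann_sum e a c r n)"

text \<open>The unit need not be the identity operator, but it is a self-adjoint idempotent, so the
  squared norm of \<open>e f\<close> is the inner product of \<open>f\<close> with
  \<open>e f\<close>.\<close>

lemma is_unit_norm_le:
  assumes "cstar_algebra A" "is_unit A e"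
  shows "norm e \<le> 1"
proof (rule norm_blinfun_bound)
  have e: "e \<in> A" "clinear_op e"
    using assms by (auto simp: is_unit_def cstar_algebra_def complex_ops_iff subset_iff)
  have "adj e \<in> A"
    using assms e by (simp add: cstar_algebra_def)
  then have "adj e = e"
    using assms(2) adj_compose[OF clinear_op_adj[OF e(2)] e(2)] e(2) unfolding is_unit_def
    by (metis adj_adj)
  fix f
  have "of_real ((norm (e f))\<^sup>2) = cinner f (adj e (e f))"
    by (rule cinner_adj_compose[OF e(2), symmetric])
  also have "adj e (e f) = e f"
    using assms(2) e(1) unfolding \<open>adj e = e\<close> is_unit_def by (metis blinfun_apply_blinfun_compose)
  finally have "cmod (of_real ((norm (e f))\<^sup>2)) = cmod (cinner f (e f))"
    by simp
  then have "norm (e f) * norm (e f) \<le> norm f * norm (e f)"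
    using cmod_cinner_le[of f "e f"] by (simp add: power2_eq_square norm_mult)
  then show "norm (e f) \<le> 1 * norm f"
    by (cases "e f = 0") (simp_all)
qed simp

section \<open>Estimates for the truncated inverse\<close>

context
  fixes e a :: "'x op" and c r :: real and n :: nat
  assumes clin: "clinear_op a" "clinear_op e" and unit: "e o\<^sub>L e = e" "a o\<^sub>L e = a" "e o\<^sub>L adj a = adj a"
    "norm e \<le> 1"
    and c: "0 < c" "c * ((norm a)\<^sup>2 + 2 * r\<^sup>2) \<le> 1" and r: "0 < r"
begin

private lemma unit_apply: "e (e f) = e f" "a (e f) = a f" "e (adj a f) = adj a f"
  using unit by (metis blinfun_apply_blinfun_compose)+

private lemma power_step: "neumann_power e a c r (Suc k) v =
    (1 - c * r\<^sup>2) *\<^sub>R e (neumann_power e a c r k v) - c *\<^sub>R adj a (a (neumann_power e a c r k v))"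
  unfolding neumann_power.simps scaleC_of_real
  by (simp add: blinfun.add_left blinfun.diff_left blinfun.scaleR_left)

private lemma power_unit: "e (neumann_power e a c r k v) = neumann_power e a c r k v"
proof (cases k)
  case (Suc l)
  show ?thesis
    unfolding Suc power_step by (simp add: blinfun.diff_right blinfun.scaleR_right unit_apply)
qed (simp add: unit_apply)

private lemma power_Suc: "neumann_power e a c r (Suc k) v =
    (1 - c * r\<^sup>2) *\<^sub>R neumann_power e a c r k v - c *\<^sub>R adj a (a (neumann_power e a c r k v))"
  unfolding power_step power_unit ..

private lemma norm_power: "norm (neumann_power e a c r k v) \<le> (1 - c * r\<^sup>2) ^ k * norm v"
proof (induction k)
  case 0
  show ?case
    using norm_blinfun[of e v] mult_right_mono[OF unit(4), of "norm v"] by simp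
next
  case (Suc k)
  have "0 \<le> c * (norm a)\<^sup>2" "0 \<le> c * r\<^sup>2"
    using c(1) by simp_all
  then have "0 \<le> 1 - c * r\<^sup>2"
    using c(2) by (simp add: algebra_simps)
  have "norm (neumann_power e a c r (Suc k) v) \<le> (1 - c * r\<^sup>2) * norm (neumann_power e a c r k v)"
    unfolding power_Suc by (rule norm_contraction_le[OF clin(1) c])
  also have "\<dots> \<le> (1 - c * r\<^sup>2) * ((1 - c * r\<^sup>2) ^ k * norm v)"
    by (rule mult_left_mono[OF Suc \<open>0 \<le> 1 - c * r\<^sup>2\<close>])
  finally show ?case
    by (simp add: mult.assoc)
qed

text \<open>Telescoping: with T the factor in \<open>neumann_power\<close>, \<open>e - T\<close> is
  c times \<open>r\<^sup>2 e + a\<^sup>* a\<close>, so applying the latter to the sum of c T^i for i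
  < k leaves e - T^k.\<close>

private lemma sum_resolvent: "r\<^sup>2 *\<^sub>R neumann_sum e a c r k v + adj a (a (neumann_sum e a c r k v))
    = e v - neumann_power e a c r k v"
proof (induction k)
  case 0
  show ?case
    by (simp add: blinfun.zero_right)
next
  case (Suc k)
  let ?s = "neumann_sum e a c r k v" and ?p = "neumann_power e a c r k v"
  have "neumann_sum e a c r (Suc k) v = ?s + c *\<^sub>R ?p"
    by (simp add: blinfun.add_left scaleC_of_real blinfun.scaleR_left)
  then have "r\<^sup>2 *\<^sub>R neumann_sum e a c r (Suc k) v + adj a (a (neumann_sum e a c r (Suc k) v))
      = (r\<^sup>2 *\<^sub>R ?s + adj a (a ?s)) + (c * r\<^sup>2) *\<^sub>R ?p + c *\<^sub>R adj a (a ?p)"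
    by (simp add: blinfun.add_right blinfun.scaleR_right scaleR_add_right mult.commute)
  also have "\<dots> = e v - ((1 - c * r\<^sup>2) *\<^sub>R ?p - c *\<^sub>R adj a (a ?p))"
    unfolding Suc by (simp add: scaleR_diff_left)
  finally show ?case
    unfolding power_Suc .
qed

private lemma norm_remainder: "norm (e v - neumann_power e a c r n v) \<le> (1 + (1 - c * r\<^sup>2) ^ n) * norm v"
  using norm_triangle_ineq4[of "e v" "neumann_power e a c r n v"] norm_power[of n v] norm_power[of 0 v]
  by (simp add: distrib_right)

text \<open>With w the partial sum applied to v, \<open>norm_resolvent_ge\<close> bounds 2 r times
  the norm of a w by the norm of \<open>e v\<close> minus the remainder of the series. The bound
  does not involve \<open>norm a\<close>, which is essential: the preimage to be truncated may be
  large.\<close>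

lemma norm_truncation_le: "norm (truncation e a c r n) \<le> r / 2 * (1 + (1 - c * r\<^sup>2) ^ n)"
proof (rule norm_blinfun_bound)
  have "0 \<le> c * (norm a)\<^sup>2" "0 \<le> c * r\<^sup>2"
    using c(1) by simp_all
  then have "0 \<le> 1 - c * r\<^sup>2"
    using c(2) by (simp add: algebra_simps)
  then show "0 \<le> r / 2 * (1 + (1 - c * r\<^sup>2) ^ n)"
    using r by simp
  fix v
  let ?w = "neumann_sum e a c r n v"
  have "norm (truncation e a c r n v) = r / 2 * (2 * r * norm (a ?w))"
    by (simp add: truncation_def norm_scaleC power2_eq_square norm_mult)
  also have "\<dots> \<le> r / 2 * norm (e v - neumann_power e a c r n v)"
    using norm_resolvent_ge(1)[OF clin(1), of r ?w] r unfolding sum_resolvent by (intro mult_left_mono) auto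
  also have "\<dots> \<le> r / 2 * ((1 + (1 - c * r\<^sup>2) ^ n) * norm v)"
    using r by (intro mult_left_mono norm_remainder) simp
  finally show "norm (truncation e a c r n v) \<le> r / 2 * (1 + (1 - c * r\<^sup>2) ^ n) * norm v"
    by (simp add: mult.assoc)
qed

text \<open>Inserting the telescoped identity into \<open>a v\<close> leaves
  \<open>- a a\<^sup>* a w - a T^n v\<close>, with T as in \<open>neumann_power\<close>. For q = 1 -
  c r^2 the first term costs r / 2 times (1 + q^n) and the second r q^n, hence the factor 3.\<close>

lemma norm_truncation_diff_le:
  assumes "norm a \<le> r"
  shows "norm (truncation e a c r n - a) \<le> r / 2 * (1 + 3 * (1 - c * r\<^sup>2) ^ n)"
proof (rule norm_blinfun_bound)
  have "0 \<le> c * (norm a)\<^sup>2" "0 \<le> c * r\<^sup>2"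
    using c(1) by simp_all
  then have "0 \<le> 1 - c * r\<^sup>2"
    using c(2) by (simp add: algebra_simps)
  then show "0 \<le> r / 2 * (1 + 3 * (1 - c * r\<^sup>2) ^ n)"
    using r by simp
  have le: "norm (a f) \<le> r * norm f" for f
    using norm_blinfun[of a f] assms by (meson mult_right_mono norm_ge_zero order_trans)
  fix v
  let ?w = "neumann_sum e a c r n v" and ?p = "neumann_power e a c r n v"
  have "a v = a (r\<^sup>2 *\<^sub>R ?w + adj a (a ?w) + ?p)"
    unfolding sum_resolvent by (simp add: unit_apply)
  then have "(truncation e a c r n - a) v = - a (adj a (a ?w)) - a ?p"
    by (simp add: truncation_def blinfun.diff_left blinfun.add_right blinfun.scaleR_right blinfun.scaleR_left
        scaleC_of_real del: of_real_power)
  then have "norm ((truncation e a c r n - a) v) \<le> norm (a (adj a (a ?w))) + norm (a ?p)"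
    using norm_triangle_ineq4[of "- a (adj a (a ?w))" "a ?p"] by simp
  also have "\<dots> \<le> r * norm (adj a (a ?w)) + r * norm ?p"
    by (intro add_mono le)
  also have "\<dots> \<le> r * (1 / 2 * norm (e v - ?p)) + r * norm ?p"
    using norm_resolvent_ge(2)[OF clin(1), of r ?w] r assms unfolding sum_resolvent
    by (intro add_mono mult_left_mono) auto
  also have "\<dots> \<le> r * (1 / 2 * ((1 + (1 - c * r\<^sup>2) ^ n) * norm v)) + r * ((1 - c * r\<^sup>2) ^ n * norm v)"
    using r by (intro add_mono mult_left_mono norm_remainder norm_power) auto
  finally show "norm ((truncation e a c r n - a) v) \<le> r / 2 * (1 + 3 * (1 - c * r\<^sup>2) ^ n) * norm v"
    by (simp add: algebra_simps)
qed

end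

text \<open>The element \<open>r\<^sup>2 a (r\<^sup>2 + a\<^sup>* a)\<^sup>-\<^sup>1\<close> has norm at most \<open>r / 2\<close> and differs from \<open>a\<close> by at most
  \<open>r / 2\<close> if \<open>norm a \<le> r\<close>. Applied to a preimage of \<open>y\<close>, it yields a preimage of controlled norm of an
  approximation of \<open>y\<close>; iterating, the images fill the closure.\<close>

theorem star_hom_surj:
  fixes A :: "'x op set" and B :: "'y op set"
  assumes A: "cstar_algebra A" "is_unit A e" and B: "cstar_algebra B" "is_unit B e'"
    and j: "unital_star_hom A B j" "bounded_clinear_on A j" and dense: "B \<subseteq> closure (j ` A)"
  shows "j ` A = B"
proof
  have jB: "j x \<in> B" if "x \<in> A" for x
    using j(1) that by (auto simp: unital_star_hom_def)
  then show "j ` A \<subseteq> B"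
    by blast
  have je: "j e = e'"
    using j(1) unit_of_eqI[OF A(2)] unit_of_eqI[OF B(2)] by (simp add: unital_star_hom_def)
  have hom: "j (x + y) = j x + j y" "j (x o\<^sub>L y) = j x o\<^sub>L j y" "j (adj x) = adj (j x)" "j (s *\<^sub>C x) = s *\<^sub>C j x"
    if "x \<in> A" "y \<in> A" for x y s
    using j(1) that by (simp_all add: unital_star_hom_def)
  have alg: "x + y \<in> A" "x o\<^sub>L y \<in> A" "adj x \<in> A" "s *\<^sub>C x \<in> A" if "x \<in> A" "y \<in> A" for x y s
    using A(1) that by (simp_all add: cstar_algebra_def)
  have e: "e \<in> A"
    using A(2) by (simp add: is_unit_def)
  \<comment> \<open>Any contraction factor below 1 would do. Approximating y within R / 16 gives
    \<open>r = 17 / 16 * R\<close>; the truncation error is at most 3 / 4 of \<open>r\<close>, that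
    is 51 / 64 of R, and adding R / 16 stays below 7 / 8 of R.\<close>
  have step: "\<exists>x\<in>A. norm x \<le> 2 * R \<and> norm (y - j x) \<le> 7 / 8 * R" if y: "y \<in> B" "norm y \<le> R" and R: "0 < R"
    for y R
  proof -
    have "y \<in> closure (j ` A)"
      using y(1) dense by blast
    then obtain a where a: "a \<in> A" "norm (j a - y) < R / 16"
      using R unfolding closure_approachable dist_norm by (force dest!: spec[of _ "R / 16"])
    define r where "r = 17 / 16 * R"
    have r: "0 < r" "norm (j a) \<le> r"
      using R a(2) y(2) norm_triangle_ineq2[of "j a" y] by (auto simp: r_def)
    \<comment> \<open>One c must suit both \<open>a\<close> and \<open>j a\<close>, because the same
      polynomial is evaluated at both. Only \<open>norm (j a)\<close> is bounded by
      \<open>r\<close>; \<open>norm a\<close> merely makes c smaller.\<close>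
    define c where "c = 1 / ((norm a)\<^sup>2 + (norm (j a))\<^sup>2 + 2 * r\<^sup>2)"
    have pos: "0 < (norm a)\<^sup>2 + (norm (j a))\<^sup>2 + 2 * r\<^sup>2"
      using r(1) by (intro add_nonneg_pos) auto
    then have c: "0 < c" "c * ((norm a)\<^sup>2 + 2 * r\<^sup>2) \<le> 1" "c * ((norm (j a))\<^sup>2 + 2 * r\<^sup>2) \<le> 1"
      by (auto simp: c_def divide_le_eq)
    have "0 \<le> c * (norm a)\<^sup>2" "0 < c * r\<^sup>2"
      using c(1) r(1) by simp_all
    then have q: "0 \<le> 1 - c * r\<^sup>2" "1 - c * r\<^sup>2 < 1"
      using c(2) by (simp_all add: algebra_simps)
    then obtain n where n: "(1 - c * r\<^sup>2) ^ n < 1 / 6"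
      using real_arch_pow_inv[of "1 / 6" "1 - c * r\<^sup>2"] by auto
    \<comment> \<open>Truncations are polynomials in \<open>a\<close> and its adjoint, so
      \<open>j\<close> maps them to truncations of \<open>j a\<close>; this is why the series is cut
      off.\<close>
    have pw: "neumann_power e a c r k \<in> A \<and> j (neumann_power e a c r k) = neumann_power e' (j a) c r k" for k
      by (induction k) (use e a(1) in \<open>simp_all add: alg hom je del: of_real_diff of_real_minus\<close>)
    \<comment> \<open>The starting value \<open>0 *\<^sub>C e\<close> of the sums, in place of 0,
      lets the rules for scalars settle the base case.\<close>
    have sm: "neumann_sum e a c r k \<in> A \<and> j (neumann_sum e a c r k) = neumann_sum e' (j a) c r k" for k
      by (induction k) (use e pw in \<open>simp_all add: alg hom je del: complex_vector.scale_zero_left\<close>)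
    define x where "x = truncation e a c r n"
    have x: "x \<in> A" "j x = truncation e' (j a) c r n"
      using a(1) sm[of n] by (simp_all add: x_def truncation_def alg hom del: of_real_power)
    have clin: "clinear_op b" if "b \<in> A" for b
      using that A(1) by (auto simp: cstar_algebra_def complex_ops_iff subset_iff)
    have clin': "clinear_op b" if "b \<in> B" for b
      using that B(1) by (auto simp: cstar_algebra_def complex_ops_iff subset_iff)
    have "norm x \<le> r / 2 * (1 + (1 - c * r\<^sup>2) ^ n)"
      unfolding x_def
      by (rule norm_truncation_le) (use A e a(1) c r clin alg is_unit_norm_le[OF A] in \<open>auto simp: is_unit_def\<close>)
    also have "\<dots> \<le> r / 2 * (1 + 1 / 6)"
      using n r by (intro mult_left_mono) auto
    finally have "norm x \<le> 2 * R"
      using R by (simp add: r_def)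
    have e': "e' \<in> B" "j a \<in> B" "adj (j a) \<in> B"
      using B(1,2) jB[OF a(1)] by (auto simp: is_unit_def cstar_algebra_def)
    have "norm (j x - j a) \<le> r / 2 * (1 + 3 * (1 - c * r\<^sup>2) ^ n)"
      unfolding x(2)
      by (rule norm_truncation_diff_le) (use B(2) e' c r clin' is_unit_norm_le[OF B] in \<open>auto
        simp: is_unit_def\<close>)
    also have "\<dots> \<le> r / 2 * (1 + 3 * (1 / 6))"
      using n r by (intro mult_left_mono add_left_mono) auto
    finally have "norm (j x - j a) \<le> 51 / 64 * R"
      by (simp add: r_def)
    moreover have "norm (y - j x) \<le> norm (j a - y) + norm (j x - j a)"
      using norm_triangle_ineq[of "j a - y" "j x - j a"] by (simp add: norm_minus_commute)
    ultimately have "norm (y - j x) \<le> 7 / 8 * R"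
      using a(2) R by simp
    then show ?thesis
      using x(1) \<open>norm x \<le> 2 * R\<close> by blast
  qed
  then obtain f where f: "\<And>y R. y \<in> B \<Longrightarrow> norm y \<le> R \<Longrightarrow> 0 < R \<Longrightarrow>
    f y R \<in> A \<and> norm (f y R) \<le> 2 * R \<and> norm (y - j (f y R)) \<le> 7 / 8 * R"
    by metis
  show "B \<subseteq> j ` A"
  proof
    fix y
    assume y: "y \<in> B"
    define R where "R n = (norm y + 1) * (7 / 8) ^ n" for n
    have R: "0 < R n" "R (Suc n) = 7 / 8 * R n" for n
      by (simp_all add: R_def add_nonneg_pos)
    \<comment> \<open>Successive approximation: \<open>Y n\<close> is what remains of y after n
      corrections, and \<open>R n\<close> bounds it geometrically.\<close>
    define Y where "Y = rec_nat y (\<lambda>n z. z - j (f z (R n)))"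
    have Y: "Y 0 = y" "Y (Suc n) = Y n - j (f (Y n) (R n))" for n
      by (simp_all add: Y_def)
    have subB: "complex_vector.subspace B" and subA: "complex_vector.subspace A"
      using A(1) B(1) by (simp_all add: cstar_algebra_subspace)
    have YB: "Y n \<in> B \<and> norm (Y n) \<le> R n" for n
    proof (induction n)
      case 0
      then show ?case
        using y by (simp add: Y R_def)
    next
      case (Suc n)
      then show ?case
        using f[of "Y n" "R n"] jB R(1) by (simp add: Y complex_vector.subspace_diff[OF subB] R(2))
    qed
    define x where "x n = f (Y n) (R n)" for n
    have x: "x n \<in> A" "norm (x n) \<le> 2 * R n" for n
      using f[of "Y n" "R n"] YB R by (simp_all add: x_def)
    have "summable (\<lambda>n. 2 * R n)"
      unfolding R_def by (intro summable_mult summable_geometric) simp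
    then have "summable (\<lambda>n. norm (x n))"
      by (rule summable_comparison_test'[where N = 0]) (simp add: x)
    then have "summable x"
      by (rule summable_norm_cancel)
    then have lim: "(\<lambda>n. \<Sum>k<n. x k) \<longlonglongrightarrow> suminf x"
      by (rule summable_LIMSEQ)
    have partial: "(\<Sum>k<n. x k) \<in> A" for n
      using x(1) by (intro complex_vector.subspace_sum[OF subA])
    have xA: "suminf x \<in> A"
      by (intro closed_sequentially[OF _ partial lim]) (use A(1) in \<open>simp add: cstar_algebra_def\<close>)
    have "(\<lambda>n. j (\<Sum>k<n. x k)) \<longlonglongrightarrow> j (suminf x)"
      by (rule continuous_on_tendsto_compose[OF bounded_clinear_on_continuous[OF j(2) subA] lim xA])
        (simp add: partial)
    moreover have "(\<lambda>n. j (\<Sum>k<n. x k)) = (\<lambda>n. y - Y n)"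
    proof
      fix n
      show "j (\<Sum>k<n. x k) = y - Y n"
    proof (induction n)
      case 0
      have "j (0 *\<^sub>C e) = 0 *\<^sub>C j e"
        by (rule hom(4)[OF e e])
      then show ?case
        by (simp add: Y)
    next
      case (Suc n)
      then show ?case
        using hom(1)[OF partial x(1), of n n] by (simp add: Y x_def)
    qed
    qed
    moreover have "Y \<longlonglongrightarrow> 0"
    proof (rule Lim_null_comparison)
      show "\<forall>\<^sub>F n in sequentially. norm (Y n) \<le> R n"
        using YB by simp
      have "R \<longlonglongrightarrow> (norm y + 1) * 0"
        unfolding R_def by (intro tendsto_mult tendsto_const LIMSEQ_power_zero) simp
      then show "R \<longlonglongrightarrow> 0"
        by simp
    qed
    then have "(\<lambda>n. y - Y n) \<longlonglongrightarrow> y - 0"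
      by (rule tendsto_diff[OF tendsto_const])
    ultimately have "j (suminf x) = y - 0"
      by (metis LIMSEQ_unique)
    then show "y \<in> j ` A"
      using xA by auto
  qed
qed


section \<open>Quotient groups\<close>

text \<open>Cosets are sets, whereas the quantum subgroup has to act on \<open>ell2\<close> of a
  given type. Each coset is therefore represented by one chosen element, carried into that type by
  \<iota>, and the quotient structure is transported.\<close>

lemma quotient_realization:
  fixes G :: "('g, 'b) monoid_scheme" and \<iota> :: "'g \<Rightarrow> 'x"
  assumes "group G" "normal H G" "inj_on \<iota> (carrier G)"
  obtains K :: "'x monoid" and \<pi> where "group K" "\<pi> \<in> hom G K" "\<pi> ` carrier G = carrier K"
    "\<And>g. g \<in> carrier G \<Longrightarrow> \<pi> g = \<one>\<^bsub>K\<^esub> \<longleftrightarrow> g \<in> H"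
proof -
  interpret normal H G by fact
  define s where "s g = (SOME x. x \<in> H #>\<^bsub>G\<^esub> g)" for g
  define \<pi> where "\<pi> g = \<iota> (s g)" for g
  have s: "s g \<in> H #>\<^bsub>G\<^esub> g" "s g \<in> carrier G" if "g \<in> carrier G" for g
  proof -
    show "s g \<in> H #>\<^bsub>G\<^esub> g"
      unfolding s_def using rcos_self[OF that is_subgroup] by (rule someI)
    then show "s g \<in> carrier G"
      using r_coset_subset_G[OF subset that] by blast
  qed
  have eq: "\<pi> g = \<pi> h \<longleftrightarrow> H #>\<^bsub>G\<^esub> g = H #>\<^bsub>G\<^esub> h" if "g \<in> carrier G" "h \<in> carrier G" for g h
  proof
    assume "\<pi> g = \<pi> h"
    then have "s g = s h"
      using s that assms(3) by (auto simp: \<pi>_def dest: inj_onD)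
    then show "H #>\<^bsub>G\<^esub> g = H #>\<^bsub>G\<^esub> h"
      using repr_independence[OF s(1)[OF that(1)] that(1) is_subgroup]
        repr_independence[OF s(1)[OF that(2)] that(2) is_subgroup] by simp
  qed (simp add: \<pi>_def s_def)
  define \<rho> where "\<rho> = inv_into (carrier G) \<pi>"
  have \<rho>: "\<rho> (\<pi> g) \<in> carrier G" "H #>\<^bsub>G\<^esub> \<rho> (\<pi> g) = H #>\<^bsub>G\<^esub> g" if "g \<in> carrier G" for g
  proof -
    show "\<rho> (\<pi> g) \<in> carrier G"
      unfolding \<rho>_def using that by (simp add: inv_into_into)
    moreover have "\<pi> (\<rho> (\<pi> g)) = \<pi> g"
      unfolding \<rho>_def using that by (simp add: f_inv_into_f)
    ultimately show "H #>\<^bsub>G\<^esub> \<rho> (\<pi> g) = H #>\<^bsub>G\<^esub> g"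
      using eq that by blast
  qed
  \<comment> \<open>\<open>M\<close> merely provides a multiplication. Its full carrier and
    arbitrary neutral element are harmless: \<open>hom_imp_img_group\<close> asks only for a
    homomorphism into it and replaces both by those of the image.\<close>
  define M :: "'x monoid" where "M = \<lparr>carrier = UNIV, mult = (\<lambda>x y. \<pi> (\<rho> x \<otimes>\<^bsub>G\<^esub> \<rho> y)), one = undefined\<rparr>"
  have mult: "\<pi> (g \<otimes>\<^bsub>G\<^esub> h) = \<pi> g \<otimes>\<^bsub>M\<^esub> \<pi> h" if "g \<in> carrier G" "h \<in> carrier G" for g h
    using that \<rho> rcos_sum[of g h] rcos_sum[of "\<rho> (\<pi> g)" "\<rho> (\<pi> h)"] by (simp add: M_def eq)
  then have "\<pi> \<in> hom G M"
    by (simp add: hom_def M_def)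
  define K where "K = M\<lparr>carrier := \<pi> ` carrier G, one := \<pi> \<one>\<^bsub>G\<^esub>\<rparr>"
  have "group K"
    unfolding K_def by (rule hom_imp_img_group[OF \<open>\<pi> \<in> hom G M\<close>])
  moreover have "\<pi> \<in> hom G K"
    using mult by (auto simp: hom_def K_def)
  moreover have "\<pi> g = \<one>\<^bsub>K\<^esub> \<longleftrightarrow> g \<in> H" if "g \<in> carrier G" for g
    using that eq[OF that one_closed] coset_join1[OF _ that is_subgroup] coset_join2[OF that is_subgroup]
    by (auto simp: K_def coset_mult_one[OF subset])
  moreover have "\<pi> ` carrier G = carrier K"
    by (simp add: K_def)
  ultimately show ?thesis
    using that by blast
qed

text \<open>The mean is pushed forward along \<pi>; invariance follows by lifting an element of K
  along the surjection.\<close>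

lemma amenable_quotient:
  fixes G :: "('a, 'b) monoid_scheme" and K :: "('c, 'd) monoid_scheme"
  assumes "amenable G" "\<pi> \<in> hom G K" "\<pi> ` carrier G = carrier K" "group G"
  shows "amenable K"
proof -
  obtain m :: "('a \<Rightarrow> real) \<Rightarrow> real" where m:
    "\<forall>f f'. bounded (f ` carrier G) \<longrightarrow> bounded (f' ` carrier G) \<longrightarrow> m (\<lambda>x. f x + f' x) = m f + m f'"
    "\<forall>f r. bounded (f ` carrier G) \<longrightarrow> m (\<lambda>x. r * f x) = r * m f"
    "\<forall>f. bounded (f ` carrier G) \<longrightarrow> (\<forall>x\<in>carrier G. 0 \<le> f x) \<longrightarrow> 0 \<le> m f"
    "m (\<lambda>_. 1) = 1"
    "\<forall>f. bounded (f ` carrier G) \<longrightarrow> (\<forall>g\<in>carrier G. m (\<lambda>x. f (g \<otimes>\<^bsub>G\<^esub> x)) = m f)"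
    using assms(1) unfolding amenable_def by (elim exE conjE) (rule that)
  \<comment> \<open>By positivity the mean sees only values on the carrier. This is needed because
    \<pi> is multiplicative on the carrier only.\<close>
  have le: "m f' \<le> m f" if b: "bounded (f ` carrier G)" "bounded (f' ` carrier G)" and
    eq: "\<And>x. x \<in> carrier G \<Longrightarrow> f x = f' x" for f f'
  proof -
    have b': "bounded ((\<lambda>x. (-1) * f' x) ` carrier G)"
      using b(2) by (auto simp: bounded_iff)
    have "bounded ((\<lambda>x. f x + (-1) * f' x) ` carrier G)"
      using eq by (auto simp: bounded_iff)
    then have "0 \<le> m (\<lambda>x. f x + (-1) * f' x)"
      using eq by (intro m(3)[rule_format]) auto
    also have "\<dots> = m f + m (\<lambda>x. (-1) * f' x)"
      using b(1) b' by (intro m(1)[rule_format])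
    also have "m (\<lambda>x. (-1) * f' x) = (-1) * m f'"
      using b(2) by (intro m(2)[rule_format])
    finally show ?thesis
      by simp
  qed
  have cong: "m f = m f'" if "bounded (f ` carrier G)" "bounded (f' ` carrier G)"
    "\<And>x. x \<in> carrier G \<Longrightarrow> f x = f' x" for f f'
    by (rule order_antisym; rule le) (use that in auto)
  have b: "bounded ((\<lambda>x. f (\<pi> x)) ` carrier G) \<longleftrightarrow> bounded (f ` carrier K)" for f :: "'c \<Rightarrow> real"
    unfolding assms(3)[symmetric] image_image ..
  have inv: "m (\<lambda>x. f (k \<otimes>\<^bsub>K\<^esub> \<pi> x)) = m (\<lambda>x. f (\<pi> x))"
    if f: "bounded (f ` carrier K)" and k: "k \<in> carrier K" for f k
  proof -
    obtain g where g: "g \<in> carrier G" "k = \<pi> g"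
      using k assms(3) by blast
    have mem: "k \<otimes>\<^bsub>K\<^esub> \<pi> x = \<pi> (g \<otimes>\<^bsub>G\<^esub> x)" "\<pi> (g \<otimes>\<^bsub>G\<^esub> x) \<in> carrier K" if "x \<in> carrier G" for x
      using that g hom_mult[OF assms(2)] hom_in_carrier[OF assms(2) monoid.m_closed[OF group.is_monoid[OF
        assms(4)]]]
      by simp_all
    obtain C where C: "\<And>x. x \<in> carrier K \<Longrightarrow> norm (f x) \<le> C"
      using f by (auto simp: bounded_iff)
    have "bounded ((\<lambda>x. f (k \<otimes>\<^bsub>K\<^esub> \<pi> x)) ` carrier G)" "bounded ((\<lambda>x. f (\<pi> (g \<otimes>\<^bsub>G\<^esub> x))) ` carrier G)"
      using C mem by (auto simp: bounded_iff intro!: exI[of _ C])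
    then have "m (\<lambda>x. f (k \<otimes>\<^bsub>K\<^esub> \<pi> x)) = m (\<lambda>x. f (\<pi> (g \<otimes>\<^bsub>G\<^esub> x)))"
      by (rule cong) (simp add: mem)
    also have "\<dots> = m (\<lambda>x. f (\<pi> x))"
      using m(5)[rule_format, of "\<lambda>x. f (\<pi> x)", OF _ g(1)] f by (simp add: b)
    finally show ?thesis .
  qed
  show ?thesis
    unfolding amenable_def
  proof (intro exI conjI allI impI ballI)
    let ?m = "\<lambda>f. m (\<lambda>x. f (\<pi> x))"
    fix f f' :: "'c \<Rightarrow> real"
    assume f: "bounded (f ` carrier K)"
    show "?m (\<lambda>x. r * f x) = r * ?m f" for r
      using m(2) f by (simp add: b)
    show "0 \<le> ?m f" if "\<forall>x\<in>carrier K. 0 \<le> f x"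
      using m(3)[rule_format, of "\<lambda>x. f (\<pi> x)"] f that assms(3) by (auto simp: b)
    show "?m (\<lambda>x. f (k \<otimes>\<^bsub>K\<^esub> x)) = ?m f" if "k \<in> carrier K" for k
      by (rule inv[OF f that])
    assume f': "bounded (f' ` carrier K)"
    show "?m (\<lambda>x. f x + f' x) = ?m f + ?m f'"
      using m(1) f f' by (simp add: b)
  next
    show "m (\<lambda>x. 1) = 1"
      by (rule m(4))
  qed
qed

section \<open>Idempotent states\<close>

context
  fixes G :: "('g, 'b) monoid_scheme"
  assumes grp: "group G"
begin

interpretation group G by (rule grp)


lemma state_bounded: "state (group_cstar G) \<phi> \<Longrightarrow> bounded_clinear_on (group_cstar G) \<phi>"
  and state_one: "state (group_cstar G) \<phi> \<Longrightarrow> \<phi> (left_translation G \<one>\<^bsub>G\<^esub>) = 1"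
  by (simp_all add: state_def unit_of_group_cstar[OF grp])

text \<open>Makes positivity usable: on a finite combination of translations it becomes a quadratic
  form in the values of \<phi> at translations. Indexing by an initial segment of the naturals lets
  the small instances n = 2 and n = 3 be expanded by simplification.\<close>

lemma state_quadratic:
  fixes \<gamma> :: "nat \<Rightarrow> 'g" and c :: "nat \<Rightarrow> complex"
  assumes \<phi>: "state (group_cstar G) \<phi>" and \<gamma>: "\<And>i. i < n \<Longrightarrow> \<gamma> i \<in> carrier G"
  defines "a \<equiv> \<Sum>i<n. c i *\<^sub>C left_translation G (\<gamma> i)"
  shows "a \<in> group_cstar G"
    and "\<phi> (adj a o\<^sub>L a) =
      (\<Sum>i<n. \<Sum>j<n. cnj (c i) * (c j * \<phi> (left_translation G (inv\<^bsub>G\<^esub> (\<gamma> i) \<otimes>\<^bsub>G\<^esub> \<gamma> j))))"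
proof -
  define b where "b = (\<Sum>i<n. cnj (c i) *\<^sub>C left_translation G (inv\<^bsub>G\<^esub> (\<gamma> i)))"
  have mem: "left_translation G (\<gamma> i) \<in> group_cstar G" "left_translation G (inv\<^bsub>G\<^esub> (\<gamma> i)) \<in> group_cstar G"
    if "i < n" for i
    using \<gamma>[OF that] by (simp_all add: left_translation_in_group_cstar[OF grp])
  show a: "a \<in> group_cstar G"
    unfolding a_def by (intro complex_vector.subspace_sum[OF subspace_group_cstar[OF grp]]
      complex_vector.subspace_scale[OF subspace_group_cstar[OF grp]]) (simp add: mem)
  have "adj a = b"
  proof (rule adj_eqI)
    fix f g
    have "cinner (left_translation G (inv\<^bsub>G\<^esub> (\<gamma> i)) f) g = cinner f (left_translation G (\<gamma> i) g)" if "i < n" for i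
      using cinner_adj_left[OF clinear_op_left_translation[OF grp \<gamma>[OF that]], of f g] \<gamma>[OF that]
      by (simp add: left_translation_adj[OF grp])
    then show "cinner (b f) g = cinner f (a g)"
      by (simp add: a_def b_def blinfun.sum_left cinner_sum_left cinner_sum_right cinner_scaleC_left
        cinner_scaleC_right)
  qed
  have "bounded_clinear_on (group_cstar G) (\<lambda>x. \<phi> (x o\<^sub>L a))"
    using a group_cstar_compose[OF grp]
    by (intro bounded_clinear_on_compose[OF bounded_clinear_on_compose_left state_bounded[OF \<phi>]]) auto
  from bounded_clinear_on_sum[OF this subspace_group_cstar[OF grp], of "{..<n}"
    "\<lambda>i. left_translation G (inv\<^bsub>G\<^esub> (\<gamma> i))" "\<lambda>i. cnj (c i)"]
  have "\<phi> (b o\<^sub>L a) = (\<Sum>i<n. cnj (c i) * \<phi> (left_translation G (inv\<^bsub>G\<^esub> (\<gamma> i)) o\<^sub>L a))"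
    by (simp add: b_def mem scaleC_complex_def)
  also have "\<dots> = (\<Sum>i<n. \<Sum>j<n. cnj (c i) * (c j * \<phi> (left_translation G (inv\<^bsub>G\<^esub> (\<gamma> i) \<otimes>\<^bsub>G\<^esub> \<gamma> j))))"
  proof (rule sum.cong)
    fix i
    assume "i \<in> {..<n}"
    then have i: "i < n"
      by simp
    have "bounded_clinear_on (group_cstar G) (\<lambda>x. \<phi> (left_translation G (inv\<^bsub>G\<^esub> (\<gamma> i)) o\<^sub>L x))"
      using mem[OF i] group_cstar_compose[OF grp]
      by (intro bounded_clinear_on_compose[OF bounded_clinear_on_compose_right state_bounded[OF \<phi>]])
        (auto simp: group_cstar_clinear[OF grp])
    from bounded_clinear_on_sum[OF this subspace_group_cstar[OF grp], of "{..<n}"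
      "\<lambda>j. left_translation G (\<gamma> j)" c]
    show "cnj (c i) * \<phi> (left_translation G (inv\<^bsub>G\<^esub> (\<gamma> i)) o\<^sub>L a)
        = (\<Sum>j<n. cnj (c i) * (c j * \<phi> (left_translation G (inv\<^bsub>G\<^esub> (\<gamma> i) \<otimes>\<^bsub>G\<^esub> \<gamma> j))))"
      using \<gamma> i by (simp add: a_def mem scaleC_complex_def left_translation_mult[OF grp] sum_distrib_left)
  qed simp
  finally show "\<phi> (adj a o\<^sub>L a) =
      (\<Sum>i<n. \<Sum>j<n. cnj (c i) * (c j * \<phi> (left_translation G (inv\<^bsub>G\<^esub> (\<gamma> i) \<otimes>\<^bsub>G\<^esub> \<gamma> j))))"
    unfolding \<open>adj a = b\<close> .
qed

lemma state_positive_definite: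
  fixes \<gamma> :: "nat \<Rightarrow> 'g"
  assumes "state (group_cstar G) \<phi>" "\<And>i. i < n \<Longrightarrow> \<gamma> i \<in> carrier G"
  shows "(\<Sum>i<n. \<Sum>j<n. cnj (c i) * (c j * \<phi> (left_translation G (inv\<^bsub>G\<^esub> (\<gamma> i) \<otimes>\<^bsub>G\<^esub> \<gamma> j)))) \<in> \<real>\<^sub>\<ge>\<^sub>0"
proof -
  have "\<phi> (adj a o\<^sub>L a) \<in> \<real>\<^sub>\<ge>\<^sub>0" if "a \<in> group_cstar G" for a
    using assms(1) that unfolding state_def by blast
  from this[OF state_quadratic(1)[OF assms, where c = c]] show ?thesis
    by (simp only: state_quadratic(2)[OF assms])
qed

lemma state_eqI:
  assumes "state (group_cstar G) \<phi>" "state (group_cstar G) \<psi>"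
    "\<And>g. g \<in> carrier G \<Longrightarrow> \<phi> (left_translation G g) = \<psi> (left_translation G g)"
  shows "\<phi> = \<psi>"
proof (rule extensionalityI)
  show "\<phi> \<in> extensional (group_cstar G)" "\<psi> \<in> extensional (group_cstar G)"
    using assms(1,2) by (simp_all add: state_def)
  show "\<phi> a = \<psi> a" if "a \<in> group_cstar G" for a
    by (rule group_cstar_eqI[OF grp state_bounded[OF assms(1)] state_bounded[OF assms(2)] assms(3) that])
qed

end

section \<open>The correspondence between idempotent states and subgroups\<close>

context
  fixes G :: "('g, 'b) monoid_scheme"
  assumes grp: "group G" and aiv: "almost_invariant_vectors G"
begin

interpretation group G by (rule grp)

private abbreviation (input) "A \<equiv> group_cstar G"
private abbreviation (input) "\<Delta> \<equiv> dual_coproduct G"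
private abbreviation (input) "\<Lambda> \<equiv> left_translation G"

lemma idempotent_state_values:
  assumes "idempotent_state A \<Delta> \<phi>" "g \<in> carrier G"
  shows "\<phi> (\<Lambda> g) = of_bool (g \<in> state_subgroup G \<phi>)"
proof -
  obtain \<Phi> where "tensor_functional A A \<phi> \<phi> \<Phi>" "\<And>a. a \<in> A \<Longrightarrow> \<Phi> (\<Delta> a) = \<phi> a"
    using assms(1) unfolding idempotent_state_def by blast
  then have "\<phi> (\<Lambda> g) * \<phi> (\<Lambda> g) = \<phi> (\<Lambda> g)"
    using assms(2) left_translation_in_group_cstar[OF grp assms(2)] dual_coproduct(3)[OF grp aiv assms(2)]
    unfolding tensor_functional_def by metis
  then show ?thesis
    using assms(2) by (auto simp: state_subgroup_def)
qed

text \<open>If \<open>u\<close> is positive definite with values in \<open>{0, 1}\<close> and \<open>u g = u h = 1\<close>, then testing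
  positivity on \<open>\<lambda>\<^sub>1 - \<lambda>\<^sub>g - \<lambda>\<^sub>h\<close> gives \<open>2 u (g\<^sup>-\<^sup>1 h) - 1 \<ge> 0\<close>.\<close>

lemma idempotent_state_subgroup:
  assumes idem: "idempotent_state A \<Delta> \<phi>"
  shows "subgroup (state_subgroup G \<phi>) G"
proof -
  let ?H = "state_subgroup G \<phi>"
  have \<phi>: "state A \<phi>"
    using idem by (simp add: idempotent_state_def)
  note val = idempotent_state_values[OF idem]
  have one: "\<one>\<^bsub>G\<^esub> \<in> ?H"
    using state_one[OF grp \<phi>] by (simp add: state_subgroup_def)
  have inv_iff: "inv\<^bsub>G\<^esub> g \<in> ?H \<longleftrightarrow> g \<in> ?H" if g: "g \<in> carrier G" for g
  proof -
    \<comment> \<open>The coefficients 1 and \<i> give 2 + \<i> (u g - u (inv g)), where u is the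
      value of \<phi> at a translation; this is real only if the two values agree.\<close>
    let ?c = "\<lambda>i :: nat. if i = 0 then 1 else \<i>"
    let ?\<gamma> = "\<lambda>i :: nat. if i = 0 then \<one>\<^bsub>G\<^esub> else g"
    have "(\<Sum>i<2. \<Sum>j<2. cnj (?c i) * (?c j * \<phi> (\<Lambda> (inv\<^bsub>G\<^esub> (?\<gamma> i) \<otimes>\<^bsub>G\<^esub> ?\<gamma> j)))) \<in> \<real>\<^sub>\<ge>\<^sub>0"
      by (rule state_positive_definite[OF grp \<phi>]) (use g in auto)
    then have "2 + \<i> * (of_bool (g \<in> ?H) - of_bool (inv\<^bsub>G\<^esub> g \<in> ?H)) \<in> \<real>\<^sub>\<ge>\<^sub>0"
      using g one by (simp add: numeral_2_eq_2 val algebra_simps)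
    then show ?thesis
      by (cases "g \<in> ?H"; cases "inv\<^bsub>G\<^esub> g \<in> ?H") (simp_all add: complex_nonneg_Reals_iff)
  qed
  have mult: "inv\<^bsub>G\<^esub> g \<otimes>\<^bsub>G\<^esub> h \<in> ?H" if "g \<in> ?H" "h \<in> ?H" for g h
  proof (rule ccontr)
    assume n: "inv\<^bsub>G\<^esub> g \<otimes>\<^bsub>G\<^esub> h \<notin> ?H"
    have gh: "g \<in> carrier G" "h \<in> carrier G"
      using that by (auto simp: state_subgroup_def)
    have "inv\<^bsub>G\<^esub> h \<otimes>\<^bsub>G\<^esub> g = inv\<^bsub>G\<^esub> (inv\<^bsub>G\<^esub> g \<otimes>\<^bsub>G\<^esub> h)"
      using gh by (simp add: inv_mult_group)
    then have n': "inv\<^bsub>G\<^esub> h \<otimes>\<^bsub>G\<^esub> g \<notin> ?H"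
      using n inv_iff[of "inv\<^bsub>G\<^esub> g \<otimes>\<^bsub>G\<^esub> h"] gh by simp
    let ?c = "\<lambda>i :: nat. if i = 0 then 1 else - 1 :: complex"
    let ?\<gamma> = "\<lambda>i :: nat. if i = 0 then \<one>\<^bsub>G\<^esub> else if i = 1 then g else h"
    have "(\<Sum>i<3. \<Sum>j<3. cnj (?c i) * (?c j * \<phi> (\<Lambda> (inv\<^bsub>G\<^esub> (?\<gamma> i) \<otimes>\<^bsub>G\<^esub> ?\<gamma> j)))) \<in> \<real>\<^sub>\<ge>\<^sub>0"
      by (rule state_positive_definite[OF grp \<phi>]) (use gh in auto)
    moreover have "(\<Sum>i<3. \<Sum>j<3. cnj (?c i) * (?c j * \<phi> (\<Lambda> (inv\<^bsub>G\<^esub> (?\<gamma> i) \<otimes>\<^bsub>G\<^esub> ?\<gamma> j)))) = - 1"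
      using gh that one n n' inv_iff[OF gh(1)] inv_iff[OF gh(2)] by (simp add: numeral_3_eq_3 val)
    ultimately show False
      by (simp add: complex_nonneg_Reals_iff)
  qed
  show ?thesis
  proof (rule subgroupI)
    show "?H \<subseteq> carrier G" "?H \<noteq> {}"
      using one by (auto simp: state_subgroup_def)
    show "inv\<^bsub>G\<^esub> g \<in> ?H" if "g \<in> ?H" for g
      using that inv_iff[of g] by (auto simp: state_subgroup_def)
    show "g \<otimes>\<^bsub>G\<^esub> h \<in> ?H" if "g \<in> ?H" "h \<in> ?H" for g h
      using mult[of "inv\<^bsub>G\<^esub> g" h] inv_iff[of g] that by (simp add: state_subgroup_def)
  qed
qed

lemma subgroup_idempotent_state:
  assumes "subgroup H G"
  obtains \<phi> where "idempotent_state A \<Delta> \<phi>" "state_subgroup G \<phi> = H"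
proof -
  note GG = DirProd_group[OF grp grp]
  note aiv2 = almost_invariant_vectors_prod[OF grp grp aiv aiv]
  interpret H: subgroup H G by fact
  obtain \<phi> where \<phi>: "state A \<phi>" "\<And>g. g \<in> carrier G \<Longrightarrow> \<phi> (\<Lambda> g) = of_bool (g \<in> H)"
    using subgroup_state[OF grp aiv assms] by blast
  \<comment> \<open>The indicator of \<open>H \<times> H\<close> is the product of the indicators of
    H, which gives the values on elementary tensors; on the diagonal it is the indicator of H
    itself, which gives idempotence.\<close>
  obtain \<Phi> where \<Phi>: "state (group_cstar (G \<times>\<times> G)) \<Phi>"
    "\<And>z. z \<in> carrier (G \<times>\<times> G) \<Longrightarrow> \<Phi> (left_translation (G \<times>\<times> G) z) = of_bool (z \<in> H \<times> H)"
    using subgroup_state[OF GG aiv2 DirProd_subgroups[OF grp assms grp assms]] by blast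
  have \<Phi>b: "bounded_clinear_on (group_cstar (G \<times>\<times> G)) \<Phi>"
    using \<Phi>(1) by (simp add: state_def)
  have clin: "clinear_op a" if "a \<in> A" for a
    using group_cstar_clinear[OF grp that] .
  have gen: "\<Phi> (\<Lambda> g \<otimes>\<^sub>o \<Lambda> h) = \<phi> (\<Lambda> g) * \<phi> (\<Lambda> h)" if "g \<in> carrier G" "h \<in> carrier G" for g h
    using that by (simp add: left_translation_prod[OF grp grp] \<Phi>(2) \<phi>(2))
  have 1: "\<Phi> (a \<otimes>\<^sub>o \<Lambda> h) = \<phi> a * \<phi> (\<Lambda> h)" if "a \<in> A" "h \<in> carrier G" for a h
  proof (rule group_cstar_eqI[OF grp _ _ _ that(1)])
    have h: "\<Lambda> h \<in> A"
      using left_translation_in_group_cstar[OF grp that(2)] .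
    show "bounded_clinear_on A (\<lambda>a. \<Phi> (a \<otimes>\<^sub>o \<Lambda> h))"
      by (rule bounded_clinear_on_compose[OF bounded_clinear_on_tensor_left \<Phi>b])
        (use h clin tensor_mem_group_cstar[OF grp] in \<open>auto simp: complex_ops_iff\<close>)
    show "bounded_clinear_on A (\<lambda>a. \<phi> a * \<phi> (\<Lambda> h))"
      using bounded_clinear_on_compose[OF state_bounded[OF grp \<phi>(1)]
          bounded_clinear_on_scaleC_left[of UNIV "\<phi> (\<Lambda> h)"] subset_UNIV]
      by (simp add: scaleC_complex_def)
  qed (simp add: gen that)
  have "\<Phi> (a \<otimes>\<^sub>o b) = \<phi> a * \<phi> b" if "a \<in> A" "b \<in> A" for a b
  proof (rule group_cstar_eqI[OF grp _ _ _ that(2)])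
    show "bounded_clinear_on A (\<lambda>b. \<Phi> (a \<otimes>\<^sub>o b))"
      by (rule bounded_clinear_on_compose[OF bounded_clinear_on_tensor_right \<Phi>b])
        (use that clin tensor_mem_group_cstar[OF grp] in \<open>auto simp: complex_ops_iff\<close>)
    show "bounded_clinear_on A (\<lambda>b. \<phi> a * \<phi> b)"
      using bounded_clinear_on_compose[OF state_bounded[OF grp \<phi>(1)]
        bounded_clinear_on_scaleC_left[of UNIV "\<phi> a"] subset_UNIV]
      by (simp add: scaleC_complex_def mult.commute)
  qed (simp add: 1 that)
  then have "tensor_functional A A \<phi> \<phi> \<Phi>"
    using \<Phi>b by (simp add: tensor_functional_def group_cstar_tensor[OF grp grp])
  moreover have "\<Phi> (\<Delta> a) = \<phi> a" if "a \<in> A" for a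
  proof (rule group_cstar_eqI[OF grp _ state_bounded[OF grp \<phi>(1)] _ that])
    show "bounded_clinear_on A (\<lambda>a. \<Phi> (\<Delta> a))"
      by (rule bounded_clinear_on_compose[OF dual_coproduct(2)[OF grp aiv] \<Phi>b])
        (use dual_coproduct_range[OF grp aiv] in auto)
  qed (simp add: dual_coproduct(3)[OF grp aiv] gen \<phi>(2))
  ultimately have "idempotent_state A \<Delta> \<phi>"
    using \<phi>(1) unfolding idempotent_state_def by blast
  moreover have "state_subgroup G \<phi> = H"
    using \<phi>(2) H.subset by (auto simp: state_subgroup_def)
  ultimately show ?thesis
    by (rule that)
qed

theorem bij_betw_state_subgroup: "bij_betw (state_subgroup G) {\<phi>. idempotent_state A \<Delta> \<phi>} {H. subgroup H G}"
proof (rule bij_betw_imageI)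
  show "inj_on (state_subgroup G) {\<phi>. idempotent_state A \<Delta> \<phi>}"
  proof (rule inj_onI, clarsimp)
    fix \<phi> \<psi>
    assume idem: "idempotent_state A \<Delta> \<phi>" "idempotent_state A \<Delta> \<psi>" and "state_subgroup G \<phi> = state_subgroup G \<psi>"
    then show "\<phi> = \<psi>"
      by (intro state_eqI[OF grp]) (simp_all add: idempotent_state_values idempotent_state_def[of A \<Delta>])
  qed
  show "state_subgroup G ` {\<phi>. idempotent_state A \<Delta> \<phi>} = {H. subgroup H G}"
  proof safe
    fix H
    assume "subgroup H G"
    then show "H \<in> state_subgroup G ` {\<phi>. idempotent_state A \<Delta> \<phi>}"
      by (rule subgroup_idempotent_state) auto
  qed (rule idempotent_state_subgroup)
qed


section \<open>Haar idempotents\<close>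

text \<open>If \<open>h \<circ> j\<close> takes the value \<open>1\<close> at \<open>\<lambda>\<^sub>g\<close> for a faithful \<open>h\<close>, then \<open>j \<lambda>\<^sub>g = 1\<close>, and this condition
  is invariant under conjugation.\<close>

lemma haar_idempotent_imp_normal:
  assumes idem: "idempotent_state A \<Delta> \<phi>" and haar: "haar_idempotent TYPE('x) A \<Delta> \<phi>"
  shows "normal (state_subgroup G \<phi>) G"
proof -
  let ?H = "state_subgroup G \<phi>"
  obtain B :: "'x op set" and \<Delta>' j h where qs: "quantum_subgroup A \<Delta> B \<Delta>' j"
    and h: "haar_state B \<Delta>' h" "faithful B h" and \<phi>: "\<phi> = restrict (h \<circ> j) A"
    using haar unfolding haar_idempotent_def by blast
  have j: "unital_star_hom A B j" and "unital_cstar_algebra B"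
    using qs by (simp_all add: quantum_subgroup_def compact_quantum_group_def)
  then obtain e where e: "is_unit B e"
    by (auto simp: unital_cstar_algebra_def)
  have hom: "j (a + b) = j a + j b" "j (a o\<^sub>L b) = j a o\<^sub>L j b" "j (adj a) = adj (j a)"
    "j (c *\<^sub>C a) = c *\<^sub>C j a" "j a \<in> B"
    if "a \<in> A" "b \<in> A" for a b c
    using j that by (auto simp: unital_star_hom_def)
  have je: "j (\<Lambda> \<one>\<^bsub>G\<^esub>) = e"
    using j unit_of_eqI[OF e] by (simp add: unital_star_hom_def unit_of_group_cstar[OF grp])
  have st: "state A \<phi>"
    using idem by (simp add: idempotent_state_def)
  note sub = idempotent_state_subgroup[OF idem]
  interpret H: subgroup ?H G by (rule sub)
  note mem = left_translation_in_group_cstar[OF grp]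
  have triv: "j (\<Lambda> g) = e" if g: "g \<in> ?H" for g
  proof -
    have gG: "g \<in> carrier G" and inv: "inv\<^bsub>G\<^esub> g \<in> ?H"
      using g by auto
    \<comment> \<open>The element tested is the translation by g minus the unit: \<phi> takes the
      value 2 - 1 - 1 = 0 on \<open>adj a o\<^sub>L a\<close>, because g and its inverse both lie in
      the subgroup.\<close>
    let ?c = "\<lambda>i :: nat. if i = 0 then 1 else - 1 :: complex"
    let ?\<gamma> = "\<lambda>i :: nat. if i = 0 then g else \<one>\<^bsub>G\<^esub>"
    define a where "a = (\<Sum>i<2. ?c i *\<^sub>C \<Lambda> (?\<gamma> i))"
    have "?\<gamma> i \<in> carrier G" for i
      using gG by simp
    note quad = state_quadratic[OF grp st, where n = 2 and c = ?c and \<gamma> = ?\<gamma>, OF this, folded a_def]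
    have a: "a \<in> A"
      by (rule quad(1))
    have "\<phi> (adj a o\<^sub>L a) = 0"
      unfolding quad(2) using gG g inv H.one_closed
        by (simp add: numeral_2_eq_2 idempotent_state_values[OF idem])
    moreover have "\<phi> (adj a o\<^sub>L a) = h (adj (j a) o\<^sub>L j a)"
      using a group_cstar_adj[OF grp a] group_cstar_compose[OF grp] by (simp add: \<phi> hom)
    ultimately have "j a = 0"
      using h(2) hom(5)[OF a a] by (simp add: faithful_def)
    moreover have "j a = j (\<Lambda> g) + (-1) *\<^sub>C j (\<Lambda> \<one>\<^bsub>G\<^esub>)"
    proof -
      have "(-1) *\<^sub>C \<Lambda> \<one>\<^bsub>G\<^esub> \<in> A"
        by (rule complex_vector.subspace_scale[OF subspace_group_cstar[OF grp] mem[OF one_closed]])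
      then have "j (\<Lambda> g + (-1) *\<^sub>C \<Lambda> \<one>\<^bsub>G\<^esub>) = j (\<Lambda> g) + j ((-1) *\<^sub>C \<Lambda> \<one>\<^bsub>G\<^esub>)"
        by (rule hom(1)[OF mem[OF gG]])
      also have "j ((-1) *\<^sub>C \<Lambda> \<one>\<^bsub>G\<^esub>) = (-1) *\<^sub>C j (\<Lambda> \<one>\<^bsub>G\<^esub>)"
        by (rule hom(4)[OF mem[OF one_closed] mem[OF one_closed]])
      finally show ?thesis
        by (simp add: a_def numeral_2_eq_2)
    qed
    ultimately show ?thesis
      by (simp add: je)
  qed
  show ?thesis
  proof (rule normal_invI[OF sub])
    fix x g
    assume x: "x \<in> carrier G" and g: "g \<in> ?H"
    then have gG: "g \<in> carrier G"
      by auto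
    have "j (\<Lambda> (x \<otimes>\<^bsub>G\<^esub> g \<otimes>\<^bsub>G\<^esub> inv\<^bsub>G\<^esub> x)) = (j (\<Lambda> x) o\<^sub>L j (\<Lambda> g)) o\<^sub>L j (\<Lambda> (inv\<^bsub>G\<^esub> x))"
      using x gG by (simp add: left_translation_mult[OF grp, symmetric] hom(2) mem group_cstar_compose[OF grp])
    also have "j (\<Lambda> x) o\<^sub>L j (\<Lambda> g) = j (\<Lambda> x)"
      using e hom(5)[OF mem[OF x] mem[OF x]] by (simp add: triv[OF g] is_unit_def)
    also have "j (\<Lambda> x) o\<^sub>L j (\<Lambda> (inv\<^bsub>G\<^esub> x)) = e"
      using x by (simp add: hom(2)[symmetric] mem left_translation_mult[OF grp] je)
    finally have "\<phi> (\<Lambda> (x \<otimes>\<^bsub>G\<^esub> g \<otimes>\<^bsub>G\<^esub> inv\<^bsub>G\<^esub> x)) = h e"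
      using x gG by (simp add: \<phi> mem)
    also have "h e = 1"
      using h(1) unit_of_eqI[OF e] by (simp add: haar_state_def state_def)
    finally show "x \<otimes>\<^bsub>G\<^esub> g \<otimes>\<^bsub>G\<^esub> inv\<^bsub>G\<^esub> x \<in> ?H"
      using x gG unfolding state_subgroup_def by simp
  qed
qed

lemma normal_imp_haar_idempotent:
  fixes \<iota> :: "'g \<Rightarrow> 'x"
  assumes idem: "idempotent_state A \<Delta> \<phi>" and normal: "normal (state_subgroup G \<phi>) G"
    and "amenable G" "inj_on \<iota> (carrier G)"
  shows "haar_idempotent TYPE('x) A \<Delta> \<phi>"
proof -
  let ?H = "state_subgroup G \<phi>"
  obtain K :: "'x monoid" and \<pi> where K: "group K" and \<pi>: "\<pi> \<in> hom G K" "\<pi> ` carrier G = carrier K"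
    and ker: "\<And>g. g \<in> carrier G \<Longrightarrow> \<pi> g = \<one>\<^bsub>K\<^esub> \<longleftrightarrow> g \<in> ?H"
    using quotient_realization[OF grp normal assms(4)] by blast
  have aivK: "almost_invariant_vectors K"
    by (rule amenable_almost_invariant_vectors[OF K amenable_quotient[OF assms(3) \<pi> grp]])
  let ?B = "group_cstar K"
  obtain j where j: "unital_star_hom A ?B j" "bounded_clinear_on A j"
    "\<And>g. g \<in> carrier G \<Longrightarrow> j (\<Lambda> g) = left_translation K (\<pi> g)"
    using group_cstar_functorial[OF grp K aiv \<pi>(1)] by blast
  have jB: "j a \<in> ?B" if "a \<in> A" for a
    using j(1) that by (auto simp: unital_star_hom_def)
  have piK: "\<pi> g \<in> carrier K" if "g \<in> carrier G" for g
    using hom_in_carrier[OF \<pi>(1) that] .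
  have "complex_vector.subspace (j ` A)"
    unfolding complex_vector.subspace_def
  proof (intro conjI ballI allI)
    have lin: "j (x + y) = j x + j y" "j (c *\<^sub>C x) = c *\<^sub>C j x" "j 0 = 0" if "x \<in> A" "y \<in> A" for x y c
      using bounded_clinear_on_linear[OF j(2) that subspace_group_cstar[OF grp]] by auto
    note A = complex_vector.subspace_0[OF subspace_group_cstar[OF grp]]
      complex_vector.subspace_add[OF subspace_group_cstar[OF grp]]
      complex_vector.subspace_scale[OF subspace_group_cstar[OF grp]]
    show "0 \<in> j ` A"
      using lin(3)[OF A(1) A(1)] A(1) by (intro image_eqI[of _ _ 0]) simp_all
    show "x + y \<in> j ` A" if "x \<in> j ` A" "y \<in> j ` A" for x y
      using that by (auto simp: lin(1)[symmetric] intro!: imageI A(2))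
    show "c *\<^sub>C x \<in> j ` A" if "x \<in> j ` A" for c x
      using that by (auto simp: lin(2)[symmetric] intro!: imageI A(3))
  qed
  \<comment> \<open>The range contains all translations of K because \<pi> is onto, so its closure,
    a closed subspace, contains their closed span.\<close>
  then have "?B \<subseteq> closure (j ` A)"
    unfolding group_cstar_eq(1)[OF K]
  proof (intro cspace_minimal subspace_closure)
    show "left_translation K ` carrier K \<subseteq> closure (j ` A)"
    proof -
      have "left_translation K (\<pi> g) \<in> j ` A" if "g \<in> carrier G" for g
        using j(3)[OF that] left_translation_in_group_cstar[OF grp that]
          by (intro image_eqI[of _ _ "\<Lambda> g"]) simp_all
      then show ?thesis
        unfolding \<pi>(2)[symmetric] using closure_subset[of "j ` A"] by blast
    qed
  qed simp_all
  then have surj: "j ` A = ?B"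
    by (rule star_hom_surj[OF group_cstar_eq(2)[OF grp] is_unit_group_cstar[OF grp] group_cstar_eq(2)[OF K]
          is_unit_group_cstar[OF K] j(1,2)])
  obtain J where J: "tensor_hom A A ?B ?B j j J" "bounded_clinear_on (group_cstar (G \<times>\<times> G)) J"
    by (rule group_cstar_functorial_tensor[OF grp grp K K almost_invariant_vectors_prod[OF grp grp aiv
      aiv] \<pi>(1) \<pi>(1)
          j(2) _ j(3) j(2) _ j(3)]) (use jB in auto)
  have "dual_coproduct K (j a) = J (\<Delta> a)" if "a \<in> A" for a
  proof (rule group_cstar_eqI[OF grp _ _ _ that])
    show "bounded_clinear_on A (\<lambda>a. dual_coproduct K (j a))"
      by (rule bounded_clinear_on_compose[OF j(2) dual_coproduct(2)[OF K aivK]]) (use jB in auto)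
    show "bounded_clinear_on A (\<lambda>a. J (\<Delta> a))"
      by (rule bounded_clinear_on_compose[OF dual_coproduct(2)[OF grp aiv] J(2)])
        (use dual_coproduct_range[OF grp aiv] in auto)
    fix g
    assume g: "g \<in> carrier G"
    then have "J (\<Lambda> g \<otimes>\<^sub>o \<Lambda> g) = j (\<Lambda> g) \<otimes>\<^sub>o j (\<Lambda> g)"
      using J(1) left_translation_in_group_cstar[OF grp g] unfolding tensor_hom_def by blast
    then show "dual_coproduct K (j (\<Lambda> g)) = J (\<Delta> (\<Lambda> g))"
      using g by (simp add: dual_coproduct(3)[OF grp aiv] dual_coproduct(3)[OF K aivK] j(3) piK)
  qed
  then have qs: "quantum_subgroup A \<Delta> ?B (dual_coproduct K) j"
    unfolding quantum_subgroup_def using compact_quantum_group_dual[OF K aivK] j(1) surj J(1) by blast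
  let ?h = "canonical_trace K"
  have st: "state A \<phi>"
    using idem by (simp add: idempotent_state_def)
  \<comment> \<open>On translations both sides are the indicator of the subgroup, since the trace of
    K detects the kernel of \<pi>.\<close>
  have "\<phi> a = ?h (j a)" if "a \<in> A" for a
  proof (rule group_cstar_eqI[OF grp state_bounded[OF grp st] _ _ that])
    show "bounded_clinear_on A (\<lambda>a. ?h (j a))"
      by (rule bounded_clinear_on_compose[OF j(2) canonical_trace_bounded[OF K]]) (use jB in auto)
    show "\<phi> (\<Lambda> g) = ?h (j (\<Lambda> g))" if "g \<in> carrier G" for g
      using that by (simp add: idempotent_state_values[OF idem] j(3) canonical_trace_generator[OF K] piK ker)
  qed
  then have "\<phi> = restrict (?h \<circ> j) A"
    using st by (intro extensionalityI[of _ A]) (auto simp: state_def)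
  then show ?thesis
    unfolding haar_idempotent_def
    using qs haar_state_canonical_trace[OF K aivK] faithful_canonical_trace[OF K] by blast
qed

end

theorem theorem3p7:
  fixes G :: "'g monoid" and \<iota> :: "'g \<Rightarrow> 'x"
  assumes "group G" and "amenable G"
    and universe: "inj_on \<iota> (carrier G)"
  shows "bij_betw (state_subgroup G)
           {\<phi>. idempotent_state (group_cstar G) (dual_coproduct G) \<phi>} {H. subgroup H G}
       \<and> (\<forall>\<phi>. idempotent_state (group_cstar G) (dual_coproduct G) \<phi> \<longrightarrow>
            (haar_idempotent TYPE('x) (group_cstar G) (dual_coproduct G) \<phi>
               \<longleftrightarrow> normal (state_subgroup G \<phi>) G))"
proof -
  have aiv: "almost_invariant_vectors G"
    by (rule amenable_almost_invariant_vectors[OF assms(1,2)])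
  show ?thesis
    using bij_betw_state_subgroup[OF assms(1) aiv] haar_idempotent_imp_normal[OF assms(1) aiv]
      normal_imp_haar_idempotent[OF assms(1) aiv _ _ assms(2) universe] by blast
qed

end
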